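(* Let $\underline{\Sigma}$ be a manifold with corners and let $\Sigma=\Sigma^{\mathrm{bas}}$ be the associated basic manifold with log corners. Let $*$ denote the one-point manifold with the trivial positive log structure $\mathcal{M}_*=\mathbb{R}_{>0}$. Then there is a natural bijection between the set of virtual morphisms $*\to\Sigma$ and the set of tangential basepoints of $\underline{\Sigma}$.
   Context: Monoids are commutative and $\mathbb{N}=\{0,1,2,\dots\}$. A map between subsets of Euclidean spaces is smooth if it extends to a smooth map on an open neighbourhood. A manifold with corners is a second countable Hausdorff space with a maximal atlas of charts onto open subsets of orthants $[0,\infty)^n$ with diffeomorphic transition maps. $\mathcal{C}^{\infty}\supset\mathcal{C}^{\infty,\ge 0}\supset\mathcal{C}^{\infty,>0}$ denote the sheaves of smooth functions with real, non-negative, positive values. A positive log structure on a manifold with corners $\underline\Sigma$ is a sheaf of monoids $\mathcal{M}_\Sigma$ with a morphism $\alpha:\mathcal{M}_\Sigma\to\mathcal{C}^{\infty,\ge0}_\Sigma$ (multiplicative monoid) such that $\alpha^{-1}(\mathcal{C}^{\infty,>0}_\Sigma)\to\mathcal{C}^{\infty,>0}_\Sigma$ is an isomorphism; one thereby views $\mathcal{C}^{\infty,>0}_\Sigma\subset\mathcal{M}_\Sigma$. The basic manifold with log corners $\Sigma^{\mathrm{bas}}$ associated with $\underline\Sigma$ is $\underline\Sigma$ equipped with the subsheaf $\mathcal{M}\subset\mathcal{C}^{\infty,\ge0}$ of functions which in local coordinates $(r_1,\dots,r_n)\in[0,\infty)^n$ have the form $g(r)\,r_1^{j_1}\cdots r_n^{j_n}$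 with $g$ positive smooth and $j_i\in\mathbb{N}$, with $\alpha$ the inclusion. $\mathcal{M}^{\mathrm{gp}}$ is the group completion. A virtual morphism $\phi:\Sigma\to\Psi$ is a pair $(\underline\phi,\phi^* )$ with $\underline\phi:\underline\Sigma\to\underline\Psi$ smooth and $\phi^*:\underline\phi^{-1}\mathcal{M}^{\mathrm{gp}}_\Psi\to\mathcal{M}^{\mathrm{gp}}_\Sigma$ a morphism of sheaves of groups which restricts on $\underline\phi^{-1}\mathcal{C}^{\infty,>0}_\Psi$ to the usual pullback $\underline\phi^*$ into $\mathcal{C}^{\infty,>0}_\Sigma$. Let $x\in\underline\Sigma$ and choose coordinates with $r_1(x)=\dots=r_j(x)=0$ and $r_{j+1}(x),\dots,r_n(x)>0$. The tangent face is $F_x=\{v\in T_x\underline\Sigma: dr_1(v)=\dots=dr_j(v)=0\}$, the normal space is $N_x=T_x\underline\Sigma/F_x$, with basis $\partial_{r_1}|_x,\dots,\partial_{r_j}|_x$, and the positive normal space $N_x^{>0}\subset N_x$ consists of the vectors $\sum_{i\le j}v_i\partial_{r_i}|_x$ with all $v_i>0$ (if $j=0$, it consists of the zero vector only). A tangential basepoint of $\underline\Sigma$ is a pair $(x,v)$ with $x\in\underline\Sigma$ and $v\in N_x^{>0}$. The natural bijection in question is the one matching $(x,\sum_{i\le j}v_i\partial_{r_i}|_x)$ with the virtual morphism $s:*\to\Sigma$ whose underlying map has image $x$ and for which $s^*r_i=v_i$ for $1\le i\le j$ and $s^*r_i=r_i(x)$ for $j<i\le n$. *)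

theory Defs
  imports "HOL-Analysis.Analysis" "HOL-Algebra.Group"
begin

section \<open>Smooth maps between subsets of Euclidean spaces\<close>

text \<open>
  The dimension varies from chart to chart, so points of $n$-space are the points of
  \<^const>\<open>Euclidean_space\<close> $n$: functions on the naturals that vanish from index $n$ on.
\<close>

primrec cont_diff :: "nat \<Rightarrow> nat \<Rightarrow> (nat \<Rightarrow> real) set \<Rightarrow> ((nat \<Rightarrow> real) \<Rightarrow> real) \<Rightarrow> bool" where
  "cont_diff 0 n W f \<longleftrightarrow>
     continuous_map (subtopology (Euclidean_space n) W) euclideanreal f"
| "cont_diff (Suc k) n W f \<longleftrightarrow>
     continuous_map (subtopology (Euclidean_space n) W) euclideanreal f \<and>
     (\<forall>i<n. \<exists>g. (\<forall>x\<in>W. ((\<lambda>t. f (x(i := t))) has_real_derivative g x) (at (x i))) \<and>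
                cont_diff k n W g)"

definition smooth_on :: "nat \<Rightarrow> (nat \<Rightarrow> real) set \<Rightarrow> ((nat \<Rightarrow> real) \<Rightarrow> real) \<Rightarrow> bool" where
  "smooth_on n A f \<longleftrightarrow>
     (\<exists>W F. openin (Euclidean_space n) W \<and> A \<subseteq> W \<and> (\<forall>k. cont_diff k n W F) \<and>
            (\<forall>x\<in>A. F x = f x))"

definition smooth_map ::
    "nat \<Rightarrow> nat \<Rightarrow> (nat \<Rightarrow> real) set \<Rightarrow> ((nat \<Rightarrow> real) \<Rightarrow> nat \<Rightarrow> real) \<Rightarrow> bool" where
  "smooth_map n m A f \<longleftrightarrow> (\<forall>i<m. smooth_on n A (\<lambda>x. f x i))"

definition orthant :: "nat \<Rightarrow> (nat \<Rightarrow> real) set" where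
  "orthant n = {x \<in> topspace (Euclidean_space n). \<forall>i<n. 0 \<le> x i}"


section \<open>Manifolds with corners\<close>

record 'a chart =
  cdim :: nat
  cdom :: "'a set"
  coord :: "'a \<Rightarrow> nat \<Rightarrow> real"

text \<open>Only the values of \<^const>\<open>coord\<close> on \<^const>\<open>cdom\<close> matter.\<close>

definition chart_inv :: "'a chart \<Rightarrow> (nat \<Rightarrow> real) \<Rightarrow> 'a" where
  "chart_inv c = inv_into (cdom c) (coord c)"

definition corner_chart :: "'a topology \<Rightarrow> 'a chart \<Rightarrow> bool" where
  "corner_chart X c \<longleftrightarrow>
     openin X (cdom c) \<and>
     openin (subtopology (Euclidean_space (cdim c)) (orthant (cdim c))) (coord c ` cdom c) \<and>
     homeomorphic_map (subtopology X (cdom c))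
       (subtopology (Euclidean_space (cdim c)) (coord c ` cdom c)) (coord c)"

definition compatible :: "'a chart \<Rightarrow> 'a chart \<Rightarrow> bool" where
  "compatible c d \<longleftrightarrow>
     smooth_map (cdim c) (cdim d) (coord c ` (cdom c \<inter> cdom d)) (coord d \<circ> chart_inv c) \<and>
     smooth_map (cdim d) (cdim c) (coord d ` (cdom c \<inter> cdom d)) (coord c \<circ> chart_inv d)"

record 'a corners =
  points :: "'a topology"
  atlas :: "'a chart set"

definition manifold_with_corners :: "'a corners \<Rightarrow> bool" where
  "manifold_with_corners M \<longleftrightarrow>
     second_countable (points M) \<and> Hausdorff_space (points M) \<and>
     (\<forall>c\<in>atlas M. corner_chart (points M) c) \<and>
     topspace (points M) \<subseteq> \<Union> (cdom ` atlas M) \<and>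
     (\<forall>c\<in>atlas M. \<forall>d\<in>atlas M. compatible c d) \<and>
     (\<forall>c. corner_chart (points M) c \<and> (\<forall>d\<in>atlas M. compatible c d) \<longrightarrow> c \<in> atlas M)"

definition smooth_maps :: "'a corners \<Rightarrow> 'b corners \<Rightarrow> ('a \<Rightarrow> 'b) set" where
  "smooth_maps M N =
     {\<phi> \<in> extensional (topspace (points M)).
        continuous_map (points M) (points N) \<phi> \<and>
        (\<forall>c\<in>atlas M. \<forall>d\<in>atlas N. \<forall>x \<in> cdom c. \<phi> x \<in> cdom d \<longrightarrow>
           (\<exists>V. openin (points M) V \<and> x \<in> V \<and> V \<subseteq> cdom c \<and> \<phi> ` V \<subseteq> cdom d \<and>
                smooth_map (cdim c) (cdim d) (coord c ` V) (coord d \<circ> \<phi> \<circ> chart_inv c)))}"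

text \<open>Sections over \<open>U\<close> of the sheaves of smooth functions with real, non-negative, positive
  values. Functions on \<open>U\<close> are \<^const>\<open>undefined\<close> outside \<open>U\<close>.\<close>

definition smooth_functions :: "'a corners \<Rightarrow> 'a set \<Rightarrow> ('a \<Rightarrow> real) set" where
  "smooth_functions M U =
     {f \<in> extensional U. \<forall>c\<in>atlas M. \<forall>x \<in> U \<inter> cdom c.
        \<exists>V. openin (points M) V \<and> x \<in> V \<and> V \<subseteq> U \<inter> cdom c \<and>
            smooth_on (cdim c) (coord c ` V) (f \<circ> chart_inv c)}"

definition nonneg_functions :: "'a corners \<Rightarrow> 'a set \<Rightarrow> ('a \<Rightarrow> real) set" where
  "nonneg_functions M U = {f \<in> smooth_functions M U. \<forall>x\<in>U. 0 \<le> f x}"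

definition pos_functions :: "'a corners \<Rightarrow> 'a set \<Rightarrow> ('a \<Rightarrow> real) set" where
  "pos_functions M U = {f \<in> smooth_functions M U. \<forall>x\<in>U. 0 < f x}"

definition point_manifold :: "unit corners" where
  "point_manifold =
     \<lparr>points = discrete_topology UNIV,
      atlas = {c. corner_chart (discrete_topology UNIV) c \<and>
                  compatible c \<lparr>cdim = 0, cdom = UNIV, coord = (\<lambda>_ _. 0)\<rparr>}\<rparr>"


section \<open>Sheaves of commutative monoids\<close>

record ('a, 'm) presheaf =
  base :: "'a topology"
  sections :: "'a set \<Rightarrow> 'm monoid"
  restr :: "'a set \<Rightarrow> 'a set \<Rightarrow> 'm \<Rightarrow> 'm"  \<comment> \<open>\<open>restr U V\<close> maps sections over \<open>U\<close> to sections over \<open>V \<subseteq> U\<close>\<close>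

definition monoid_presheaf :: "('a, 'm) presheaf \<Rightarrow> bool" where
  "monoid_presheaf F \<longleftrightarrow>
     (\<forall>U. openin (base F) U \<longrightarrow> comm_monoid (sections F U)) \<and>
     (\<forall>U V. openin (base F) U \<and> openin (base F) V \<and> V \<subseteq> U \<longrightarrow>
        restr F U V \<in> hom (sections F U) (sections F V) \<and>
        restr F U V \<one>\<^bsub>sections F U\<^esub> = \<one>\<^bsub>sections F V\<^esub>) \<and>
     (\<forall>U s. openin (base F) U \<and> s \<in> carrier (sections F U) \<longrightarrow> restr F U U s = s) \<and>
     (\<forall>U V W s. openin (base F) U \<and> openin (base F) V \<and> openin (base F) W \<and>
        W \<subseteq> V \<and> V \<subseteq> U \<and> s \<in> carrier (sections F U) \<longrightarrow>
        restr F V W (restr F U V s) = restr F U W s)"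

definition monoid_sheaf :: "('a, 'm) presheaf \<Rightarrow> bool" where
  "monoid_sheaf F \<longleftrightarrow> monoid_presheaf F \<and>
     (\<forall>\<U> s. (\<forall>U\<in>\<U>. openin (base F) U \<and> s U \<in> carrier (sections F U)) \<and>
            (\<forall>U\<in>\<U>. \<forall>V\<in>\<U>. restr F U (U \<inter> V) (s U) = restr F V (U \<inter> V) (s V)) \<longrightarrow>
        (\<exists>!t. t \<in> carrier (sections F (\<Union>\<U>)) \<and> (\<forall>U\<in>\<U>. restr F (\<Union>\<U>) U t = s U)))"

definition presheaf_morphism ::
    "('a, 'm) presheaf \<Rightarrow> ('a, 'k) presheaf \<Rightarrow> ('a set \<Rightarrow> 'm \<Rightarrow> 'k) \<Rightarrow> bool" where
  "presheaf_morphism F G h \<longleftrightarrow>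
     (\<forall>U. openin (base F) U \<longrightarrow>
        h U \<in> hom (sections F U) (sections G U) \<and>
        h U \<one>\<^bsub>sections F U\<^esub> = \<one>\<^bsub>sections G U\<^esub>) \<and>
     (\<forall>U V s. openin (base F) U \<and> openin (base F) V \<and> V \<subseteq> U \<and> s \<in> carrier (sections F U) \<longrightarrow>
        h V (restr F U V s) = restr G U V (h U s))"

definition function_presheaf ::
    "'a topology \<Rightarrow> ('a set \<Rightarrow> ('a \<Rightarrow> real) set) \<Rightarrow> ('a, 'a \<Rightarrow> real) presheaf" where
  "function_presheaf X S =
     \<lparr>base = X,
      sections = (\<lambda>U. \<lparr>carrier = S U, mult = (\<lambda>f g. \<lambda>x\<in>U. f x * g x), one = (\<lambda>x\<in>U. 1)\<rparr>),
      restr = (\<lambda>U V f. restrict f V)\<rparr>"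

definition germ :: "('a, 'm) presheaf \<Rightarrow> 'a \<Rightarrow> 'a set \<Rightarrow> 'm \<Rightarrow> ('a set \<times> 'm) set" where
  "germ F x U s =
     {(V, t). openin (base F) V \<and> x \<in> V \<and> t \<in> carrier (sections F V) \<and>
        (\<exists>W. openin (base F) W \<and> x \<in> W \<and> W \<subseteq> U \<inter> V \<and> restr F U W s = restr F V W t)}"

definition stalk :: "('a, 'm) presheaf \<Rightarrow> 'a \<Rightarrow> ('a set \<times> 'm) set monoid" where
  "stalk F x =
     \<lparr>carrier = {germ F x U s | U s. openin (base F) U \<and> x \<in> U \<and> s \<in> carrier (sections F U)},
      mult = (\<lambda>p q. \<Union> {germ F x (U \<inter> V)
                        (restr F U (U \<inter> V) s \<otimes>\<^bsub>sections F (U \<inter> V)\<^esub> restr F V (U \<inter> V) t)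
                        | U s V t. (U, s) \<in> p \<and> (V, t) \<in> q}),
      one = germ F x (topspace (base F)) \<one>\<^bsub>sections F (topspace (base F))\<^esub>\<rparr>"

text \<open>
  The inverse image of \<open>F\<close> along a continuous map \<open>\<phi>\<close> from \<open>X\<close> to the base of \<open>F\<close>, i.e. the sheaf
  associated with the presheaf sending \<open>V\<close> to the colimit of \<open>F(W)\<close> over open \<open>W\<close> containing
  \<open>\<phi>(V)\<close>. Its stalk at \<open>x\<close> is the stalk of \<open>F\<close> at \<open>\<phi> x\<close>, and sections of an associated sheaf are
  families of germs that are locally induced by sections of the presheaf.
\<close>

definition pulled_back_section ::
    "('b, 'm) presheaf \<Rightarrow> ('a \<Rightarrow> 'b) \<Rightarrow> 'b set \<Rightarrow> 'm \<Rightarrow> 'a set \<Rightarrow> 'a \<Rightarrow> ('b set \<times> 'm) set" where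
  "pulled_back_section F \<phi> W s V = (\<lambda>x\<in>V. germ F (\<phi> x) W s)"

definition inverse_image ::
    "'a topology \<Rightarrow> ('a \<Rightarrow> 'b) \<Rightarrow> ('b, 'm) presheaf \<Rightarrow> ('a, 'a \<Rightarrow> ('b set \<times> 'm) set) presheaf" where
  "inverse_image X \<phi> F =
     \<lparr>base = X,
      sections = (\<lambda>V.
        \<lparr>carrier = {\<sigma> \<in> extensional V. \<forall>x\<in>V. \<exists>V' W s.
             openin X V' \<and> x \<in> V' \<and> V' \<subseteq> V \<and> openin (base F) W \<and> \<phi> ` V' \<subseteq> W \<and>
             s \<in> carrier (sections F W) \<and> restrict \<sigma> V' = pulled_back_section F \<phi> W s V'},
         mult = (\<lambda>\<sigma> \<tau>. \<lambda>x\<in>V. \<sigma> x \<otimes>\<^bsub>stalk F (\<phi> x)\<^esub> \<tau> x),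
         one = (\<lambda>x\<in>V. \<one>\<^bsub>stalk F (\<phi> x)\<^esub>)\<rparr>),
      restr = (\<lambda>U V \<sigma>. restrict \<sigma> V)\<rparr>"

definition sheafification :: "('a, 'm) presheaf \<Rightarrow> ('a, 'a \<Rightarrow> ('a set \<times> 'm) set) presheaf" where
  "sheafification F = inverse_image (base F) (\<lambda>x. x) F"


section \<open>Group completion\<close>

definition gp_rel :: "'m monoid \<Rightarrow> (('m \<times> 'm) \<times> ('m \<times> 'm)) set" where
  "gp_rel G =
     {((a, b), (c, d)). a \<in> carrier G \<and> b \<in> carrier G \<and> c \<in> carrier G \<and> d \<in> carrier G \<and>
        (\<exists>e\<in>carrier G. e \<otimes>\<^bsub>G\<^esub> (a \<otimes>\<^bsub>G\<^esub> d) = e \<otimes>\<^bsub>G\<^esub> (c \<otimes>\<^bsub>G\<^esub> b))}"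

definition group_completion :: "'m monoid \<Rightarrow> ('m \<times> 'm) set monoid" where
  "group_completion G =
     \<lparr>carrier = (carrier G \<times> carrier G) // gp_rel G,
      mult = (\<lambda>p q. gp_rel G `` {(a \<otimes>\<^bsub>G\<^esub> c, b \<otimes>\<^bsub>G\<^esub> d) | a b c d. (a, b) \<in> p \<and> (c, d) \<in> q}),
      one = gp_rel G `` {(\<one>\<^bsub>G\<^esub>, \<one>\<^bsub>G\<^esub>)}\<rparr>"

definition gp_presheaf :: "('a, 'm) presheaf \<Rightarrow> ('a, ('m \<times> 'm) set) presheaf" where
  "gp_presheaf F =
     \<lparr>base = base F,
      sections = (\<lambda>U. group_completion (sections F U)),
      restr = (\<lambda>U V p. gp_rel (sections F V) `` map_prod (restr F U V) (restr F U V) ` p)\<rparr>"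

type_synonym ('a, 'm) gp_section = "'a \<Rightarrow> ('a set \<times> ('m \<times> 'm) set) set"

definition gp_sheaf :: "('a, 'm) presheaf \<Rightarrow> ('a, ('a, 'm) gp_section) presheaf" where
  "gp_sheaf F = sheafification (gp_presheaf F)"

text \<open>The canonical morphism from \<open>F\<close> to its group completion.\<close>

definition to_gp :: "('a, 'm) presheaf \<Rightarrow> 'a set \<Rightarrow> 'm \<Rightarrow> ('a, 'm) gp_section" where
  "to_gp F U m =
     (\<lambda>x\<in>U. germ (gp_presheaf F) x U (gp_rel (sections F U) `` {(m, \<one>\<^bsub>sections F U\<^esub>)}))"


section \<open>Positive log structures\<close>

record ('a, 'm) log_corners =
  underlying :: "'a corners"
  log_sheaf :: "('a, 'm) presheaf"
  alpha :: "'a set \<Rightarrow> 'm \<Rightarrow> 'a \<Rightarrow> real"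

definition positive_log_structure :: "('a, 'm) log_corners \<Rightarrow> bool" where
  "positive_log_structure \<Sigma> \<longleftrightarrow>
     (let X = points (underlying \<Sigma>); F = log_sheaf \<Sigma> in
      base F = X \<and> monoid_sheaf F \<and>
      presheaf_morphism F (function_presheaf X (nonneg_functions (underlying \<Sigma>))) (alpha \<Sigma>) \<and>
      (\<forall>U. openin X U \<longrightarrow>
         bij_betw (alpha \<Sigma> U)
           {m \<in> carrier (sections F U). alpha \<Sigma> U m \<in> pos_functions (underlying \<Sigma>) U}
           (pos_functions (underlying \<Sigma>) U)))"

text \<open>The inclusion of the sheaf of positive smooth functions into the log sheaf.\<close>

definition of_pos :: "('a, 'm) log_corners \<Rightarrow> 'a set \<Rightarrow> ('a \<Rightarrow> real) \<Rightarrow> 'm" where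
  "of_pos \<Sigma> U f = (THE m. m \<in> carrier (sections (log_sheaf \<Sigma>) U) \<and> alpha \<Sigma> U m = f)"

definition trivial_log :: "'a corners \<Rightarrow> ('a, 'a \<Rightarrow> real) log_corners" where
  "trivial_log M =
     \<lparr>underlying = M,
      log_sheaf = function_presheaf (points M) (pos_functions M),
      alpha = (\<lambda>U f. f)\<rparr>"

text \<open>The local form is required in every chart; since transition maps carry coordinate functions to
  products of a coordinate or 1 with a positive smooth function, one chart around each point would
  do.\<close>

definition basic_sections :: "'a corners \<Rightarrow> 'a set \<Rightarrow> ('a \<Rightarrow> real) set" where
  "basic_sections M U =
     {f \<in> nonneg_functions M U. \<forall>c\<in>atlas M. \<forall>x \<in> U \<inter> cdom c.
        \<exists>V g j. openin (points M) V \<and> x \<in> V \<and> V \<subseteq> U \<inter> cdom c \<and> g \<in> pos_functions M V \<and>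
          (\<forall>y\<in>V. f y = g y * (\<Prod>i<cdim c. coord c y i ^ (j i :: nat)))}"

definition basic_log :: "'a corners \<Rightarrow> ('a, 'a \<Rightarrow> real) log_corners" where
  "basic_log M =
     \<lparr>underlying = M,
      log_sheaf = function_presheaf (points M) (basic_sections M),
      alpha = (\<lambda>U f. f)\<rparr>"

abbreviation point_log :: "(unit, unit \<Rightarrow> real) log_corners" where
  "point_log \<equiv> trivial_log point_manifold"

text \<open>
  A virtual morphism is a pair \<open>(\<phi>, h)\<close> where \<open>h\<close> is \<open>\<phi>\<^sup>*\<close>. Functions are required to be
  \<^const>\<open>undefined\<close> outside their domains, so that equality of pairs is equality of virtual
  morphisms. It suffices to state the last condition for the sections of the inverse image that are
  pulled back from a section, since these generate it locally.
\<close>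

definition virtual_morphisms ::
    "('a, 'm) log_corners \<Rightarrow> ('b, 'k) log_corners \<Rightarrow>
     (('a \<Rightarrow> 'b) \<times>
      ('a set \<Rightarrow> ('a \<Rightarrow> ('b set \<times> ('b, 'k) gp_section) set) \<Rightarrow> ('a, 'm) gp_section)) set" where
  "virtual_morphisms \<Sigma> \<Psi> =
     (let X = points (underlying \<Sigma>); Y = points (underlying \<Psi>);
          F = gp_sheaf (log_sheaf \<Sigma>); G = gp_sheaf (log_sheaf \<Psi>) in
      {(\<phi>, h). \<phi> \<in> smooth_maps (underlying \<Sigma>) (underlying \<Psi>) \<and>
         h \<in> extensional {V. openin X V} \<and>
         (\<forall>V. openin X V \<longrightarrow> h V \<in> extensional (carrier (sections (inverse_image X \<phi> G) V))) \<and>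
         presheaf_morphism (inverse_image X \<phi> G) F h \<and>
         (\<forall>V W f. openin X V \<and> openin Y W \<and> \<phi> ` V \<subseteq> W \<and> f \<in> pos_functions (underlying \<Psi>) W \<longrightarrow>
            h V (pulled_back_section G \<phi> W (to_gp (log_sheaf \<Psi>) W (of_pos \<Psi> W f)) V) =
            to_gp (log_sheaf \<Sigma>) V (of_pos \<Sigma> V (\<lambda>x\<in>V. f (\<phi> x))))})"


section \<open>Tangential basepoints\<close>

text \<open>Tangent vectors at \<open>x\<close> are derivations of the algebra of germs at \<open>x\<close> of smooth functions;
  a germ is represented by any function on the whole type inducing it.\<close>

definition smooth_near :: "'a corners \<Rightarrow> 'a \<Rightarrow> ('a \<Rightarrow> real) set" where
  "smooth_near M x =
     {f. \<exists>U. openin (points M) U \<and> x \<in> U \<and> restrict f U \<in> smooth_functions M U}"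

definition tangent_space :: "'a corners \<Rightarrow> 'a \<Rightarrow> (('a \<Rightarrow> real) \<Rightarrow> real) set" where
  "tangent_space M x =
     {D \<in> extensional (smooth_near M x). \<forall>f\<in>smooth_near M x. \<forall>g\<in>smooth_near M x.
        ((\<exists>U. openin (points M) U \<and> x \<in> U \<and> (\<forall>y\<in>U. f y = g y)) \<longrightarrow> D f = D g) \<and>
        D (\<lambda>y. f y + g y) = D f + D g \<and>
        (\<forall>a. D (\<lambda>y. a * f y) = a * D f) \<and>
        D (\<lambda>y. f y * g y) = f x * D g + g x * D f}"

text \<open>The indices of the coordinates that vanish at \<open>x\<close>. Coordinates are not reordered, so these
  need not be an initial segment.\<close>

definition zero_coords :: "'a chart \<Rightarrow> 'a \<Rightarrow> nat set" where
  "zero_coords c x = {i. i < cdim c \<and> coord c x i = 0}"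

definition tangent_face :: "'a corners \<Rightarrow> 'a \<Rightarrow> (('a \<Rightarrow> real) \<Rightarrow> real) set" where
  "tangent_face M x =
     {D \<in> tangent_space M x. \<forall>c\<in>atlas M. x \<in> cdom c \<longrightarrow>
        (\<forall>i\<in>zero_coords c x. D (\<lambda>y. coord c y i) = 0)}"

definition normal_rel ::
    "'a corners \<Rightarrow> 'a \<Rightarrow> ((('a \<Rightarrow> real) \<Rightarrow> real) \<times> (('a \<Rightarrow> real) \<Rightarrow> real)) set" where
  "normal_rel M x =
     {(D, E). D \<in> tangent_space M x \<and> E \<in> tangent_space M x \<and>
        (\<lambda>f\<in>smooth_near M x. D f - E f) \<in> tangent_face M x}"

definition normal_space :: "'a corners \<Rightarrow> 'a \<Rightarrow> (('a \<Rightarrow> real) \<Rightarrow> real) set set" where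
  "normal_space M x = tangent_space M x // normal_rel M x"

text \<open>The coordinate vector of \<open>c\<close> at \<open>x\<close> in direction \<open>i\<close>. The derivative is taken from the right
  because the \<open>i\<close>-th coordinate may vanish at \<open>x\<close>.\<close>

definition coord_vector :: "'a chart \<Rightarrow> 'a \<Rightarrow> nat \<Rightarrow> ('a \<Rightarrow> real) \<Rightarrow> real" where
  "coord_vector c x i f =
     vector_derivative (\<lambda>t. f (chart_inv c ((coord c x)(i := coord c x i + t)))) (at 0 within {0..})"

definition normal_vector ::
    "'a corners \<Rightarrow> 'a chart \<Rightarrow> 'a \<Rightarrow> (nat \<Rightarrow> real) \<Rightarrow> (('a \<Rightarrow> real) \<Rightarrow> real) set" where
  "normal_vector M c x v =
     normal_rel M x `` {\<lambda>f\<in>smooth_near M x. \<Sum>i\<in>zero_coords c x. v i * coord_vector c x i f}"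

definition positive_normal_space :: "'a corners \<Rightarrow> 'a \<Rightarrow> (('a \<Rightarrow> real) \<Rightarrow> real) set set" where
  "positive_normal_space M x =
     {N \<in> normal_space M x. \<exists>c\<in>atlas M. x \<in> cdom c \<and>
        (\<exists>v. (\<forall>i\<in>zero_coords c x. 0 < v i) \<and> N = normal_vector M c x v)}"

definition tangential_basepoints :: "'a corners \<Rightarrow> ('a \<times> (('a \<Rightarrow> real) \<Rightarrow> real) set) set" where
  "tangential_basepoints M = Sigma (topspace (points M)) (positive_normal_space M)"

text \<open>The \<open>i\<close>-th coordinate of \<open>c\<close> as a section of the group completed sheaf of the basic log
  structure, pulled back along the map from the point.\<close>

definition pulled_back_coord ::
    "'a corners \<Rightarrow> (unit \<Rightarrow> 'a) \<Rightarrow> 'a chart \<Rightarrow> nat \<Rightarrow>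
     unit \<Rightarrow> ('a set \<times> ('a, 'a \<Rightarrow> real) gp_section) set" where
  "pulled_back_coord M \<phi> c i =
     pulled_back_section (gp_sheaf (log_sheaf (basic_log M))) \<phi> (cdom c)
       (to_gp (log_sheaf (basic_log M)) (cdom c) (\<lambda>y\<in>cdom c. coord c y i)) UNIV"

text \<open>A positive real number as a section of the group completed sheaf of the point.\<close>

definition point_value :: "real \<Rightarrow> (unit, unit \<Rightarrow> real) gp_section" where
  "point_value a = to_gp (log_sheaf point_log) UNIV (\<lambda>_. a)"


section \<open>The trivial and the basic log structure are positive log structures\<close>

lemma cont_diff_subset: "cont_diff k n W f \<Longrightarrow> W' \<subseteq> W \<Longrightarrow> cont_diff k n W' f"
proof (induction k arbitrary: f)
  case 0
  then show ?case by (auto intro: continuous_map_from_subtopology_mono)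
next
  case (Suc k)
  have "\<exists>g. (\<forall>x\<in>W'. ((\<lambda>t. f (x(i := t))) has_real_derivative g x) (at (x i))) \<and> cont_diff k n W' g"
    if i: "i < n" for i
  proof -
    obtain g where g: "\<forall>x\<in>W. ((\<lambda>t. f (x(i := t))) has_real_derivative g x) (at (x i))"
      "cont_diff k n W g"
      using Suc.prems(1) i by auto
    show ?thesis
    proof (intro exI conjI ballI)
      show "((\<lambda>t. f (x(i := t))) has_real_derivative g x) (at (x i))" if "x \<in> W'" for x
        using g(1) Suc.prems(2) that by blast
      show "cont_diff k n W' g" using Suc.IH g(2) Suc.prems(2) .
    qed
  qed
  moreover have "continuous_map (subtopology (Euclidean_space n) W') euclideanreal f"
    using Suc.prems by (auto intro: continuous_map_from_subtopology_mono)
  ultimately show ?case by simp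
qed

lemma cont_diff_continuous:
  "cont_diff k n W f \<Longrightarrow> continuous_map (subtopology (Euclidean_space n) W) euclideanreal f"
  by (cases k) auto

lemma cont_diff_Suc_imp: "cont_diff (Suc k) n W f \<Longrightarrow> cont_diff k n W f"
proof (induction k arbitrary: f)
  case (Suc k)
  then show ?case by (metis cont_diff.simps(2))
qed simp

lemma cont_diff_const: "cont_diff k n W (\<lambda>_. a)"
proof (induction k arbitrary: a)
  case (Suc k)
  then show ?case by (auto intro!: exI[of _ "\<lambda>_. 0"])
qed simp

lemma cont_diff_add:
  "cont_diff k n W f \<Longrightarrow> cont_diff k n W g \<Longrightarrow> cont_diff k n W (\<lambda>x. f x + g x)"
proof (induction k arbitrary: f g)
  case 0
  then show ?case by (auto intro: continuous_map_add)
next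
  case (Suc k)
  have "\<exists>h. (\<forall>x\<in>W. ((\<lambda>t. f (x(i := t)) + g (x(i := t))) has_real_derivative h x) (at (x i))) \<and>
      cont_diff k n W h" if "i < n" for i
  proof -
    obtain f' g' where "\<forall>x\<in>W. ((\<lambda>t. f (x(i := t))) has_real_derivative f' x) (at (x i))"
      "cont_diff k n W f'" "\<forall>x\<in>W. ((\<lambda>t. g (x(i := t))) has_real_derivative g' x) (at (x i))"
      "cont_diff k n W g'"
      using Suc.prems \<open>i < n\<close> by (auto simp only: cont_diff.simps) metis
    then show ?thesis
      by (intro exI[of _ "\<lambda>x. f' x + g' x"]) (auto intro!: Suc.IH DERIV_add)
  qed
  then show ?case using Suc.prems by (auto intro: continuous_map_add)
qed

lemma cont_diff_mult:
  "cont_diff k n W f \<Longrightarrow> cont_diff k n W g \<Longrightarrow> cont_diff k n W (\<lambda>x. f x * g x)"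
proof (induction k arbitrary: f g)
  case 0
  then show ?case by (auto intro: continuous_map_real_mult)
next
  case (Suc k)
  have "\<exists>h. (\<forall>x\<in>W. ((\<lambda>t. f (x(i := t)) * g (x(i := t))) has_real_derivative h x) (at (x i))) \<and>
      cont_diff k n W h" if "i < n" for i
  proof -
    obtain f' g' where f': "\<forall>x\<in>W. ((\<lambda>t. f (x(i := t))) has_real_derivative f' x) (at (x i))"
      "cont_diff k n W f'" and g': "\<forall>x\<in>W. ((\<lambda>t. g (x(i := t))) has_real_derivative g' x) (at (x i))"
      "cont_diff k n W g'"
      using Suc.prems \<open>i < n\<close> by (auto simp only: cont_diff.simps) metis
    have "((\<lambda>t. f (x(i := t)) * g (x(i := t))) has_real_derivative f' x * g x + g' x * f x) (at (x i))"
      if "x \<in> W" for x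
      using DERIV_mult[OF bspec[OF f'(1) that] bspec[OF g'(1) that]] by simp
    moreover have "cont_diff k n W (\<lambda>x. f' x * g x + g' x * f x)"
      by (rule cont_diff_add[OF Suc.IH[OF f'(2) cont_diff_Suc_imp[OF Suc.prems(2)]]
            Suc.IH[OF g'(2) cont_diff_Suc_imp[OF Suc.prems(1)]]])
    ultimately show ?thesis by (intro exI[of _ "\<lambda>x. f' x * g x + g' x * f x"]) auto
  qed
  then show ?case using Suc.prems by (auto intro: continuous_map_real_mult)
qed

lemma smooth_on_const: "A \<subseteq> topspace (Euclidean_space n) \<Longrightarrow> smooth_on n A (\<lambda>_. a)"
  unfolding smooth_on_def
  by (intro exI[of _ "topspace (Euclidean_space n)"] exI[of _ "\<lambda>_. a"]) (simp add: cont_diff_const)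

lemma smooth_on_subset: "smooth_on n A f \<Longrightarrow> B \<subseteq> A \<Longrightarrow> smooth_on n B f"
  unfolding smooth_on_def by (elim exE, intro exI) (auto simp: subset_iff)

lemma smooth_on_cong: "smooth_on n A f \<Longrightarrow> (\<And>x. x \<in> A \<Longrightarrow> f x = g x) \<Longrightarrow> smooth_on n A g"
  unfolding smooth_on_def by (elim exE, intro exI) auto

lemma smooth_on_mult:
  assumes "smooth_on n A f" "smooth_on n A g"
  shows "smooth_on n A (\<lambda>x. f x * g x)"
proof -
  obtain W F where F: "openin (Euclidean_space n) W" "A \<subseteq> W" "\<forall>k. cont_diff k n W F"
    "\<forall>x\<in>A. F x = f x" using assms(1) unfolding smooth_on_def by blast
  obtain V G where G: "openin (Euclidean_space n) V" "A \<subseteq> V" "\<forall>k. cont_diff k n V G"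
    "\<forall>x\<in>A. G x = g x" using assms(2) unfolding smooth_on_def by blast
  have "cont_diff k n (W \<inter> V) (\<lambda>x. F x * G x)" for k
    using F(3) G(3) by (intro cont_diff_mult) (auto intro: cont_diff_subset)
  then show ?thesis unfolding smooth_on_def using F G
    by (intro exI[of _ "W \<inter> V"] exI[of _ "\<lambda>x. F x * G x"]) auto
qed

lemma chart_facts:
  assumes "manifold_with_corners M" "c \<in> atlas M"
  shows "openin (points M) (cdom c)"
    and "\<And>y. y \<in> cdom c \<Longrightarrow> chart_inv c (coord c y) = y"
    and "coord c ` cdom c \<subseteq> topspace (Euclidean_space (cdim c))"
proof -
  have c: "corner_chart (points M) c"
    using assms unfolding manifold_with_corners_def by blast
  then show "openin (points M) (cdom c)" by (simp add: corner_chart_def)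
  then have "topspace (subtopology (points M) (cdom c)) = cdom c"
    using openin_subset by (metis inf.absorb2 topspace_subtopology)
  then have "inj_on (coord c) (cdom c)"
    using homeomorphic_imp_injective_map[OF c[unfolded corner_chart_def, THEN conjunct2, THEN conjunct2]]
    by simp
  then show "chart_inv c (coord c y) = y" if "y \<in> cdom c" for y
    using that by (simp add: chart_inv_def)
  show "coord c ` cdom c \<subseteq> topspace (Euclidean_space (cdim c))"
    using openin_subset[OF c[unfolded corner_chart_def, THEN conjunct2, THEN conjunct1]]
    by auto
qed

lemma smooth_functions_one:
  assumes M: "manifold_with_corners M" and U: "openin (points M) U"
  shows "(\<lambda>x\<in>U. 1) \<in> smooth_functions M U"
proof -
  have "smooth_on (cdim c) (coord c ` (U \<inter> cdom c)) ((\<lambda>x\<in>U. 1) \<circ> chart_inv c)"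
    if c: "c \<in> atlas M" for c
    by (rule smooth_on_cong[OF smooth_on_const[where a = 1]])
      (use chart_facts[OF M c] in auto)
  moreover have "openin (points M) (U \<inter> cdom c)" if "c \<in> atlas M" for c
    using U chart_facts(1)[OF M that] by blast
  ultimately show ?thesis
    unfolding smooth_functions_def
    by (intro CollectI conjI ballI restrict_extensional exI[of _ "U \<inter> cdom _"]) auto
qed

lemma smooth_functions_mult:
  assumes M: "manifold_with_corners M" and f: "f \<in> smooth_functions M U"
    and g: "g \<in> smooth_functions M U"
  shows "(\<lambda>x\<in>U. f x * g x) \<in> smooth_functions M U"
proof -
  have "\<exists>V. openin (points M) V \<and> x \<in> V \<and> V \<subseteq> U \<inter> cdom c \<and>
      smooth_on (cdim c) (coord c ` V) ((\<lambda>x\<in>U. f x * g x) \<circ> chart_inv c)"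
    if c: "c \<in> atlas M" and x: "x \<in> U \<inter> cdom c" for c x
  proof -
    obtain V where V: "openin (points M) V" "x \<in> V" "V \<subseteq> U \<inter> cdom c"
      "smooth_on (cdim c) (coord c ` V) (f \<circ> chart_inv c)"
      using f c x unfolding smooth_functions_def by blast
    obtain W where W: "openin (points M) W" "x \<in> W" "W \<subseteq> U \<inter> cdom c"
      "smooth_on (cdim c) (coord c ` W) (g \<circ> chart_inv c)"
      using g c x unfolding smooth_functions_def by blast
    have "smooth_on (cdim c) (coord c ` (V \<inter> W)) (\<lambda>p. (f \<circ> chart_inv c) p * (g \<circ> chart_inv c) p)"
      by (intro smooth_on_mult smooth_on_subset[OF V(4)] smooth_on_subset[OF W(4)]) auto
    then have "smooth_on (cdim c) (coord c ` (V \<inter> W)) ((\<lambda>x\<in>U. f x * g x) \<circ> chart_inv c)"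
      by (rule smooth_on_cong) (use V(3) in \<open>auto simp: subset_iff chart_facts(2)[OF M c]\<close>)
    then show ?thesis using V W by (intro exI[of _ "V \<inter> W"]) auto
  qed
  then show ?thesis by (simp add: smooth_functions_def)
qed

lemma smooth_functions_restrict:
  assumes M: "manifold_with_corners M" and f: "f \<in> smooth_functions M U"
    and V: "openin (points M) V" "V \<subseteq> U"
  shows "restrict f V \<in> smooth_functions M V"
proof -
  have "\<exists>V'. openin (points M) V' \<and> x \<in> V' \<and> V' \<subseteq> V \<inter> cdom c \<and>
      smooth_on (cdim c) (coord c ` V') (restrict f V \<circ> chart_inv c)"
    if c: "c \<in> atlas M" and x: "x \<in> V \<inter> cdom c" for c x
  proof -
    obtain W where W: "openin (points M) W" "x \<in> W" "W \<subseteq> U \<inter> cdom c"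
      "smooth_on (cdim c) (coord c ` W) (f \<circ> chart_inv c)"
      using f c x V unfolding smooth_functions_def by blast
    have "smooth_on (cdim c) (coord c ` (V \<inter> W)) (f \<circ> chart_inv c)"
      by (rule smooth_on_subset[OF W(4)]) auto
    then have "smooth_on (cdim c) (coord c ` (V \<inter> W)) (restrict f V \<circ> chart_inv c)"
      by (rule smooth_on_cong) (use W(3) in \<open>auto simp: subset_iff chart_facts(2)[OF M c]\<close>)
    then show ?thesis using V W x by (intro exI[of _ "V \<inter> W"]) auto
  qed
  then show ?thesis by (simp add: smooth_functions_def)
qed

lemma smooth_functions_local:
  assumes M: "manifold_with_corners M" and f: "f \<in> extensional U"
    and loc: "\<And>x. x \<in> U \<Longrightarrow> \<exists>V. openin (points M) V \<and> x \<in> V \<and> V \<subseteq> U \<and>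
                restrict f V \<in> smooth_functions M V"
  shows "f \<in> smooth_functions M U"
proof -
  have "\<exists>V'. openin (points M) V' \<and> x \<in> V' \<and> V' \<subseteq> U \<inter> cdom c \<and>
      smooth_on (cdim c) (coord c ` V') (f \<circ> chart_inv c)"
    if c: "c \<in> atlas M" and x: "x \<in> U \<inter> cdom c" for c x
  proof -
    obtain V where V: "openin (points M) V" "x \<in> V" "V \<subseteq> U" "restrict f V \<in> smooth_functions M V"
      using loc x by blast
    then obtain W where W: "openin (points M) W" "x \<in> W" "W \<subseteq> V \<inter> cdom c"
      "smooth_on (cdim c) (coord c ` W) (restrict f V \<circ> chart_inv c)"
      using c x unfolding smooth_functions_def by blast
    have "smooth_on (cdim c) (coord c ` W) (f \<circ> chart_inv c)"
      by (rule smooth_on_cong[OF W(4)]) (use W(3) in \<open>auto simp: subset_iff chart_facts(2)[OF M c]\<close>)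
    then show ?thesis using V W by blast
  qed
  then show ?thesis using f unfolding smooth_functions_def by blast
qed

lemma monoid_sheaf_function_presheaf:
  assumes ext: "\<And>U. S U \<subseteq> extensional U"
    and one: "\<And>U. openin X U \<Longrightarrow> (\<lambda>x\<in>U. 1) \<in> S U"
    and mult: "\<And>U f g. openin X U \<Longrightarrow> f \<in> S U \<Longrightarrow> g \<in> S U \<Longrightarrow> (\<lambda>x\<in>U. f x * g x) \<in> S U"
    and res: "\<And>U V f. openin X V \<Longrightarrow> V \<subseteq> U \<Longrightarrow> f \<in> S U \<Longrightarrow> restrict f V \<in> S V"
    and loc: "\<And>U f. openin X U \<Longrightarrow> f \<in> extensional U \<Longrightarrow>
      (\<And>x. x \<in> U \<Longrightarrow> \<exists>V. openin X V \<and> x \<in> V \<and> V \<subseteq> U \<and> restrict f V \<in> S V) \<Longrightarrow> f \<in> S U"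
  shows "monoid_sheaf (function_presheaf X S)"
proof -
  have extD: "(\<lambda>x\<in>U. f x) = f" if "f \<in> S U" for f U
    using ext that extensional_restrict by blast
  have "comm_monoid \<lparr>carrier = S U, mult = (\<lambda>f g. \<lambda>x\<in>U. f x * g x), one = (\<lambda>x\<in>U. 1)\<rparr>"
    if "openin X U" for U
    by (rule comm_monoidI)
      (auto simp: that one mult fun_eq_iff mult.assoc mult.commute extD
            intro!: restrict_ext, (metis extD restrict_apply)+)
  moreover have "restrict (\<lambda>x\<in>U. f x * g x) V = (\<lambda>x\<in>V. restrict f V x * restrict g V x)"
    if "V \<subseteq> U" for U V and f g :: "'a \<Rightarrow> real"
    using that by (auto simp: fun_eq_iff)
  moreover have "restrict (\<lambda>x\<in>U. 1) V = (\<lambda>x\<in>V. 1 :: real)" if "V \<subseteq> U" for U V :: "'a set"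
    using that by (auto simp: fun_eq_iff)
  moreover have "restrict f U = f" if "f \<in> S U" for f U
    using extD[OF that] .
  moreover have "restrict (restrict f V) W = restrict f W" if "W \<subseteq> V" for V W and f :: "'a \<Rightarrow> real"
    using that by (auto simp: fun_eq_iff)
  ultimately have pre: "monoid_presheaf (function_presheaf X S)"
    unfolding monoid_presheaf_def function_presheaf_def
    by (auto simp add: hom_def res Int_absorb1 Int_absorb2 intro!: restrict_ext)
  have glue: "\<exists>!t. t \<in> S (\<Union>\<U>) \<and> (\<forall>U\<in>\<U>. restrict t U = s U)"
    if s: "\<forall>U\<in>\<U>. openin X U \<and> s U \<in> S U"
      and agree: "\<forall>U\<in>\<U>. \<forall>V\<in>\<U>. restrict (s U) (U \<inter> V) = restrict (s V) (U \<inter> V)" for \<U> s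
  proof -
    define t where "t = (\<lambda>x\<in>\<Union>\<U>. s (SOME U. U \<in> \<U> \<and> x \<in> U) x)"
    have eq: "t x = s U x" if "U \<in> \<U>" "x \<in> U" for x U
    proof -
      define V where "V = (SOME U. U \<in> \<U> \<and> x \<in> U)"
      have V: "V \<in> \<U> \<and> x \<in> V" unfolding V_def by (rule someI) (use that in blast)
      then have "restrict (s U) (U \<inter> V) x = restrict (s V) (U \<inter> V) x"
        using agree that by metis
      moreover have "t x = s V x" using that unfolding t_def V_def by auto
      ultimately show ?thesis using V that by auto
    qed
    have r: "restrict t U = s U" if "U \<in> \<U>" for U
    proof -
      have "restrict t U = (\<lambda>x\<in>U. s U x)" using eq that by (intro restrict_ext) auto
      then show ?thesis using extD s that by simp
    qed
    have "t \<in> S (\<Union>\<U>)"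
    proof (rule loc)
      show "openin X (\<Union>\<U>)" using s by blast
      show "t \<in> extensional (\<Union>\<U>)" by (simp add: t_def)
      fix x assume "x \<in> \<Union>\<U>"
      then obtain U where "U \<in> \<U>" "x \<in> U" by blast
      then show "\<exists>V. openin X V \<and> x \<in> V \<and> V \<subseteq> \<Union>\<U> \<and> restrict t V \<in> S V"
        using r s by (metis Union_upper)
    qed
    moreover have "t' = t" if t': "t' \<in> S (\<Union>\<U>)" "\<forall>U\<in>\<U>. restrict t' U = s U" for t'
    proof (rule extensionalityI[of _ "\<Union>\<U>"])
      show "t' \<in> extensional (\<Union>\<U>)" using ext t'(1) by blast
      show "t \<in> extensional (\<Union>\<U>)" by (simp add: t_def)
      fix x assume "x \<in> \<Union>\<U>"
      then obtain U where U: "U \<in> \<U>" "x \<in> U" by blast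
      then have "restrict t' U x = restrict t U x" using t'(2) r by simp
      then show "t' x = t x" using U by simp
    qed
    ultimately show ?thesis using r by blast
  qed
  show ?thesis
    unfolding monoid_sheaf_def
  proof (intro conjI pre allI impI, elim conjE)
    fix \<U> s
    assume "\<forall>U\<in>\<U>. openin (base (function_presheaf X S)) U \<and>
        s U \<in> carrier (sections (function_presheaf X S) U)"
      "\<forall>U\<in>\<U>. \<forall>V\<in>\<U>. restr (function_presheaf X S) U (U \<inter> V) (s U) =
        restr (function_presheaf X S) V (U \<inter> V) (s V)"
    then show "\<exists>!t. t \<in> carrier (sections (function_presheaf X S) (\<Union>\<U>)) \<and>
        (\<forall>U\<in>\<U>. restr (function_presheaf X S) (\<Union>\<U>) U t = s U)"
      using glue[of \<U> s] by (simp add: function_presheaf_def)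
  qed
qed

lemma pos_functions_subset_basic:
  assumes M: "manifold_with_corners M" and U: "openin (points M) U"
  shows "pos_functions M U \<subseteq> basic_sections M U"
proof
  fix f assume f: "f \<in> pos_functions M U"
  have "\<exists>V g j. openin (points M) V \<and> x \<in> V \<and> V \<subseteq> U \<inter> cdom c \<and> g \<in> pos_functions M V \<and>
      (\<forall>y\<in>V. f y = g y * (\<Prod>i<cdim c. coord c y i ^ (j i :: nat)))"
    if c: "c \<in> atlas M" and x: "x \<in> U \<inter> cdom c" for c x
  proof (intro exI conjI)
    show V: "openin (points M) (U \<inter> cdom c)" using U chart_facts(1)[OF M c] by blast
    show "restrict f (U \<inter> cdom c) \<in> pos_functions M (U \<inter> cdom c)"
      using f smooth_functions_restrict[OF M _ V] by (auto simp: pos_functions_def)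
    show "\<forall>y\<in>U \<inter> cdom c. f y = restrict f (U \<inter> cdom c) y * (\<Prod>i<cdim c. coord c y i ^ 0)"
      by simp
  qed (use x in auto)
  then show "f \<in> basic_sections M U"
    using f by (auto simp: basic_sections_def nonneg_functions_def pos_functions_def
        intro: less_imp_le)
qed

lemma monoid_sheaf_pos:
  assumes M: "manifold_with_corners M"
  shows "monoid_sheaf (function_presheaf (points M) (pos_functions M))"
proof (rule monoid_sheaf_function_presheaf)
  fix U f assume "openin (points M) U" and f: "f \<in> extensional U"
    and loc: "\<And>x. x \<in> U \<Longrightarrow>
      \<exists>V. openin (points M) V \<and> x \<in> V \<and> V \<subseteq> U \<and> restrict f V \<in> pos_functions M V"
  have "f \<in> smooth_functions M U"
    by (rule smooth_functions_local[OF M f]) (use loc in \<open>fastforce simp: pos_functions_def\<close>)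
  moreover have "0 < f x" if "x \<in> U" for x
    using loc[OF that] by (auto simp: pos_functions_def)
  ultimately show "f \<in> pos_functions M U" by (simp add: pos_functions_def)
next
  show "pos_functions M U \<subseteq> extensional U" for U
    by (auto simp: pos_functions_def smooth_functions_def)
  show "(\<lambda>x\<in>U. 1) \<in> pos_functions M U" if "openin (points M) U" for U
    using smooth_functions_one[OF M that] by (auto simp: pos_functions_def)
  show "(\<lambda>x\<in>U. f x * g x) \<in> pos_functions M U" if "f \<in> pos_functions M U" "g \<in> pos_functions M U"
    for U f g
    using smooth_functions_mult[OF M] that by (auto simp: pos_functions_def)
  show "restrict f V \<in> pos_functions M V"
    if "openin (points M) V" "V \<subseteq> U" "f \<in> pos_functions M U" for U V f
    using smooth_functions_restrict[OF M] that by (auto simp: pos_functions_def)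
qed

lemma monoid_sheaf_basic:
  assumes M: "manifold_with_corners M"
  shows "monoid_sheaf (function_presheaf (points M) (basic_sections M))"
proof (rule monoid_sheaf_function_presheaf)
  show "basic_sections M U \<subseteq> extensional U" for U
    by (auto simp: basic_sections_def nonneg_functions_def smooth_functions_def)
  show "(\<lambda>x\<in>U. 1) \<in> basic_sections M U" if "openin (points M) U" for U
    using pos_functions_subset_basic[OF M that] smooth_functions_one[OF M that]
    by (auto simp: pos_functions_def)
next
  fix U f g assume U: "openin (points M) U" and f: "f \<in> basic_sections M U"
    and g: "g \<in> basic_sections M U"
  have "\<exists>V h j. openin (points M) V \<and> x \<in> V \<and> V \<subseteq> U \<inter> cdom c \<and> h \<in> pos_functions M V \<and>
      (\<forall>y\<in>V. (\<lambda>x\<in>U. f x * g x) y = h y * (\<Prod>i<cdim c. coord c y i ^ (j i :: nat)))"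
    if c: "c \<in> atlas M" and x: "x \<in> U \<inter> cdom c" for c x
  proof -
    obtain V1 h1 j1 where 1: "openin (points M) V1" "x \<in> V1" "V1 \<subseteq> U \<inter> cdom c"
      "h1 \<in> pos_functions M V1"
      "\<forall>y\<in>V1. f y = h1 y * (\<Prod>i<cdim c. coord c y i ^ (j1 i :: nat))"
      using f c x unfolding basic_sections_def by blast
    obtain V2 h2 j2 where 2: "openin (points M) V2" "x \<in> V2" "V2 \<subseteq> U \<inter> cdom c"
      "h2 \<in> pos_functions M V2"
      "\<forall>y\<in>V2. g y = h2 y * (\<Prod>i<cdim c. coord c y i ^ (j2 i :: nat))"
      using g c x unfolding basic_sections_def by blast
    have V: "openin (points M) (V1 \<inter> V2)" using 1 2 by blast
    have "(\<lambda>y\<in>V1 \<inter> V2. restrict h1 (V1 \<inter> V2) y * restrict h2 (V1 \<inter> V2) y) \<in> pos_functions M (V1 \<inter> V2)"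
      using smooth_functions_mult[OF M smooth_functions_restrict[OF M _ V] smooth_functions_restrict[OF M _ V]] 1(4) 2(4)
      by (auto simp: pos_functions_def)
    then show ?thesis
      using 1 2 V
      by (intro exI[of _ "V1 \<inter> V2"] exI[of _ "\<lambda>y\<in>V1 \<inter> V2. restrict h1 (V1 \<inter> V2) y * restrict h2 (V1 \<inter> V2) y"]
           exI[of _ "\<lambda>i. j1 i + j2 i"]) (auto simp: power_add prod.distrib subset_iff)
  qed
  then show "(\<lambda>x\<in>U. f x * g x) \<in> basic_sections M U"
    using f g smooth_functions_mult[OF M]
    by (auto simp: basic_sections_def nonneg_functions_def)
next
  fix U V f assume V: "openin (points M) V" "V \<subseteq> U" and f: "f \<in> basic_sections M U"
  have "\<exists>V' g j. openin (points M) V' \<and> x \<in> V' \<and> V' \<subseteq> V \<inter> cdom c \<and> g \<in> pos_functions M V' \<and>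
      (\<forall>y\<in>V'. restrict f V y = g y * (\<Prod>i<cdim c. coord c y i ^ (j i :: nat)))"
    if c: "c \<in> atlas M" and x: "x \<in> V \<inter> cdom c" for c x
  proof -
    obtain W g j where W: "openin (points M) W" "x \<in> W" "W \<subseteq> U \<inter> cdom c" "g \<in> pos_functions M W"
      "\<forall>y\<in>W. f y = g y * (\<Prod>i<cdim c. coord c y i ^ (j i :: nat))"
      using f c x V unfolding basic_sections_def by blast
    have "openin (points M) (W \<inter> V)" using W V by blast
    moreover from this have "restrict g (W \<inter> V) \<in> pos_functions M (W \<inter> V)"
      using smooth_functions_restrict[OF M] W(4) by (auto simp: pos_functions_def)
    ultimately show ?thesis using W x
      by (intro exI[of _ "W \<inter> V"] exI[of _ "restrict g (W \<inter> V)"] exI[of _ j]) auto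
  qed
  then show "restrict f V \<in> basic_sections M V"
    using f V smooth_functions_restrict[OF M]
    by (auto simp: basic_sections_def nonneg_functions_def)
next
  fix U f assume "openin (points M) U" and f: "f \<in> extensional U"
    and loc: "\<And>x. x \<in> U \<Longrightarrow>
      \<exists>V. openin (points M) V \<and> x \<in> V \<and> V \<subseteq> U \<and> restrict f V \<in> basic_sections M V"
  have "f \<in> smooth_functions M U"
    by (rule smooth_functions_local[OF M f])
      (use loc in \<open>fastforce simp: basic_sections_def nonneg_functions_def\<close>)
  moreover have "0 \<le> f x" if "x \<in> U" for x
    using loc[OF that] by (auto simp: basic_sections_def nonneg_functions_def)
  moreover have "\<exists>V g j. openin (points M) V \<and> x \<in> V \<and> V \<subseteq> U \<inter> cdom c \<and> g \<in> pos_functions M V \<and>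
      (\<forall>y\<in>V. f y = g y * (\<Prod>i<cdim c. coord c y i ^ (j i :: nat)))"
    if c: "c \<in> atlas M" and x: "x \<in> U \<inter> cdom c" for c x
  proof -
    obtain V where V: "V \<subseteq> U" "x \<in> V" "restrict f V \<in> basic_sections M V" using loc x by blast
    then obtain W g j where W: "openin (points M) W" "x \<in> W" "W \<subseteq> V \<inter> cdom c" "g \<in> pos_functions M W"
      "\<forall>y\<in>W. restrict f V y = g y * (\<Prod>i<cdim c. coord c y i ^ (j i :: nat))"
      using c x unfolding basic_sections_def by blast
    then show ?thesis using V
      by (intro exI[of _ W] exI[of _ g] exI[of _ j]) (auto simp: subset_iff)
  qed
  ultimately show "f \<in> basic_sections M U"
    by (simp add: basic_sections_def nonneg_functions_def)
qed

lemma positive_log_structure_trivial: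
  assumes "manifold_with_corners M"
  shows "positive_log_structure (trivial_log M)"
  unfolding positive_log_structure_def Let_def
  using monoid_sheaf_pos[OF assms]
  by (auto simp: trivial_log_def function_presheaf_def presheaf_morphism_def hom_def bij_betw_def
      pos_functions_def nonneg_functions_def less_imp_le)

lemma positive_log_structure_basic:
  assumes M: "manifold_with_corners M"
  shows "positive_log_structure (basic_log M)"
proof -
  have nonneg: "f \<in> nonneg_functions M U" if "f \<in> basic_sections M U" for f U
    using that by (simp add: basic_sections_def)
  have "{f \<in> basic_sections M U. f \<in> pos_functions M U} = pos_functions M U"
    if "openin (points M) U" for U
    using pos_functions_subset_basic[OF M that] by blast
  then show ?thesis
    unfolding positive_log_structure_def Let_def
    using monoid_sheaf_basic[OF M]
    by (simp add: basic_log_def function_presheaf_def presheaf_morphism_def hom_def bij_betw_def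
        nonneg)
qed

end

(* A virtual morphism from the point over x is a homomorphism from the stalk at x of the group
   completed sheaf to the positive reals that evaluates positive functions at x. Near x every
   section is a positive function times a monomial in coordinates r_i, and the r_i that do not
   vanish at x are themselves positive, so the homomorphism amounts to a positive number v_i for
   each r_i that vanishes at x.

   That this matches normal vectors independently of charts rests on one fact: a coordinate s_i of
   another chart that vanishes at x is g * r_k near x, with g positive and smooth and r_k(x) = 0.
   Then both the homomorphism and the tangent vector with components v take the value g(x) v_k
   on s_i. *)

theory Submission
  imports Defs
begin

section \<open>Calculus in the spaces \<open>Euclidean_space n\<close>\<close>

text \<open>A fraction of basic sections cannot be evaluated at \<open>x\<close>: numerator,
  denominator and the multiplier \<open>e\<close> that witnesses an equality of fractions in the
  group completion may all vanish there. Along a curve that leaves \<open>x\<close> into the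
  interior with normal velocity \<open>v\<close>, however, each of them has a strictly positive
  leading coefficient, and positive numbers cancel. Leading coefficients therefore give a
  homomorphism that depends neither on the presentation by a monomial nor on the chosen fraction.
  The factorisation of one boundary coordinate by another has its origin in signs: coordinates are
  nonnegative, so one that vanishes at a point has derivative zero there in every direction that can
  be followed both ways. A section of the pulled back group completed sheaf is a family of germs of
  a sheaf whose sections are themselves families of germs of fractions. Over a one-point space all
  of this reduces to stalks, and stalks are unchanged by sheafification; the sheaf theory below
  serves to peel off these layers.\<close>

lemma Euclidean_space_eq: "Euclidean_space n = top_of_set {x. \<forall>i\<ge>n. x i = 0}"
  by (simp add: Euclidean_space_def euclidean_product_topology)

lemma openin_Euclidean_subset: "openin (Euclidean_space n) W \<Longrightarrow> W \<subseteq> topspace (Euclidean_space n)"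
  by (rule openin_subset)

text \<open>Passes to the type class topology of \<open>nat \<Rightarrow> real\<close>, where
  continuity of composite functions is easy to derive. As \<open>W\<close> lies in the space,
  restricting twice changes nothing.\<close>

lemma continuous_map_Euclidean_iff:
  assumes "W \<subseteq> topspace (Euclidean_space n)"
  shows "continuous_map (subtopology (Euclidean_space n) W) euclideanreal f \<longleftrightarrow> continuous_on W f"
proof -
  have "subtopology (Euclidean_space n) W = top_of_set W"
    using assms by (simp add: Euclidean_space_eq subtopology_subtopology inf.absorb2)
  then show ?thesis by simp
qed

section \<open>Limits and boxes in coordinate spaces\<close>

lemma tendsto_funI:
  fixes \<gamma> :: "'b \<Rightarrow> 'i \<Rightarrow> 'c :: topological_space"
  assumes "\<And>i. ((\<lambda>t. \<gamma> t i) \<longlongrightarrow> p i) F"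
  shows "(\<gamma> \<longlongrightarrow> p) F"
proof -
  have "limitin (product_topology (\<lambda>i. euclidean) UNIV) \<gamma> p F"
    using assms by (simp add: limitin_componentwise)
  then show ?thesis by (simp add: euclidean_product_topology)
qed

text \<open>The coordinates from index \<open>n\<close> on are zero both along
  \<open>\<gamma>\<close> and at \<open>p\<close>, so \<open>n\<close> limits control the whole
  product topology.\<close>

lemma tendsto_Euclidean:
  assumes "p \<in> topspace (Euclidean_space n)"
    and "\<forall>\<^sub>F t in F. \<gamma> t \<in> topspace (Euclidean_space n)"
    and lim: "\<And>i. i < n \<Longrightarrow> ((\<lambda>t. \<gamma> t i) \<longlongrightarrow> p i) F"
  shows "(\<gamma> \<longlongrightarrow> p) F"
proof (rule tendsto_funI)
  fix i
  show "((\<lambda>t. \<gamma> t i) \<longlongrightarrow> p i) F"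
  proof (cases "i < n")
    case False
    have "\<forall>\<^sub>F t in F. \<gamma> t i = p i"
      by (rule eventually_mono[OF assms(2)])
        (use assms(1) False in \<open>auto simp: topspace_Euclidean_space\<close>)
    then show ?thesis by (simp add: tendsto_eventually)
  qed (rule lim)
qed

lemma eventually_in_open_Euclidean:
  assumes W: "openin (Euclidean_space n) W" and p: "p \<in> W"
    and ev: "\<forall>\<^sub>F t in F. \<gamma> t \<in> topspace (Euclidean_space n)"
    and lim: "\<And>i. i < n \<Longrightarrow> ((\<lambda>t. \<gamma> t i) \<longlongrightarrow> p i) F"
  shows "\<forall>\<^sub>F t in F. \<gamma> t \<in> W"
proof -
  obtain T where T: "open T" "W = topspace (Euclidean_space n) \<inter> T"
    using W by (auto simp: Euclidean_space_eq openin_open)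
  have "(\<gamma> \<longlongrightarrow> p) F"
    using tendsto_Euclidean[OF _ ev lim] p T by auto
  then have "\<forall>\<^sub>F t in F. \<gamma> t \<in> T"
    using T p by (auto dest: topological_tendstoD)
  with ev show ?thesis by eventually_elim (simp add: T)
qed

lemma tendsto_compose_Euclidean:
  assumes W: "openin (Euclidean_space n) W" and p: "p \<in> W" and f: "continuous_on W f"
    and ev: "\<forall>\<^sub>F t in F. \<gamma> t \<in> topspace (Euclidean_space n)"
    and lim: "\<And>i. i < n \<Longrightarrow> ((\<lambda>t. \<gamma> t i) \<longlongrightarrow> p i) F"
  shows "((\<lambda>t. f (\<gamma> t)) \<longlongrightarrow> f p) F"
  by (rule continuous_on_tendsto_compose[OF f _ p eventually_in_open_Euclidean[OF W p ev lim]])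
    (use tendsto_Euclidean[OF _ ev lim] openin_Euclidean_subset[OF W] p in auto)

text \<open>Only finitely many coordinates are constrained, so the box is open although the topology
  is that of an infinite product.\<close>

lemma openin_box:
  "openin (Euclidean_space n) {y \<in> topspace (Euclidean_space n). \<forall>i<n. \<bar>y i - p i\<bar> < e}"
proof -
  have "open {y :: nat \<Rightarrow> real. \<bar>y i - p i\<bar> < e}" for i
    by (intro open_Collect_less continuous_intros) auto
  then have "open (\<Inter>i\<in>{..<n}. {y :: nat \<Rightarrow> real. \<bar>y i - p i\<bar> < e})"
    by (intro open_INT) auto
  moreover have "{y \<in> topspace (Euclidean_space n). \<forall>i<n. \<bar>y i - p i\<bar> < e}
     = topspace (Euclidean_space n) \<inter> (\<Inter>i\<in>{..<n}. {y. \<bar>y i - p i\<bar> < e})"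
    by auto
  ultimately show ?thesis
    by (auto simp: Euclidean_space_eq openin_open)
qed

text \<open>If the box of radius \<open>1 / Suc m\<close> left \<open>W\<close> for every
  \<open>m\<close>, points chosen outside \<open>W\<close> would converge to \<open>p\<close> in
  each coordinate and hence eventually lie in \<open>W\<close>.\<close>

lemma openin_contains_box:
  assumes W: "openin (Euclidean_space n) W" and p: "p \<in> W"
  obtains e where "e > 0"
    "\<And>y. y \<in> topspace (Euclidean_space n) \<Longrightarrow> (\<And>i. i < n \<Longrightarrow> \<bar>y i - p i\<bar> < e) \<Longrightarrow> y \<in> W"
proof (rule ccontr)
  assume "\<not> thesis"
  then have "\<forall>m. \<exists>y. y \<in> topspace (Euclidean_space n) \<and> (\<forall>i<n. \<bar>y i - p i\<bar> < 1 / Suc m) \<and> y \<notin> W"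
    using that[of "1 / Suc _"] by fastforce
  then obtain y where y: "\<And>m. y m \<in> topspace (Euclidean_space n)"
    "\<And>m i. i < n \<Longrightarrow> \<bar>y m i - p i\<bar> < 1 / Suc m" "\<And>m. y m \<notin> W"
    by metis
  have "(\<lambda>m. y m i) \<longlonglongrightarrow> p i" if "i < n" for i
  proof (rule LIM_zero_cancel, rule tendsto_0_le[OF LIMSEQ_inverse_real_of_nat])
    show "\<forall>\<^sub>F m in sequentially. norm (y m i - p i) \<le> norm (inverse (real (Suc m))) * 1"
      using y(2)[OF that] by (auto intro!: always_eventually simp: inverse_eq_divide less_imp_le)
  qed
  then have "\<forall>\<^sub>F m in sequentially. y m \<in> W"
    using y(1) by (intro eventually_in_open_Euclidean[OF W p]) auto
  then show False using y(3) by simp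
qed

section \<open>Mean value theorem and chain rule\<close>

lemma cont_diff_continuous_on:
  assumes "openin (Euclidean_space n) W" "cont_diff k n W f"
  shows "continuous_on W f"
  using assms cont_diff_continuous continuous_map_Euclidean_iff openin_Euclidean_subset by blast

text \<open>A coordinate of a curve may increase, decrease or stand still; the closed segment covers
  both orders of \<open>a\<close> and \<open>b\<close> and the case \<open>a = b\<close>.\<close>

lemma line_mean_value:
  fixes F :: "(nat \<Rightarrow> real) \<Rightarrow> real"
  assumes d: "\<And>x. x \<in> W \<Longrightarrow> ((\<lambda>t. F (x(i := t))) has_real_derivative g x) (at (x i))"
    and seg: "\<And>s. s \<in> closed_segment a b \<Longrightarrow> p(i := s) \<in> W"
  shows "\<exists>z\<in>closed_segment a b. F (p(i := b)) - F (p(i := a)) = g (p(i := z)) * (b - a)"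
proof -
  have D: "((\<lambda>t. F (p(i := t))) has_real_derivative g (p(i := s))) (at s)"
    if "s \<in> closed_segment a b" for s
    using d[OF seg[OF that]] by simp
  consider "a < b" | "a = b" | "b < a" by linarith
  then show ?thesis
  proof cases
    case 1
    then obtain z where "a < z" "z < b" "F (p(i := b)) - F (p(i := a)) = (b - a) * g (p(i := z))"
      using MVT2[of a b "\<lambda>t. F (p(i := t))" "\<lambda>s. g (p(i := s))"] D
      by (auto simp: closed_segment_eq_real_ivl)
    then show ?thesis using 1 by (auto simp: closed_segment_eq_real_ivl intro!: bexI[of _ z])
  next
    case 3
    then obtain z where "b < z" "z < a" "F (p(i := a)) - F (p(i := b)) = (a - b) * g (p(i := z))"
      using MVT2[of b a "\<lambda>t. F (p(i := t))" "\<lambda>s. g (p(i := s))"] D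
      by (auto simp: closed_segment_eq_real_ivl)
    then show ?thesis using 3
      by (auto simp: closed_segment_eq_real_ivl algebra_simps intro!: bexI[of _ z])
  qed auto
qed

text \<open>The increment of \<open>F\<close> along \<open>\<gamma>\<close> is split into \<open>n\<close> increments in coordinate directions, so
  that only continuity of the partial derivatives is used.\<close>

lemma has_real_derivative_chain:
  fixes \<gamma> :: "real \<Rightarrow> nat \<Rightarrow> real"
  assumes W: "openin (Euclidean_space n) W" and p: "\<gamma> t0 \<in> W"
    and d: "\<And>k x. k < n \<Longrightarrow> x \<in> W \<Longrightarrow> ((\<lambda>t. F (x(k := t))) has_real_derivative g k x) (at (x k))"
    and c: "\<And>k. k < n \<Longrightarrow> continuous_on W (g k)"
    and ev: "\<forall>\<^sub>F t in at t0 within S. \<gamma> t \<in> topspace (Euclidean_space n)"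
    and \<gamma>: "\<And>k. k < n \<Longrightarrow> ((\<lambda>t. \<gamma> t k) has_real_derivative \<gamma>' k) (at t0 within S)"
  shows "((\<lambda>t. F (\<gamma> t)) has_real_derivative (\<Sum>k<n. g k (\<gamma> t0) * \<gamma>' k)) (at t0 within S)"
proof -
  define p where "p = \<gamma> t0"
  have pW: "p \<in> W" and pE: "p \<in> topspace (Euclidean_space n)"
    using p openin_Euclidean_subset[OF W] by (auto simp: p_def)
  \<comment> \<open>Hybrid points: the coordinates below \<open>m\<close> follow the curve, the
    others stay at \<open>p\<close>. They lead from \<open>p\<close> at \<open>m = 0\<close> to
    \<open>\<gamma> t\<close> at \<open>m = n\<close>, one coordinate at a time.\<close>
  define y where "y m t = (\<lambda>i. if i < m then \<gamma> t i else p i)" for m t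
  have y0: "y m t0 = p" for m by (auto simp: y_def p_def)
  \<comment> \<open>\<open>W\<close> need not contain the hybrid points of a curve in
    \<open>W\<close>. A box around \<open>p\<close> does contain them for \<open>t\<close> near
    \<open>t0\<close>, together with the segments between consecutive ones.\<close>
  obtain e where e: "e > 0" and
    box: "\<And>y. y \<in> topspace (Euclidean_space n) \<Longrightarrow> (\<And>i. i < n \<Longrightarrow> \<bar>y i - p i\<bar> < e) \<Longrightarrow> y \<in> W"
    using openin_contains_box[OF W pW] by metis
  have lim: "((\<lambda>t. \<gamma> t k) \<longlongrightarrow> p k) (at t0 within S)" if "k < n" for k
    using DERIV_continuous[OF \<gamma>[OF that]] by (simp add: continuous_within p_def)
  have near: "\<forall>\<^sub>F t in at t0 within S. \<forall>k\<in>{..<n}. \<bar>\<gamma> t k - p k\<bar> < e"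
    unfolding eventually_ball_finite_distrib[OF finite_lessThan]
    using tendstoD[OF lim e] by (auto simp: dist_real_def)
  have "((\<lambda>t. (F (y m t) - F p) / (t - t0)) \<longlongrightarrow> (\<Sum>k<m. g k p * \<gamma>' k)) (at t0 within S)"
    if "m \<le> n" for m
    using that
  proof (induction m)
    case 0
    then show ?case by (simp add: y_def)
  next
    case (Suc m)
    then have m: "m < n" by simp
    have ex: "\<forall>\<^sub>F t in at t0 within S. \<exists>z\<in>closed_segment (p m) (\<gamma> t m).
        F (y (Suc m) t) - F (y m t) = g m ((y m t)(m := z)) * (\<gamma> t m - p m)"
      using near ev
    proof eventually_elim
      case (elim t)
      have 1: "(y m t)(m := \<gamma> t m) = y (Suc m) t" "(y m t)(m := p m) = y m t"
        by (auto simp: y_def less_Suc_eq)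
      have "(y m t)(m := s) \<in> W" if s: "s \<in> closed_segment (p m) (\<gamma> t m)" for s
      proof (rule box)
        show "(y m t)(m := s) \<in> topspace (Euclidean_space n)"
          using elim(2) pE m by (auto simp: y_def topspace_Euclidean_space)
        have "\<bar>s - p m\<bar> \<le> \<bar>\<gamma> t m - p m\<bar>"
          using s by (auto simp: closed_segment_eq_real_ivl split: if_splits)
        then show "\<bar>((y m t)(m := s)) i - p i\<bar> < e" if "i < n" for i
          using bspec[OF elim(1), of i] that e by (cases "i = m") (auto simp: y_def)
      qed
      from line_mean_value[of W F m "g m" "p m" "\<gamma> t m" "y m t", OF d[OF m] this] show ?case
        unfolding 1 .
    qed
    define P where "P t z \<longleftrightarrow> z \<in> closed_segment (p m) (\<gamma> t m) \<and>
        F (y (Suc m) t) - F (y m t) = g m ((y m t)(m := z)) * (\<gamma> t m - p m)" for t z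
    define z where "z t = (SOME z. P t z)" for t
    have z: "\<forall>\<^sub>F t in at t0 within S. P t (z t)"
      using ex
    proof eventually_elim
      case (elim t)
      then have "\<exists>z. P t z" by (auto simp: P_def)
      then show ?case unfolding z_def by (rule someI_ex)
    qed
    \<comment> \<open>The intermediate value is squeezed between \<open>p m\<close> and
      \<open>\<gamma> t m\<close>.\<close>
    have zlim: "(z \<longlongrightarrow> p m) (at t0 within S)"
    proof (rule LIM_zero_cancel, rule tendsto_0_le[OF LIM_zero[OF lim[OF m]]])
      show "\<forall>\<^sub>F t in at t0 within S. norm (z t - p m) \<le> norm (\<gamma> t m - p m) * 1"
        using z by eventually_elim
          (auto simp: P_def closed_segment_eq_real_ivl split: if_splits)
    qed
    have "((\<lambda>t. g m ((y m t)(m := z t))) \<longlongrightarrow> g m p) (at t0 within S)"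
    proof (rule tendsto_compose_Euclidean[OF W pW c[OF m]])
      show "\<forall>\<^sub>F t in at t0 within S. (y m t)(m := z t) \<in> topspace (Euclidean_space n)"
        using ev by eventually_elim (use pE m in \<open>auto simp: y_def topspace_Euclidean_space\<close>)
      show "((\<lambda>t. ((y m t)(m := z t)) i) \<longlongrightarrow> p i) (at t0 within S)" if "i < n" for i
        using zlim lim[OF that] by (cases "i = m"; cases "i < m") (auto simp: y_def)
    qed
    moreover have "((\<lambda>t. (\<gamma> t m - p m) / (t - t0)) \<longlongrightarrow> \<gamma>' m) (at t0 within S)"
      using \<gamma>[OF m] by (simp add: has_field_derivative_iff p_def)
    ultimately have "((\<lambda>t. g m ((y m t)(m := z t)) * ((\<gamma> t m - p m) / (t - t0))) \<longlongrightarrow> g m p * \<gamma>' m)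
        (at t0 within S)"
      by (rule tendsto_mult)
    \<comment> \<open>The division is by \<open>t - t0\<close>, never by the increment of the
      coordinate, so a coordinate that stands still does no harm.\<close>
    then have "((\<lambda>t. (F (y (Suc m) t) - F (y m t)) / (t - t0)) \<longlongrightarrow> g m p * \<gamma>' m) (at t0 within S)"
      by (rule Lim_transform_eventually) (use z in eventually_elim, auto simp: P_def)
    from tendsto_add[OF Suc.IH this] m show ?case
      by (simp add: diff_divide_distrib)
  qed
  from this[of n] have "((\<lambda>t. (F (y n t) - F p) / (t - t0)) \<longlongrightarrow> (\<Sum>k<n. g k p * \<gamma>' k)) (at t0 within S)"
    by simp
  moreover have "\<forall>\<^sub>F t in at t0 within S. (F (y n t) - F p) / (t - t0) = (F (\<gamma> t) - F p) / (t - t0)"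
    using ev
  proof eventually_elim
    case (elim t)
    have "y n t = \<gamma> t"
      using elim pE by (auto simp: y_def topspace_Euclidean_space fun_eq_iff)
    then show ?case by simp
  qed
  ultimately show ?thesis
    unfolding has_field_derivative_iff p_def by (rule Lim_transform_eventually)
qed

section \<open>Partial derivatives and composition\<close>

lemma cont_diff_partials:
  assumes "cont_diff (Suc k) n W F"
  obtains g where "\<And>i x. i < n \<Longrightarrow> x \<in> W \<Longrightarrow> ((\<lambda>t. F (x(i := t))) has_real_derivative g i x) (at (x i))"
    "\<And>i. i < n \<Longrightarrow> cont_diff k n W (g i)"
proof -
  have "\<forall>i. \<exists>g. i < n \<longrightarrow> (\<forall>x\<in>W. ((\<lambda>t. F (x(i := t))) has_real_derivative g x) (at (x i))) \<and> cont_diff k n W g"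
    using assms by auto
  then obtain g where "\<forall>i. i < n \<longrightarrow> (\<forall>x\<in>W. ((\<lambda>t. F (x(i := t))) has_real_derivative g i x) (at (x i))) \<and> cont_diff k n W (g i)"
    by metis
  with that show ?thesis by blast
qed

text \<open>Openness matters here: a partial derivative at \<open>x\<close> looks at
  \<open>x(i := t)\<close> for \<open>t\<close> near \<open>x i\<close>, and these points remain in
  \<open>W\<close>, where both functions agree.\<close>

lemma cont_diff_cong:
  assumes W: "openin (Euclidean_space n) W"
  shows "cont_diff k n W g \<Longrightarrow> (\<And>x. x \<in> W \<Longrightarrow> g x = h x) \<Longrightarrow> cont_diff k n W h"
proof (induction k arbitrary: g h)
  case 0
  then show ?case using W
    by (simp add: continuous_map_Euclidean_iff openin_Euclidean_subset cong: continuous_on_cong)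
next
  case (Suc k)
  have "continuous_on W h"
    using cont_diff_continuous_on[OF W Suc.prems(1)] Suc.prems(2) by (simp cong: continuous_on_cong)
  moreover have "\<exists>g'. (\<forall>x\<in>W. ((\<lambda>t. h (x(i := t))) has_real_derivative g' x) (at (x i))) \<and> cont_diff k n W g'"
    if i: "i < n" for i
  proof -
    obtain g' where g': "\<forall>x\<in>W. ((\<lambda>t. g (x(i := t))) has_real_derivative g' x) (at (x i))"
      "cont_diff k n W g'" using Suc.prems(1) i by auto
    have "((\<lambda>t. h (x(i := t))) has_real_derivative g' x) (at (x i))" if x: "x \<in> W" for x
    proof -
      have "\<forall>\<^sub>F t in nhds (x i). x(i := t) \<in> W"
      proof (rule eventually_in_open_Euclidean[OF W x])
        show "\<forall>\<^sub>F t in nhds (x i). x(i := t) \<in> topspace (Euclidean_space n)"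
          using openin_Euclidean_subset[OF W] x i by (auto simp: topspace_Euclidean_space)
        show "((\<lambda>t. (x(i := t)) j) \<longlongrightarrow> x j) (nhds (x i))" for j
          by (cases "j = i") (auto simp: filterlim_ident)
      qed
      then have "\<forall>\<^sub>F t in nhds (x i). g (x(i := t)) = h (x(i := t))"
        by eventually_elim (rule Suc.prems(2))
      with bspec[OF g'(1) x] show ?thesis
        by (subst DERIV_cong_ev[symmetric, of "x i" "x i" "\<lambda>t. g (x(i := t))"]) auto
    qed
    then show ?thesis using g' by blast
  qed
  ultimately show ?case using W
    by (simp add: continuous_map_Euclidean_iff openin_Euclidean_subset)
qed

text \<open>The partial derivatives in \<^const>\<open>cont_diff\<close> may depend on \<open>k\<close>; here they do not.\<close>

lemma smooth_partials:
  assumes W: "openin (Euclidean_space n) W" and F: "\<forall>k. cont_diff k n W F"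
  obtains g where "\<And>i x. i < n \<Longrightarrow> x \<in> W \<Longrightarrow> ((\<lambda>t. F (x(i := t))) has_real_derivative g i x) (at (x i))"
    "\<And>i. i < n \<Longrightarrow> \<forall>k. cont_diff k n W (g i)"
proof -
  have "cont_diff (Suc 0) n W F" using F by blast
  then obtain g where g: "\<And>i x. i < n \<Longrightarrow> x \<in> W \<Longrightarrow> ((\<lambda>t. F (x(i := t))) has_real_derivative g i x) (at (x i))"
    using cont_diff_partials by blast
  have "cont_diff k n W (g i)" if i: "i < n" for k i
  proof -
    have "cont_diff (Suc k) n W F" using F by blast
    then obtain h where h: "\<And>i x. i < n \<Longrightarrow> x \<in> W \<Longrightarrow> ((\<lambda>t. F (x(i := t))) has_real_derivative h i x) (at (x i))"
      "\<And>i. i < n \<Longrightarrow> cont_diff k n W (h i)"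
      using cont_diff_partials by blast
    \<comment> \<open>The derivative \<open>h\<close> obtained for order \<open>k\<close> equals
      \<open>g\<close> on \<open>W\<close> by uniqueness of derivatives, so its differentiability
      passes to \<open>g\<close>.\<close>
    show ?thesis
      by (rule cont_diff_cong[OF W h(2)[OF i]]) (rule DERIV_unique[OF h(1)[OF i] g[OF i]])
  qed
  with g that show ?thesis by blast
qed

lemma cont_diff_sum:
  "(\<And>i. i \<in> I \<Longrightarrow> cont_diff k n W (f i)) \<Longrightarrow> cont_diff k n W (\<lambda>x. \<Sum>i\<in>I. f i x)"
  by (induction I rule: infinite_finite_induct) (auto intro: cont_diff_add cont_diff_const)

text \<open>Padding with zeros turns the \<open>n\<close> functions \<open>T k\<close> into a point
  of the coordinate space. In the induction the chain rule writes each partial derivative as a sum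
  of products of a composite and a partial derivative of some \<open>T k\<close>, all of order
  \<open>j\<close>.\<close>

lemma cont_diff_compose:
  assumes W: "openin (Euclidean_space n) W" and V: "openin (Euclidean_space m) V"
    and TW: "\<And>y. y \<in> V \<Longrightarrow> (\<lambda>k. if k < n then T k y else 0) \<in> W"
  shows "cont_diff j n W F \<Longrightarrow> (\<And>k. k < n \<Longrightarrow> cont_diff j m V (T k)) \<Longrightarrow>
    cont_diff j m V (\<lambda>y. F (\<lambda>k. if k < n then T k y else 0))"
proof (induction j arbitrary: F)
  case 0
  have "continuous_on V (\<lambda>y. F (\<lambda>k. if k < n then T k y else 0))"
  proof (rule continuous_on_compose2[of W F])
    show "continuous_on W F" using cont_diff_continuous_on[OF W 0(1)] .
    have "continuous_on V (\<lambda>y. if k < n then T k y else 0)" for k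
      using cont_diff_continuous_on[OF V 0(2)] by (cases "k < n") auto
    then show "continuous_on V (\<lambda>y k. if k < n then T k y else 0)"
      by (rule continuous_on_coordinatewise_then_product)
  qed (use TW in blast)
  then show ?case using V by (simp add: continuous_map_Euclidean_iff openin_Euclidean_subset)
next
  case (Suc j)
  obtain g where g: "\<And>i x. i < n \<Longrightarrow> x \<in> W \<Longrightarrow> ((\<lambda>t. F (x(i := t))) has_real_derivative g i x) (at (x i))"
    "\<And>i. i < n \<Longrightarrow> cont_diff j n W (g i)"
    using cont_diff_partials[OF Suc.prems(1)] by blast
  have T: "cont_diff j m V (T k)" if "k < n" for k
    using Suc.prems(2)[OF that] by (rule cont_diff_Suc_imp)
  have "\<exists>h. (\<forall>y\<in>V. ((\<lambda>t. F (\<lambda>k. if k < n then T k (y(i := t)) else 0)) has_real_derivative h y) (at (y i))) \<and>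
      cont_diff j m V h" if i: "i < m" for i
  proof -
    have "\<forall>k. \<exists>g. k < n \<longrightarrow> (\<forall>x\<in>V. ((\<lambda>t. T k (x(i := t))) has_real_derivative g x) (at (x i))) \<and> cont_diff j m V g"
      using Suc.prems(2) i by auto
    then obtain T' where T': "\<And>k x. k < n \<Longrightarrow> x \<in> V \<Longrightarrow> ((\<lambda>t. T k (x(i := t))) has_real_derivative T' k x) (at (x i))"
      "\<And>k. k < n \<Longrightarrow> cont_diff j m V (T' k)" by metis
    have "((\<lambda>t. F (\<lambda>k. if k < n then T k (y(i := t)) else 0)) has_real_derivative
        (\<Sum>k<n. g k (\<lambda>k. if k < n then T k y else 0) * T' k y)) (at (y i))" if y: "y \<in> V" for y
      using has_real_derivative_chain[OF W _ g(1) cont_diff_continuous_on[OF W g(2)],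
          where \<gamma> = "\<lambda>t k. if k < n then T k (y(i := t)) else 0" and ?t0.0 = "y i"
            and \<gamma>' = "\<lambda>k. T' k y" and S = UNIV]
        T'(1) y TW by (simp add: topspace_Euclidean_space cong del: if_weak_cong)
    moreover have "cont_diff j m V (\<lambda>y. \<Sum>k<n. g k (\<lambda>k. if k < n then T k y else 0) * T' k y)"
      by (intro cont_diff_sum cont_diff_mult Suc.IH g(2) T T'(2)) auto
    ultimately show ?thesis by (intro exI conjI ballI)
  qed
  moreover have "continuous_on V (\<lambda>y. F (\<lambda>k. if k < n then T k y else 0))"
    using cont_diff_continuous_on[OF V Suc.IH[OF cont_diff_Suc_imp[OF Suc.prems(1)] T]] .
  ultimately show ?case using V by (simp add: continuous_map_Euclidean_iff openin_Euclidean_subset)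
qed

lemma cont_diff_coord:
  assumes "i < n"
  shows "cont_diff k n W (\<lambda>x. x i)"
proof (cases k)
  case 0
  have "continuous_map (Euclidean_space n) euclideanreal (\<lambda>x. x i)"
    by (simp add: Euclidean_space_eq continuous_on_subset[OF continuous_on_product_coordinates])
  then show ?thesis by (simp add: 0 continuous_map_from_subtopology)
next
  case (Suc l)
  have "continuous_map (Euclidean_space n) euclideanreal (\<lambda>x. x i)"
    by (simp add: Euclidean_space_eq continuous_on_subset[OF continuous_on_product_coordinates])
  moreover have "((\<lambda>t. (x(j := t)) i) has_real_derivative (if j = i then 1 else 0)) (at (x j))" for x j
    by (cases "j = i") auto
  ultimately show ?thesis
    unfolding Suc cont_diff.simps
    by (intro conjI allI impI exI[of _ "\<lambda>_. if _ = i then 1 else 0"] ballI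
        continuous_map_from_subtopology) (simp_all only: cont_diff_const)
qed

text \<open>Hadamard's lemma: if \<open>H = \<partial>\<^sub>k F\<close> then
  \<open>F x = F (x(k := 0)) + x k * (\<integral>\<^bsub>0\<^esub>\<^bsup>1\<^esup> H (x(k := t * x k)) dt)\<close>. The powers of \<open>t\<close> appear on
  differentiating the integral in the direction \<open>k\<close>.\<close>

lemma cont_diff_integral:
  assumes W: "openin (Euclidean_space n) W"
    and star: "\<And>x t. x \<in> W \<Longrightarrow> 0 \<le> t \<Longrightarrow> t \<le> 1 \<Longrightarrow> x(k := t * x k) \<in> W"
  shows "cont_diff m n W H \<Longrightarrow> cont_diff m n W (\<lambda>x. integral {0..1} (\<lambda>t. t ^ a * H (x(k := t * x k))))"
proof -
  \<comment> \<open>Joint continuity in the point and the parameter. It is needed for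
    \<open>H\<close> and again for its partial derivatives with another exponent, so both are kept
    general.\<close>
  have cont2: "continuous_on (W \<times> {0..1}) (\<lambda>(x, t). t ^ a * H (x(k := t * x k)))"
    if H: "continuous_on W H" for H and a :: nat
  proof -
    have "continuous_on (W \<times> {0..1::real}) (\<lambda>p. (fst p)(k := snd p * fst p k))"
    proof (rule continuous_on_coordinatewise_then_product)
      have "continuous_on (W \<times> {0..1::real}) (\<lambda>p. fst p j)" for j
        by (rule continuous_on_compose2[OF continuous_on_product_coordinates])
          (auto intro: continuous_intros)
      then show "continuous_on (W \<times> {0..1::real}) (\<lambda>p. ((fst p)(k := snd p * fst p k)) j)" for j
        by (cases "j = k") (auto intro!: continuous_intros)
    qed
    then have "continuous_on (W \<times> {0..1}) (\<lambda>p. H ((fst p)(k := snd p * fst p k)))"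
      by (rule continuous_on_compose2[OF H]) (use star in auto)
    then show ?thesis
      unfolding split_beta by (intro continuous_intros)
  qed
  have cont: "continuous_on W (\<lambda>x. integral {0..1} (\<lambda>t. t ^ a * H (x(k := t * x k))))"
    if H: "continuous_on W H" for H a
    using integral_continuous_on_param[of W 0 1 "\<lambda>x t. t ^ a * H (x(k := t * x k))"] cont2[OF H, of a]
    by simp
  show "cont_diff m n W H \<Longrightarrow> cont_diff m n W (\<lambda>x. integral {0..1} (\<lambda>t. t ^ a * H (x(k := t * x k))))"
proof (induction m arbitrary: H a)
  case 0
  show ?case
    using cont[OF cont_diff_continuous_on[OF W 0]] W
    by (simp add: continuous_map_Euclidean_iff openin_Euclidean_subset)
next
  case (Suc m)
  have H: "continuous_on W H" using cont_diff_continuous_on[OF W Suc.prems] .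
  obtain h where h: "\<And>i x. i < n \<Longrightarrow> x \<in> W \<Longrightarrow> ((\<lambda>t. H (x(i := t))) has_real_derivative h i x) (at (x i))"
    "\<And>i. i < n \<Longrightarrow> cont_diff m n W (h i)"
    using cont_diff_partials[OF Suc.prems] by blast
  define b where "b i = (if i = k then Suc a else a)" for i
  have D: "((\<lambda>s. integral {0..1} (\<lambda>t. t ^ a * H ((x(i := s))(k := t * (x(i := s)) k))))
      has_real_derivative integral {0..1} (\<lambda>t. t ^ b i * h i (x(k := t * x k)))) (at (x i))"
    if i: "i < n" and x: "x \<in> W" for i x
  proof -
    have "\<forall>\<^sub>F s in nhds (x i). x(i := s) \<in> W"
    proof (rule eventually_in_open_Euclidean[OF W x])
      show "\<forall>\<^sub>F t in nhds (x i). x(i := t) \<in> topspace (Euclidean_space n)"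
        using openin_Euclidean_subset[OF W] x i by (auto simp: topspace_Euclidean_space)
      show "((\<lambda>t. (x(i := t)) j) \<longlongrightarrow> x j) (nhds (x i))" for j
        by (cases "j = i") (auto simp: filterlim_ident)
    qed
    \<comment> \<open>The Leibniz rule asks for a convex set of parameters: a ball around
      \<open>x i\<close> in which the \<open>i\<close>-th coordinate may move without leaving
      \<open>W\<close>.\<close>
    then obtain e where e: "e > 0" and "\<And>s. dist s (x i) < e \<Longrightarrow> x(i := s) \<in> W"
      unfolding eventually_nhds_metric by blast
    then have xW: "x(i := s) \<in> W" if "s \<in> ball (x i) e" for s
      using that by (simp add: dist_commute)
    have D: "((\<lambda>s. t ^ a * H ((x(i := s))(k := t * (x(i := s)) k))) has_real_derivative
        t ^ b i * h i ((x(i := s))(k := t * (x(i := s)) k))) (at s)"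
      if s: "s \<in> ball (x i) e" and t: "0 \<le> t" "t \<le> 1" for s t
    proof -
      define y where "y = (x(i := s))(k := t * (x(i := s)) k)"
      have y: "y \<in> W" unfolding y_def using star[OF xW[OF s] t] .
      show ?thesis
      proof (cases "i = k")
        case True
        have "((\<lambda>s. H (y(i := t * s))) has_real_derivative h i y * t) (at s)"
          by (rule DERIV_chain'[of "\<lambda>s. t * s" t s UNIV "\<lambda>u. H (y(i := u))" "h i y", simplified])
            (use h(1)[OF i y] True in \<open>auto simp: y_def intro!: derivative_eq_intros\<close>)
        from DERIV_cmult[OF this, of "t ^ a"] show ?thesis
          using True by (simp add: y_def b_def mult_ac)
      next
        case False
        have "((\<lambda>s. H (y(i := s))) has_real_derivative h i y) (at s)"
          using h(1)[OF i y] False by (simp add: y_def)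
        from DERIV_cmult[OF this, of "t ^ a"] show ?thesis
          using False by (simp add: y_def b_def fun_upd_twist)
      qed
    qed
    have "((\<lambda>s. integral (cbox 0 1) (\<lambda>t. t ^ a * H ((x(i := s))(k := t * (x(i := s)) k))))
      has_real_derivative integral (cbox 0 1) (\<lambda>t. t ^ b i * h i ((x(i := x i))(k := t * (x(i := x i)) k))))
      (at (x i) within ball (x i) e)"
    proof (rule leibniz_rule_field_derivative)
      show "((\<lambda>s. t ^ a * H ((x(i := s))(k := t * (x(i := s)) k))) has_real_derivative
        t ^ b i * h i ((x(i := s))(k := t * (x(i := s)) k))) (at s within ball (x i) e)"
        if "s \<in> ball (x i) e" "t \<in> cbox 0 1" for s t
        using D[OF that(1), of t] that(2) by (simp add: has_field_derivative_at_within)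
      show "(\<lambda>t. t ^ a * H ((x(i := s))(k := t * (x(i := s)) k))) integrable_on cbox 0 1"
        if "s \<in> ball (x i) e" for s
      proof (rule integrable_continuous)
        have "continuous_on (cbox 0 1) (\<lambda>t :: real. (x(i := s), t))"
          by (intro continuous_intros)
        moreover have "(\<lambda>t :: real. (x(i := s), t)) ` cbox 0 1 \<subseteq> W \<times> {0..1}"
          using xW[OF that] by auto
        ultimately show "continuous_on (cbox 0 1) (\<lambda>t. t ^ a * H ((x(i := s))(k := t * (x(i := s)) k)))"
          using continuous_on_compose2[OF cont2[OF H, of a]] by fastforce
      qed
      show "continuous_on (ball (x i) e \<times> cbox 0 1)
          (\<lambda>(s, t). t ^ b i * h i ((x(i := s))(k := t * (x(i := s)) k)))"
      proof -
        have "continuous_on (ball (x i) e \<times> cbox (0::real) 1) (\<lambda>p. x(i := fst p))"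
        proof (rule continuous_on_coordinatewise_then_product)
          show "continuous_on (ball (x i) e \<times> cbox (0::real) 1) (\<lambda>p. (x(i := fst p)) j)" for j
            by (cases "j = i") (auto intro: continuous_intros)
        qed
        then have "continuous_on (ball (x i) e \<times> cbox (0::real) 1) (\<lambda>p. (x(i := fst p), snd p))"
          by (rule continuous_on_Pair) (rule continuous_on_snd[OF continuous_on_id])
        moreover have "(\<lambda>p. (x(i := fst p), snd p)) ` (ball (x i) e \<times> cbox (0::real) 1) \<subseteq> W \<times> {0..1}"
          using xW by auto
        ultimately show ?thesis
          using continuous_on_compose2[OF cont2[OF cont_diff_continuous_on[OF W h(2)[OF i]], of "b i"]]
          unfolding split_beta by fastforce
      qed
    qed (use e in auto)
    then show ?thesis
      by (subst (asm) at_within_open) (use e in \<open>auto simp: cbox_interval\<close>)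
  qed
  have "\<exists>g. (\<forall>x\<in>W. ((\<lambda>s. integral {0..1} (\<lambda>t. t ^ a * H ((x(i := s))(k := t * (x(i := s)) k))))
      has_real_derivative g x) (at (x i))) \<and> cont_diff m n W g" if "i < n" for i
    by (intro exI conjI ballI) (rule D[OF that], assumption, rule Suc.IH[OF h(2)[OF that]])
  then show ?case
    unfolding cont_diff.simps continuous_map_Euclidean_iff[OF openin_Euclidean_subset[OF W]]
    by (intro conjI cont[OF H] allI impI)
qed
qed

lemma Hadamard:
  assumes W: "openin (Euclidean_space n) W" and F: "\<forall>m. cont_diff m n W F"
    and p: "p \<in> W" "p k = 0" and k: "k < n"
    and D: "((\<lambda>t. F (p(k := t))) has_real_derivative D) (at 0)"
  obtains V G where "openin (Euclidean_space n) V" "p \<in> V" "V \<subseteq> W" "\<forall>m. cont_diff m n V G" "G p = D"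
    "\<And>x. x \<in> V \<Longrightarrow> x(k := 0) \<in> V" "\<And>x. x \<in> V \<Longrightarrow> F x = F (x(k := 0)) + x k * G x"
proof -
  obtain e where e: "e > 0" and
    box: "\<And>y. y \<in> topspace (Euclidean_space n) \<Longrightarrow> (\<And>i. i < n \<Longrightarrow> \<bar>y i - p i\<bar> < e) \<Longrightarrow> y \<in> W"
    using openin_contains_box[OF W p(1)] by metis
  \<comment> \<open>Since \<open>p k = 0\<close>, this box is symmetric about 0 in direction
    \<open>k\<close>, hence stable under multiplying the \<open>k\<close>-th coordinate by any
    \<open>t\<close> in \<open>[0, 1]\<close>. This is what the integral formula needs.\<close>
  define V where "V = {y \<in> topspace (Euclidean_space n). \<forall>i<n. \<bar>y i - p i\<bar> < e}"
  have V: "openin (Euclidean_space n) V" unfolding V_def by (rule openin_box)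
  have VW: "V \<subseteq> W" using box by (auto simp: V_def)
  have pV: "p \<in> V" using p openin_Euclidean_subset[OF W] e by (auto simp: V_def)
  have star: "x(k := t * x k) \<in> V" if x: "x \<in> V" and t: "0 \<le> t" "t \<le> 1" for x t
  proof -
    have "\<bar>x k\<bar> < e" using x k p(2) by (auto simp: V_def)
    moreover have "\<bar>t * x k\<bar> \<le> \<bar>x k\<bar>"
      using t by (simp add: abs_mult mult_left_le_one_le)
    ultimately show ?thesis
      using x k p(2) by (auto simp: V_def topspace_Euclidean_space)
  qed
  obtain h where h: "\<And>i x. i < n \<Longrightarrow> x \<in> W \<Longrightarrow> ((\<lambda>t. F (x(i := t))) has_real_derivative h i x) (at (x i))"
    "\<And>i. i < n \<Longrightarrow> \<forall>m. cont_diff m n W (h i)"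
    using smooth_partials[OF W F] by blast
  define G where "G x = integral {0..1} (\<lambda>t. t ^ 0 * h k (x(k := t * x k)))" for x
  show thesis
  proof (rule that[OF V pV VW])
    show "\<forall>m. cont_diff m n V G"
      unfolding G_def using cont_diff_integral[OF V star] cont_diff_subset[OF _ VW] h(2)[OF k] by blast
    have "h k p = D"
      using DERIV_unique[OF h(1)[OF k p(1)]] D p(2) by simp
    \<comment> \<open>At \<open>p\<close> the integrand is constant in \<open>t\<close>, again
      because \<open>p k = 0\<close>.\<close>
    then show "G p = D" using p(2) by (simp add: G_def fun_upd_idem)
    show "x(k := 0) \<in> V" if "x \<in> V" for x
      using star[OF that, of 0] by simp
    show "F x = F (x(k := 0)) + x k * G x" if x: "x \<in> V" for x
    proof -
      have "((\<lambda>t. F (x(k := t * x k))) has_vector_derivative x k * h k (x(k := t * x k))) (at t within {0..1})"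
        if t: "t \<in> {0..1}" for t
      proof -
        have "x(k := t * x k) \<in> W" using star[OF x] t VW by auto
        from h(1)[OF k this]
        have "((\<lambda>u. F (x(k := u))) has_real_derivative h k (x(k := t * x k))) (at (t * x k))" by simp
        moreover have "((\<lambda>t. t * x k) has_real_derivative x k) (at t)"
          by (auto intro!: derivative_eq_intros)
        ultimately have "((\<lambda>t. F (x(k := t * x k))) has_real_derivative h k (x(k := t * x k)) * x k) (at t)"
          by (rule DERIV_chain2)
        then show ?thesis
          by (simp add: has_real_derivative_iff_has_vector_derivative mult.commute
              has_vector_derivative_at_within)
      qed
      then have "((\<lambda>t. x k * h k (x(k := t * x k))) has_integral F (x(k := 1 * x k)) - F (x(k := 0 * x k))) {0..1}"
        by (rule fundamental_theorem_of_calculus[OF zero_le_one])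
      from integral_unique[OF this]
      have "integral {0..1} (\<lambda>t. x k * h k (x(k := t * x k))) = F x - F (x(k := 0))"
        by (simp only: mult_1 mult_zero_left fun_upd_triv)
      then have "x k * integral {0..1} (\<lambda>t. h k (x(k := t * x k))) = F x - F (x(k := 0))"
        by (simp only: integral_mult_right)
      then show ?thesis by (simp only: G_def power_0 mult_1)
    qed
  qed
qed

section \<open>Stalks and group completions\<close>

context
  fixes F :: "('a, 'm) presheaf"
  assumes F: "monoid_presheaf F"
begin

lemma presheaf_comm_monoid: "openin (base F) U \<Longrightarrow> comm_monoid (sections F U)"
  using F by (simp add: monoid_presheaf_def)

lemma presheaf_restr_hom:
  "openin (base F) U \<Longrightarrow> openin (base F) V \<Longrightarrow> V \<subseteq> U \<Longrightarrow>
    restr F U V \<in> hom (sections F U) (sections F V)"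
  using F by (simp add: monoid_presheaf_def)

lemma presheaf_restr_closed:
  "openin (base F) U \<Longrightarrow> openin (base F) V \<Longrightarrow> V \<subseteq> U \<Longrightarrow> s \<in> carrier (sections F U) \<Longrightarrow>
    restr F U V s \<in> carrier (sections F V)"
  using hom_in_carrier[OF presheaf_restr_hom] .

lemma presheaf_restr_mult:
  "openin (base F) U \<Longrightarrow> openin (base F) V \<Longrightarrow> V \<subseteq> U \<Longrightarrow> s \<in> carrier (sections F U) \<Longrightarrow>
    t \<in> carrier (sections F U) \<Longrightarrow>
    restr F U V (s \<otimes>\<^bsub>sections F U\<^esub> t) = restr F U V s \<otimes>\<^bsub>sections F V\<^esub> restr F U V t"
  using hom_mult[OF presheaf_restr_hom] .

lemma presheaf_restr_one:
  "openin (base F) U \<Longrightarrow> openin (base F) V \<Longrightarrow> V \<subseteq> U \<Longrightarrow>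
    restr F U V \<one>\<^bsub>sections F U\<^esub> = \<one>\<^bsub>sections F V\<^esub>"
  using F by (simp add: monoid_presheaf_def)

lemma presheaf_restr_id:
  "openin (base F) U \<Longrightarrow> s \<in> carrier (sections F U) \<Longrightarrow> restr F U U s = s"
  using F by (simp add: monoid_presheaf_def)

lemma presheaf_restr_comp:
  "openin (base F) U \<Longrightarrow> openin (base F) V \<Longrightarrow> openin (base F) W \<Longrightarrow> W \<subseteq> V \<Longrightarrow> V \<subseteq> U \<Longrightarrow>
    s \<in> carrier (sections F U) \<Longrightarrow> restr F V W (restr F U V s) = restr F U W s"
  using F by (simp add: monoid_presheaf_def)

lemma presheaf_one_closed: "openin (base F) U \<Longrightarrow> \<one>\<^bsub>sections F U\<^esub> \<in> carrier (sections F U)"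
  using monoid.one_closed[OF comm_monoid.axioms(1)[OF presheaf_comm_monoid]] .

lemma presheaf_mult_closed:
  "openin (base F) U \<Longrightarrow> s \<in> carrier (sections F U) \<Longrightarrow> t \<in> carrier (sections F U) \<Longrightarrow>
    s \<otimes>\<^bsub>sections F U\<^esub> t \<in> carrier (sections F U)"
  using monoid.m_closed[OF comm_monoid.axioms(1)[OF presheaf_comm_monoid]] .

lemma mem_germ:
  "openin (base F) V \<Longrightarrow> x \<in> V \<Longrightarrow> t \<in> carrier (sections F V) \<Longrightarrow> (V, t) \<in> germ F x V t"
  unfolding germ_def by blast

text \<open>A germ is stored as its full equivalence class, so equality of germs rests on
  transitivity: neighbourhoods on which two agreements hold are intersected.\<close>

lemma germ_eq_iff:
  assumes U: "openin (base F) U" "x \<in> U" "s \<in> carrier (sections F U)"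
    and V: "openin (base F) V" "x \<in> V" "t \<in> carrier (sections F V)"
  shows "germ F x U s = germ F x V t \<longleftrightarrow>
    (\<exists>W. openin (base F) W \<and> x \<in> W \<and> W \<subseteq> U \<inter> V \<and> restr F U W s = restr F V W t)"
proof
  assume "germ F x U s = germ F x V t"
  then have "(V, t) \<in> germ F x U s" using mem_germ[OF V] by simp
  then show "\<exists>W. openin (base F) W \<and> x \<in> W \<and> W \<subseteq> U \<inter> V \<and> restr F U W s = restr F V W t"
    unfolding germ_def by blast
next
  have sub: "germ F x U s \<subseteq> germ F x V t"
    if U: "openin (base F) U" "x \<in> U" "s \<in> carrier (sections F U)"
      and V: "openin (base F) V" "x \<in> V" "t \<in> carrier (sections F V)"
      and W: "openin (base F) W" "x \<in> W" "W \<subseteq> U \<inter> V" "restr F U W s = restr F V W t"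
    for U V W s t
  proof clarify
    fix A a assume "(A, a) \<in> germ F x U s"
    then obtain B where A: "openin (base F) A" "x \<in> A" "a \<in> carrier (sections F A)"
      and B: "openin (base F) B" "x \<in> B" "B \<subseteq> U \<inter> A" "restr F U B s = restr F A B a"
      unfolding germ_def by blast
    have BW: "openin (base F) (B \<inter> W)" using B W by blast
    have "restr F V (B \<inter> W) t = restr F W (B \<inter> W) (restr F V W t)"
      by (rule presheaf_restr_comp[symmetric]) (use BW B W V in auto)
    also have "\<dots> = restr F U (B \<inter> W) s"
      unfolding W(4)[symmetric] by (rule presheaf_restr_comp) (use BW B W U in auto)
    also have "\<dots> = restr F B (B \<inter> W) (restr F U B s)"
      by (rule presheaf_restr_comp[symmetric]) (use BW B W U in auto)
    also have "\<dots> = restr F A (B \<inter> W) a"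
      unfolding B(4) by (rule presheaf_restr_comp) (use BW B W A in auto)
    finally have "restr F V (B \<inter> W) t = restr F A (B \<inter> W) a" .
    moreover have "B \<inter> W \<subseteq> V \<inter> A" "x \<in> B \<inter> W" using B W by auto
    ultimately show "(A, a) \<in> germ F x V t" using A BW unfolding germ_def by blast
  qed
  assume "\<exists>W. openin (base F) W \<and> x \<in> W \<and> W \<subseteq> U \<inter> V \<and> restr F U W s = restr F V W t"
  then obtain W where W: "openin (base F) W" "x \<in> W" "W \<subseteq> U \<inter> V" "restr F U W s = restr F V W t"
    by blast
  show "germ F x U s = germ F x V t"
    using sub[OF U V W] sub[OF V U W(1,2)] W(3,4) by (auto simp: Int_commute)
qed

lemma germ_restr:
  assumes "openin (base F) U" "openin (base F) V" "x \<in> V" "V \<subseteq> U" "s \<in> carrier (sections F U)"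
  shows "germ F x V (restr F U V s) = germ F x U s"
proof -
  have "restr F V V (restr F U V s) = restr F U V s"
    using assms by (intro presheaf_restr_id presheaf_restr_closed)
  then show ?thesis
    using assms presheaf_restr_closed by (subst germ_eq_iff) auto
qed

text \<open>The product in the stalk is a union over all pairs of representatives. All of them
  produce the same germ, so the union is taken over a singleton.\<close>

lemma stalk_mult_germ:
  assumes U: "openin (base F) U" "x \<in> U" "s \<in> carrier (sections F U)"
    and V: "openin (base F) V" "x \<in> V" "t \<in> carrier (sections F V)"
  shows "germ F x U s \<otimes>\<^bsub>stalk F x\<^esub> germ F x V t =
    germ F x (U \<inter> V) (restr F U (U \<inter> V) s \<otimes>\<^bsub>sections F (U \<inter> V)\<^esub> restr F V (U \<inter> V) t)"
proof -
  let ?m = "\<lambda>U s V t. restr F U (U \<inter> V) s \<otimes>\<^bsub>sections F (U \<inter> V)\<^esub> restr F V (U \<inter> V) t"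
  have eq: "germ F x (A \<inter> B) (?m A a B b) = germ F x (U \<inter> V) (?m U s V t)"
    if mem: "(A, a) \<in> germ F x U s" "(B, b) \<in> germ F x V t" for A a B b
  proof -
    obtain C where A: "openin (base F) A" "x \<in> A" "a \<in> carrier (sections F A)"
      and C: "openin (base F) C" "x \<in> C" "C \<subseteq> U \<inter> A" "restr F U C s = restr F A C a"
      using mem(1) unfolding germ_def by blast
    obtain D where B: "openin (base F) B" "x \<in> B" "b \<in> carrier (sections F B)"
      and D: "openin (base F) D" "x \<in> D" "D \<subseteq> V \<inter> B" "restr F V D t = restr F B D b"
      using mem(2) unfolding germ_def by blast
    define W where "W = C \<inter> D"
    have W: "openin (base F) W" "x \<in> W" "W \<subseteq> U" "W \<subseteq> V" "W \<subseteq> A" "W \<subseteq> B" "W \<subseteq> C" "W \<subseteq> D"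
      using C D by (auto simp: W_def)
    have m: "restr F (P \<inter> Q) W (?m P p Q q) = restr F P W p \<otimes>\<^bsub>sections F W\<^esub> restr F Q W q"
      if "openin (base F) P" "openin (base F) Q" "W \<subseteq> P" "W \<subseteq> Q"
        "p \<in> carrier (sections F P)" "q \<in> carrier (sections F Q)" for P Q p q
    proof -
      have PQ: "openin (base F) (P \<inter> Q)" using that by blast
      have "restr F (P \<inter> Q) W (?m P p Q q) = restr F (P \<inter> Q) W (restr F P (P \<inter> Q) p) \<otimes>\<^bsub>sections F W\<^esub>
          restr F (P \<inter> Q) W (restr F Q (P \<inter> Q) q)"
        by (intro presheaf_restr_mult presheaf_restr_closed) (use PQ W that in auto)
      also have "restr F (P \<inter> Q) W (restr F P (P \<inter> Q) p) = restr F P W p"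
        by (intro presheaf_restr_comp) (use PQ W that in auto)
      also have "restr F (P \<inter> Q) W (restr F Q (P \<inter> Q) q) = restr F Q W q"
        by (intro presheaf_restr_comp) (use PQ W that in auto)
      finally show ?thesis .
    qed
    have "restr F U W s = restr F A W a"
      using presheaf_restr_comp[of U C W s] presheaf_restr_comp[of A C W a] U A C W by auto
    moreover have "restr F V W t = restr F B W b"
      using presheaf_restr_comp[of V D W t] presheaf_restr_comp[of B D W b] V B D W by auto
    ultimately have "restr F (A \<inter> B) W (?m A a B b) = restr F (U \<inter> V) W (?m U s V t)"
      using m U V A B W by simp
    moreover have "?m P p Q q \<in> carrier (sections F (P \<inter> Q))"
      if "openin (base F) P" "openin (base F) Q"
        "p \<in> carrier (sections F P)" "q \<in> carrier (sections F Q)" for P Q p q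
      by (intro presheaf_mult_closed presheaf_restr_closed) (use that in auto)
    moreover have "W \<subseteq> A \<inter> B \<inter> (U \<inter> V)" using W by blast
    ultimately show ?thesis
      using W(1,2) A B U V by (subst germ_eq_iff) blast+
  qed
  have "germ F x U s \<otimes>\<^bsub>stalk F x\<^esub> germ F x V t =
    \<Union> {germ F x (A \<inter> B) (?m A a B b) | A a B b. (A, a) \<in> germ F x U s \<and> (B, b) \<in> germ F x V t}"
    by (simp add: stalk_def)
  also have "{germ F x (A \<inter> B) (?m A a B b) | A a B b. (A, a) \<in> germ F x U s \<and> (B, b) \<in> germ F x V t}
     = {germ F x (U \<inter> V) (?m U s V t)}"
    using eq mem_germ[OF U] mem_germ[OF V] by blast
  finally show ?thesis by simp
qed

text \<open>Any three germs have representatives over one common neighbourhood, where the laws hold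
  for sections.\<close>

lemma stalk_comm_monoid:
  assumes x: "x \<in> topspace (base F)"
  shows "comm_monoid (stalk F x)"
proof -
  have cl: "germ F x U s \<in> carrier (stalk F x)"
    if "openin (base F) U" "x \<in> U" "s \<in> carrier (sections F U)" for U s
    using that by (auto simp: stalk_def)
  have ex: "\<exists>U s. openin (base F) U \<and> x \<in> U \<and> s \<in> carrier (sections F U) \<and> p = germ F x U s"
    if "p \<in> carrier (stalk F x)" for p
    using that by (auto simp: stalk_def)
  have common: "\<exists>s'. s' \<in> carrier (sections F W) \<and> germ F x U s = germ F x W s'"
    if "openin (base F) U" "s \<in> carrier (sections F U)" "openin (base F) W" "x \<in> W" "W \<subseteq> U" for U s W
    using germ_restr[of U W x s] presheaf_restr_closed[of U W s] that by metis
  have ex3: "\<exists>W s t u. openin (base F) W \<and> x \<in> W \<and> s \<in> carrier (sections F W) \<and> t \<in> carrier (sections F W) \<and>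
      u \<in> carrier (sections F W) \<and> p = germ F x W s \<and> q = germ F x W t \<and> r = germ F x W u"
    if mem: "p \<in> carrier (stalk F x)" "q \<in> carrier (stalk F x)" "r \<in> carrier (stalk F x)" for p q r
  proof -
    obtain U s where U: "openin (base F) U" "x \<in> U" "s \<in> carrier (sections F U)" "p = germ F x U s"
      using ex[OF mem(1)] by blast
    obtain V t where V: "openin (base F) V" "x \<in> V" "t \<in> carrier (sections F V)" "q = germ F x V t"
      using ex[OF mem(2)] by blast
    obtain A u where A: "openin (base F) A" "x \<in> A" "u \<in> carrier (sections F A)" "r = germ F x A u"
      using ex[OF mem(3)] by blast
    define W where "W = U \<inter> V \<inter> A"
    have W: "openin (base F) W" "x \<in> W" "W \<subseteq> U" "W \<subseteq> V" "W \<subseteq> A"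
      using U V A by (auto simp: W_def)
    show ?thesis
      using common[OF U(1,3) W(1,2,3)] common[OF V(1,3) W(1,2,4)] common[OF A(1,3) W(1,2,5)] W(1,2) U(4) V(4) A(4)
      by metis
  qed
  have mult: "germ F x W s \<otimes>\<^bsub>stalk F x\<^esub> germ F x W t = germ F x W (s \<otimes>\<^bsub>sections F W\<^esub> t)"
    if "openin (base F) W" "x \<in> W" "s \<in> carrier (sections F W)" "t \<in> carrier (sections F W)" for W s t
    using stalk_mult_germ[OF that(1-3) that(1,2,4)] that by (simp add: presheaf_restr_id)
  have one: "\<one>\<^bsub>stalk F x\<^esub> = germ F x W \<one>\<^bsub>sections F W\<^esub>" if "openin (base F) W" "x \<in> W" for W
  proof -
    have "germ F x W (restr F (topspace (base F)) W \<one>\<^bsub>sections F (topspace (base F))\<^esub>) =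
        germ F x (topspace (base F)) \<one>\<^bsub>sections F (topspace (base F))\<^esub>"
      by (rule germ_restr) (use that openin_subset in \<open>auto intro: presheaf_one_closed\<close>)
    then show ?thesis
      using that openin_subset[OF that(1)] by (simp add: stalk_def presheaf_restr_one)
  qed
  show ?thesis
  proof (rule comm_monoidI)
    show "\<one>\<^bsub>stalk F x\<^esub> \<in> carrier (stalk F x)"
      using one[OF openin_topspace x] cl[OF openin_topspace x presheaf_one_closed] by simp
    fix p q r assume p: "p \<in> carrier (stalk F x)" and q: "q \<in> carrier (stalk F x)"
      and r: "r \<in> carrier (stalk F x)"
    obtain W s t u where *: "openin (base F) W" "x \<in> W" "s \<in> carrier (sections F W)" "t \<in> carrier (sections F W)"
      "u \<in> carrier (sections F W)" "p = germ F x W s" "q = germ F x W t" "r = germ F x W u"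
      using ex3[OF p q r] by blast
    interpret comm_monoid "sections F W" using presheaf_comm_monoid[OF *(1)] .
    show "p \<otimes>\<^bsub>stalk F x\<^esub> q \<otimes>\<^bsub>stalk F x\<^esub> r = p \<otimes>\<^bsub>stalk F x\<^esub> (q \<otimes>\<^bsub>stalk F x\<^esub> r)"
      using * by (simp add: mult m_assoc)
  next
    fix p q assume p: "p \<in> carrier (stalk F x)" and q: "q \<in> carrier (stalk F x)"
    obtain W s t u where *: "openin (base F) W" "x \<in> W" "s \<in> carrier (sections F W)" "t \<in> carrier (sections F W)"
      "u \<in> carrier (sections F W)" "p = germ F x W s" "q = germ F x W t" "p = germ F x W u"
      using ex3[OF p q p] by blast
    interpret comm_monoid "sections F W" using presheaf_comm_monoid[OF *(1)] .
    show "p \<otimes>\<^bsub>stalk F x\<^esub> q = q \<otimes>\<^bsub>stalk F x\<^esub> p"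
      using *(1-4,6,7) by (simp add: mult m_comm)
    show "p \<otimes>\<^bsub>stalk F x\<^esub> q \<in> carrier (stalk F x)"
      using *(1-4,6,7) by (simp add: mult cl)
    show "\<one>\<^bsub>stalk F x\<^esub> \<otimes>\<^bsub>stalk F x\<^esub> p = p"
      using *(1-4,6,7) by (simp add: mult one[of W])
  qed
qed

end

section \<open>Group completion of a commutative monoid\<close>

context
  fixes G :: "'m monoid" (structure)
  assumes G: "comm_monoid G"
begin

interpretation comm_monoid G by (rule G)

lemma equiv_gp_rel: "equiv (carrier G \<times> carrier G) (gp_rel G)"
proof (rule equivI)
  show "gp_rel G \<subseteq> (carrier G \<times> carrier G) \<times> (carrier G \<times> carrier G)"
    unfolding gp_rel_def by auto
  show "refl_on (carrier G \<times> carrier G) (gp_rel G)"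
    unfolding refl_on_def gp_rel_def by auto
  show "sym (gp_rel G)"
    unfolding sym_def gp_rel_def by auto metis
  show "trans (gp_rel G)"
  proof (rule transI, clarify)
    fix a b c d e f assume "((a, b), (c, d)) \<in> gp_rel G" "((c, d), (e, f)) \<in> gp_rel G"
    then obtain u v where car: "a \<in> carrier G" "b \<in> carrier G" "c \<in> carrier G" "d \<in> carrier G"
      "e \<in> carrier G" "f \<in> carrier G" "u \<in> carrier G" "v \<in> carrier G"
      and u: "u \<otimes> (a \<otimes> d) = u \<otimes> (c \<otimes> b)" and v: "v \<otimes> (c \<otimes> f) = v \<otimes> (e \<otimes> d)"
      unfolding gp_rel_def by auto
    \<comment> \<open>Nothing can be cancelled in \<open>G\<close>, so the middle denominator
      \<open>d\<close> is absorbed into the witness along with \<open>u\<close> and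
      \<open>v\<close>.\<close>
    have "(u \<otimes> v \<otimes> d) \<otimes> (a \<otimes> f) = (u \<otimes> (a \<otimes> d)) \<otimes> (v \<otimes> f)"
      using car by (simp add: m_ac)
    also have "\<dots> = (v \<otimes> (c \<otimes> f)) \<otimes> (u \<otimes> b)"
      unfolding u using car by (simp add: m_ac)
    also have "\<dots> = (u \<otimes> v \<otimes> d) \<otimes> (e \<otimes> b)"
      unfolding v using car by (simp add: m_ac)
    finally show "((a, b), (e, f)) \<in> gp_rel G"
      using car unfolding gp_rel_def by blast
  qed
qed

lemma gp_class_eq_iff:
  assumes "a \<in> carrier G" "b \<in> carrier G" "c \<in> carrier G" "d \<in> carrier G"
  shows "gp_rel G `` {(a, b)} = gp_rel G `` {(c, d)} \<longleftrightarrow>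
    (\<exists>e\<in>carrier G. e \<otimes> (a \<otimes> d) = e \<otimes> (c \<otimes> b))"
  using eq_equiv_class_iff[OF equiv_gp_rel, of "(a, b)" "(c, d)"] assms by (auto simp: gp_rel_def)

lemma gp_class_closed:
  "a \<in> carrier G \<Longrightarrow> b \<in> carrier G \<Longrightarrow> gp_rel G `` {(a, b)} \<in> carrier (group_completion G)"
  by (simp add: group_completion_def quotientI)

lemma gp_class_cases:
  assumes "p \<in> carrier (group_completion G)"
  obtains a b where "a \<in> carrier G" "b \<in> carrier G" "p = gp_rel G `` {(a, b)}"
  using assms by (auto simp: group_completion_def elim!: quotientE)

text \<open>Products and restrictions of classes are defined as the saturation of the set of all
  results on representatives. This shows such a saturation to be one class.\<close>

lemma gp_rel_Image:
  assumes "A \<noteq> {}" "\<And>q. q \<in> A \<Longrightarrow> (p, q) \<in> gp_rel G"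
  shows "gp_rel G `` A = gp_rel G `` {p}"
proof -
  have "gp_rel G `` {q} = gp_rel G `` {p}" if "q \<in> A" for q
    using equiv_class_eq[OF equiv_gp_rel assms(2)[OF that]] by simp
  then show ?thesis using assms(1) by blast
qed

lemma gp_class_mult:
  assumes "a \<in> carrier G" "b \<in> carrier G" "c \<in> carrier G" "d \<in> carrier G"
  shows "gp_rel G `` {(a, b)} \<otimes>\<^bsub>group_completion G\<^esub> gp_rel G `` {(c, d)} =
    gp_rel G `` {(a \<otimes> c, b \<otimes> d)}"
proof -
  have self: "(a, b) \<in> gp_rel G `` {(a, b)}" "(c, d) \<in> gp_rel G `` {(c, d)}"
    using equiv_class_self[OF equiv_gp_rel] assms by auto
  have "((a \<otimes> c, b \<otimes> d), (a' \<otimes> c', b' \<otimes> d')) \<in> gp_rel G"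
    if "((a, b), (a', b')) \<in> gp_rel G" "((c, d), (c', d')) \<in> gp_rel G" for a' b' c' d'
  proof -
    obtain u v where car: "a' \<in> carrier G" "b' \<in> carrier G" "c' \<in> carrier G" "d' \<in> carrier G"
      "u \<in> carrier G" "v \<in> carrier G"
      and u: "u \<otimes> (a \<otimes> b') = u \<otimes> (a' \<otimes> b)" and v: "v \<otimes> (c \<otimes> d') = v \<otimes> (c' \<otimes> d)"
      using \<open>((a, b), (a', b')) \<in> gp_rel G\<close> \<open>((c, d), (c', d')) \<in> gp_rel G\<close>
      unfolding gp_rel_def by auto
    have "(u \<otimes> v) \<otimes> ((a \<otimes> c) \<otimes> (b' \<otimes> d')) = (u \<otimes> (a \<otimes> b')) \<otimes> (v \<otimes> (c \<otimes> d'))"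
      using car assms by (simp add: m_ac)
    also have "\<dots> = (u \<otimes> v) \<otimes> ((a' \<otimes> c') \<otimes> (b \<otimes> d))"
      unfolding u v using car assms by (simp add: m_ac)
    finally show ?thesis
      using car assms unfolding gp_rel_def by blast
  qed
  then have *: "((a \<otimes> c, b \<otimes> d), q) \<in> gp_rel G"
    if "q \<in> {(a' \<otimes> c', b' \<otimes> d') |a' b' c' d'.
      (a', b') \<in> gp_rel G `` {(a, b)} \<and> (c', d') \<in> gp_rel G `` {(c, d)}}" for q
    using that by auto
  show ?thesis
    unfolding group_completion_def monoid.simps
    by (rule gp_rel_Image[OF _ *]) (use self in blast)+
qed

lemma group_completion_comm_monoid: "comm_monoid (group_completion G)"
proof (rule comm_monoidI)
  have one: "\<one>\<^bsub>group_completion G\<^esub> = gp_rel G `` {(\<one>, \<one>)}" by (simp add: group_completion_def)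
  then show "\<one>\<^bsub>group_completion G\<^esub> \<in> carrier (group_completion G)"
    by (simp add: gp_class_closed)
  fix p q r assume p: "p \<in> carrier (group_completion G)" and q: "q \<in> carrier (group_completion G)"
  obtain a b where 1: "a \<in> carrier G" "b \<in> carrier G" "p = gp_rel G `` {(a, b)}"
    using gp_class_cases[OF p] .
  obtain c d where 2: "c \<in> carrier G" "d \<in> carrier G" "q = gp_rel G `` {(c, d)}"
    using gp_class_cases[OF q] .
  show "p \<otimes>\<^bsub>group_completion G\<^esub> q \<in> carrier (group_completion G)"
    using 1 2 by (simp add: gp_class_mult gp_class_closed)
  show "p \<otimes>\<^bsub>group_completion G\<^esub> q = q \<otimes>\<^bsub>group_completion G\<^esub> p"
    using 1 2 by (simp add: gp_class_mult m_comm)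
  show "\<one>\<^bsub>group_completion G\<^esub> \<otimes>\<^bsub>group_completion G\<^esub> p = p"
    using 1 by (simp add: one gp_class_mult)
  assume "r \<in> carrier (group_completion G)"
  then obtain e f where 3: "e \<in> carrier G" "f \<in> carrier G" "r = gp_rel G `` {(e, f)}"
    using gp_class_cases by blast
  show "p \<otimes>\<^bsub>group_completion G\<^esub> q \<otimes>\<^bsub>group_completion G\<^esub> r =
      p \<otimes>\<^bsub>group_completion G\<^esub> (q \<otimes>\<^bsub>group_completion G\<^esub> r)"
    using 1 2 3 by (simp add: gp_class_mult m_assoc)
qed

end

text \<open>A witness \<open>e\<close> for the equality of two fractions over \<open>G\<close> is
  carried to the witness \<open>r e\<close> over \<open>H\<close>.\<close>

lemma gp_class_map:
  assumes G: "comm_monoid G" and H: "comm_monoid H" and r: "r \<in> hom G H"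
    and a: "a \<in> carrier G" and b: "b \<in> carrier G"
  shows "gp_rel H `` map_prod r r ` (gp_rel G `` {(a, b)}) = gp_rel H `` {(r a, r b)}"
proof (rule gp_rel_Image[OF H])
  show "map_prod r r ` (gp_rel G `` {(a, b)}) \<noteq> {}"
    using equiv_class_self[OF equiv_gp_rel[OF G]] a b by blast
  fix q assume "q \<in> map_prod r r ` (gp_rel G `` {(a, b)})"
  then obtain c d where q: "q = (r c, r d)" and "((a, b), (c, d)) \<in> gp_rel G" by auto
  then obtain e where e: "c \<in> carrier G" "d \<in> carrier G" "e \<in> carrier G"
    "e \<otimes>\<^bsub>G\<^esub> (a \<otimes>\<^bsub>G\<^esub> d) = e \<otimes>\<^bsub>G\<^esub> (c \<otimes>\<^bsub>G\<^esub> b)"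
    unfolding gp_rel_def by auto
  interpret G: comm_monoid G by (rule G)
  have "r e \<otimes>\<^bsub>H\<^esub> (r a \<otimes>\<^bsub>H\<^esub> r d) = r (e \<otimes>\<^bsub>G\<^esub> (a \<otimes>\<^bsub>G\<^esub> d))"
    using r a e(1-3) by (simp add: hom_mult)
  also have "\<dots> = r e \<otimes>\<^bsub>H\<^esub> (r c \<otimes>\<^bsub>H\<^esub> r b)"
    unfolding e(4) using r b e by (simp add: hom_mult)
  finally show "((r a, r b), q) \<in> gp_rel H"
    unfolding q using a b e r by (auto simp: gp_rel_def hom_in_carrier)
qed

section \<open>The presheaf of group completions\<close>

lemma gp_presheaf_simps [simp]:
  "base (gp_presheaf F) = base F"
  "sections (gp_presheaf F) U = group_completion (sections F U)"
  by (simp_all add: gp_presheaf_def)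

lemma gp_restr_class:
  assumes F: "monoid_presheaf F"
    and "openin (base F) U" "openin (base F) V" "V \<subseteq> U"
    and "a \<in> carrier (sections F U)" "b \<in> carrier (sections F U)"
  shows "restr (gp_presheaf F) U V (gp_rel (sections F U) `` {(a, b)}) =
    gp_rel (sections F V) `` {(restr F U V a, restr F U V b)}"
  unfolding gp_presheaf_def presheaf.simps
  by (intro gp_class_map presheaf_comm_monoid presheaf_restr_hom) (use assms in auto)

lemma gp_presheaf_monoid:
  assumes F: "monoid_presheaf F"
  shows "monoid_presheaf (gp_presheaf F)"
  unfolding monoid_presheaf_def gp_presheaf_simps
proof (intro conjI allI impI; (elim conjE)?)
  fix U assume U: "openin (base F) U"
  show "comm_monoid (group_completion (sections F U))"
    by (intro group_completion_comm_monoid presheaf_comm_monoid F U)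
next
  fix U V assume U: "openin (base F) U" and V: "openin (base F) V" "V \<subseteq> U"
  note cl = presheaf_restr_closed[OF F U V] and mU = presheaf_comm_monoid[OF F U]
    and mV = presheaf_comm_monoid[OF F V(1)] and rc = gp_restr_class[OF F U V]
  show "restr (gp_presheaf F) U V \<in> hom (group_completion (sections F U)) (group_completion (sections F V))"
  proof (rule homI)
    fix p assume "p \<in> carrier (group_completion (sections F U))"
    then obtain a b where p: "a \<in> carrier (sections F U)" "b \<in> carrier (sections F U)"
      "p = gp_rel (sections F U) `` {(a, b)}"
      using gp_class_cases[OF mU] by blast
    then show "restr (gp_presheaf F) U V p \<in> carrier (group_completion (sections F V))"
      by (simp add: rc gp_class_closed[OF mV] cl)
    fix q assume "q \<in> carrier (group_completion (sections F U))"
    then obtain c d where q: "c \<in> carrier (sections F U)" "d \<in> carrier (sections F U)"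
      "q = gp_rel (sections F U) `` {(c, d)}"
      using gp_class_cases[OF mU] by blast
    show "restr (gp_presheaf F) U V (p \<otimes>\<^bsub>group_completion (sections F U)\<^esub> q) =
        restr (gp_presheaf F) U V p \<otimes>\<^bsub>group_completion (sections F V)\<^esub> restr (gp_presheaf F) U V q"
      using p q by (simp add: rc gp_class_mult[OF mV] gp_class_mult[OF mU] cl
          presheaf_mult_closed[OF F U] presheaf_restr_mult[OF F U V])
  qed
  show "restr (gp_presheaf F) U V \<one>\<^bsub>group_completion (sections F U)\<^esub> = \<one>\<^bsub>group_completion (sections F V)\<^esub>"
    using rc[OF presheaf_one_closed[OF F U] presheaf_one_closed[OF F U]]
    by (simp add: group_completion_def presheaf_restr_one[OF F U V])
next
  fix U p assume U: "openin (base F) U" and "p \<in> carrier (group_completion (sections F U))"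
  then obtain a b where p: "a \<in> carrier (sections F U)" "b \<in> carrier (sections F U)"
    "p = gp_rel (sections F U) `` {(a, b)}"
    using gp_class_cases[OF presheaf_comm_monoid[OF F U]] by blast
  then show "restr (gp_presheaf F) U U p = p"
    using U by (simp add: gp_restr_class[OF F] presheaf_restr_id[OF F])
next
  fix U V W p assume U: "openin (base F) U" and V: "openin (base F) V" "openin (base F) W" "W \<subseteq> V" "V \<subseteq> U"
    and "p \<in> carrier (group_completion (sections F U))"
  then obtain a b where p: "a \<in> carrier (sections F U)" "b \<in> carrier (sections F U)"
    "p = gp_rel (sections F U) `` {(a, b)}"
    using gp_class_cases[OF presheaf_comm_monoid[OF F U]] by blast
  have "W \<subseteq> U" using V by blast
  then show "restr (gp_presheaf F) V W (restr (gp_presheaf F) U V p) = restr (gp_presheaf F) U W p"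
    using U V p by (simp add: gp_restr_class[OF F] presheaf_restr_comp[OF F] presheaf_restr_closed[OF F])
qed

section \<open>Inverse images\<close>

context
  fixes P :: "('b, 'm) presheaf" and X :: "'a topology" and \<phi> :: "'a \<Rightarrow> 'b"
  assumes P: "monoid_presheaf P" and \<phi>: "continuous_map X (base P) \<phi>"
begin

lemma inverse_image_simps [simp]:
  "base (inverse_image X \<phi> P) = X"
  "restr (inverse_image X \<phi> P) U V \<sigma> = restrict \<sigma> V"
  "\<sigma> \<otimes>\<^bsub>sections (inverse_image X \<phi> P) V\<^esub> \<tau> = (\<lambda>x\<in>V. \<sigma> x \<otimes>\<^bsub>stalk P (\<phi> x)\<^esub> \<tau> x)"
  "\<one>\<^bsub>sections (inverse_image X \<phi> P) V\<^esub> = (\<lambda>x\<in>V. \<one>\<^bsub>stalk P (\<phi> x)\<^esub>)"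
  by (simp_all add: inverse_image_def)

text \<open>Trades an equality of extensional functions for a pointwise one, so that
  \<open>undefined\<close> values stay out of the later arguments.\<close>

lemma mem_inverse_image:
  "\<sigma> \<in> carrier (sections (inverse_image X \<phi> P) V) \<longleftrightarrow> \<sigma> \<in> extensional V \<and>
    (\<forall>x\<in>V. \<exists>V' W s. openin X V' \<and> x \<in> V' \<and> V' \<subseteq> V \<and> openin (base P) W \<and> \<phi> ` V' \<subseteq> W \<and>
      s \<in> carrier (sections P W) \<and> (\<forall>y\<in>V'. \<sigma> y = germ P (\<phi> y) W s))"
proof -
  have "restrict \<sigma> V' = pulled_back_section P \<phi> W s V' \<longleftrightarrow> (\<forall>y\<in>V'. \<sigma> y = germ P (\<phi> y) W s)" for V' W s
    unfolding pulled_back_section_def fun_eq_iff by (auto simp: restrict_def)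
  then show ?thesis by (simp add: inverse_image_def)
qed

lemma inverse_image_stalk:
  assumes "\<sigma> \<in> carrier (sections (inverse_image X \<phi> P) V)" "x \<in> V"
  shows "\<sigma> x \<in> carrier (stalk P (\<phi> x))"
  using assms unfolding mem_inverse_image by (fastforce simp: stalk_def)

lemma pulled_back_section_closed:
  assumes "openin X V" "openin (base P) W" "\<phi> ` V \<subseteq> W" "s \<in> carrier (sections P W)"
  shows "pulled_back_section P \<phi> W s V \<in> carrier (sections (inverse_image X \<phi> P) V)"
  unfolding mem_inverse_image using assms by (auto simp: pulled_back_section_def)

text \<open>The laws hold pointwise in the stalks. What has to be seen is that products remain
  locally induced: if \<open>s\<close> over \<open>W\<close> induces one factor and \<open>t\<close>
  over \<open>Y\<close> the other, then the product of their restrictions to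
  \<open>W \<inter> Y\<close> induces the product.\<close>

lemma inverse_image_monoid: "monoid_presheaf (inverse_image X \<phi> P)"
proof -
  have st: "comm_monoid (stalk P (\<phi> x))" if "openin X V" "x \<in> V" for x V
    using that \<phi> openin_subset by (intro stalk_comm_monoid[OF P]) (fastforce simp: continuous_map_def)
  have mult: "(\<lambda>x\<in>V. \<sigma> x \<otimes>\<^bsub>stalk P (\<phi> x)\<^esub> \<tau> x) \<in> carrier (sections (inverse_image X \<phi> P) V)"
    if \<sigma>: "\<sigma> \<in> carrier (sections (inverse_image X \<phi> P) V)" and \<tau>: "\<tau> \<in> carrier (sections (inverse_image X \<phi> P) V)"
    for \<sigma> \<tau> V
    unfolding mem_inverse_image
  proof (intro conjI ballI)
    fix x assume x: "x \<in> V"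
    obtain A W s where 1: "openin X A" "x \<in> A" "A \<subseteq> V" "openin (base P) W" "\<phi> ` A \<subseteq> W"
      "s \<in> carrier (sections P W)" "\<forall>y\<in>A. \<sigma> y = germ P (\<phi> y) W s"
      using \<sigma> x unfolding mem_inverse_image by blast
    obtain B Y t where 2: "openin X B" "x \<in> B" "B \<subseteq> V" "openin (base P) Y" "\<phi> ` B \<subseteq> Y"
      "t \<in> carrier (sections P Y)" "\<forall>y\<in>B. \<tau> y = germ P (\<phi> y) Y t"
      using \<tau> x unfolding mem_inverse_image by blast
    have WY: "openin (base P) (W \<inter> Y)" using 1 2 by blast
    show "\<exists>V' W s. openin X V' \<and> x \<in> V' \<and> V' \<subseteq> V \<and> openin (base P) W \<and> \<phi> ` V' \<subseteq> W \<and>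
      s \<in> carrier (sections P W) \<and> (\<forall>y\<in>V'. (\<lambda>x\<in>V. \<sigma> x \<otimes>\<^bsub>stalk P (\<phi> x)\<^esub> \<tau> x) y = germ P (\<phi> y) W s)"
    proof (intro exI conjI ballI)
      show "openin X (A \<inter> B)" "x \<in> A \<inter> B" "A \<inter> B \<subseteq> V" "\<phi> ` (A \<inter> B) \<subseteq> W \<inter> Y"
        using 1 2 by auto
      show "restr P W (W \<inter> Y) s \<otimes>\<^bsub>sections P (W \<inter> Y)\<^esub> restr P Y (W \<inter> Y) t \<in> carrier (sections P (W \<inter> Y))"
        by (intro presheaf_mult_closed[OF P] presheaf_restr_closed[OF P]) (use WY 1 2 in auto)
      fix y assume y: "y \<in> A \<inter> B"
      then have "\<phi> y \<in> W" "\<phi> y \<in> Y" using 1(5) 2(5) by auto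
      from stalk_mult_germ[OF P 1(4) this(1) 1(6) 2(4) this(2) 2(6)]
      show "(\<lambda>x\<in>V. \<sigma> x \<otimes>\<^bsub>stalk P (\<phi> x)\<^esub> \<tau> x) y = germ P (\<phi> y) (W \<inter> Y)
         (restr P W (W \<inter> Y) s \<otimes>\<^bsub>sections P (W \<inter> Y)\<^esub> restr P Y (W \<inter> Y) t)"
        using y 1(3,7) 2(7) by auto
    qed (fact WY)
  qed simp
  have one: "(\<lambda>x\<in>V. \<one>\<^bsub>stalk P (\<phi> x)\<^esub>) \<in> carrier (sections (inverse_image X \<phi> P) V)" if V: "openin X V" for V
    unfolding mem_inverse_image
  proof (intro conjI ballI)
    fix x assume x: "x \<in> V"
    have "\<phi> ` V \<subseteq> topspace (base P)" using openin_subset[OF V] \<phi> by (auto simp: continuous_map_def)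
    then show "\<exists>V' W s. openin X V' \<and> x \<in> V' \<and> V' \<subseteq> V \<and> openin (base P) W \<and> \<phi> ` V' \<subseteq> W \<and>
      s \<in> carrier (sections P W) \<and> (\<forall>y\<in>V'. (\<lambda>x\<in>V. \<one>\<^bsub>stalk P (\<phi> x)\<^esub>) y = germ P (\<phi> y) W s)"
      using V x presheaf_one_closed[OF P openin_topspace]
      by (intro exI[of _ V] exI[of _ "topspace (base P)"] exI[of _ "\<one>\<^bsub>sections P (topspace (base P))\<^esub>"])
        (auto simp: stalk_def)
  qed simp
  have ext: "restrict \<sigma> V = \<sigma>" if "\<sigma> \<in> carrier (sections (inverse_image X \<phi> P) V)" for \<sigma> V
    using that unfolding mem_inverse_image by (auto intro: extensional_restrict)
  have res: "restrict \<sigma> W \<in> carrier (sections (inverse_image X \<phi> P) W)"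
    if W: "openin X W" "W \<subseteq> V" and \<sigma>: "\<sigma> \<in> carrier (sections (inverse_image X \<phi> P) V)" for \<sigma> V W
    unfolding mem_inverse_image
  proof (intro conjI ballI)
    fix x assume x: "x \<in> W"
    obtain A Y s where 1: "openin X A" "x \<in> A" "A \<subseteq> V" "openin (base P) Y" "\<phi> ` A \<subseteq> Y"
      "s \<in> carrier (sections P Y)" "\<forall>y\<in>A. \<sigma> y = germ P (\<phi> y) Y s"
      using \<sigma> x W(2) unfolding mem_inverse_image by blast
    have "openin X (A \<inter> W)" using 1 W by blast
    then show "\<exists>V' Y s. openin X V' \<and> x \<in> V' \<and> V' \<subseteq> W \<and> openin (base P) Y \<and> \<phi> ` V' \<subseteq> Y \<and>
      s \<in> carrier (sections P Y) \<and> (\<forall>y\<in>V'. restrict \<sigma> W y = germ P (\<phi> y) Y s)"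
      using 1 x by (intro exI[of _ "A \<inter> W"] exI[of _ Y] exI[of _ s]) auto
  qed simp
  show ?thesis
    unfolding monoid_presheaf_def inverse_image_simps(1)
  proof (intro conjI allI impI; (elim conjE)?)
    fix V assume V: "openin X V"
    show "comm_monoid (sections (inverse_image X \<phi> P) V)"
    proof (rule comm_monoidI; unfold inverse_image_simps)
      show "(\<lambda>x\<in>V. \<one>\<^bsub>stalk P (\<phi> x)\<^esub>) \<in> carrier (sections (inverse_image X \<phi> P) V)" using one[OF V] .
      fix \<sigma> \<tau> assume s: "\<sigma> \<in> carrier (sections (inverse_image X \<phi> P) V)" and t: "\<tau> \<in> carrier (sections (inverse_image X \<phi> P) V)"
      show "(\<lambda>x\<in>V. \<sigma> x \<otimes>\<^bsub>stalk P (\<phi> x)\<^esub> \<tau> x) \<in> carrier (sections (inverse_image X \<phi> P) V)" using mult[OF s t] .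
      show "(\<lambda>x\<in>V. \<sigma> x \<otimes>\<^bsub>stalk P (\<phi> x)\<^esub> \<tau> x) = (\<lambda>x\<in>V. \<tau> x \<otimes>\<^bsub>stalk P (\<phi> x)\<^esub> \<sigma> x)"
        by (rule restrict_ext) (rule comm_monoid.m_comm[OF st[OF V]], auto intro: inverse_image_stalk s t)
      show "(\<lambda>x\<in>V. (\<lambda>x\<in>V. \<one>\<^bsub>stalk P (\<phi> x)\<^esub>) x \<otimes>\<^bsub>stalk P (\<phi> x)\<^esub> \<sigma> x) = \<sigma>"
      proof -
        have "(\<lambda>x\<in>V. (\<lambda>x\<in>V. \<one>\<^bsub>stalk P (\<phi> x)\<^esub>) x \<otimes>\<^bsub>stalk P (\<phi> x)\<^esub> \<sigma> x) = restrict \<sigma> V"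
          by (rule restrict_ext)
            (simp add: monoid.l_one[OF comm_monoid.axioms(1)[OF st[OF V]]] inverse_image_stalk[OF s])
        then show ?thesis using ext[OF s] by simp
      qed
      fix \<upsilon> assume u: "\<upsilon> \<in> carrier (sections (inverse_image X \<phi> P) V)"
      show "(\<lambda>x\<in>V. (\<lambda>x\<in>V. \<sigma> x \<otimes>\<^bsub>stalk P (\<phi> x)\<^esub> \<tau> x) x \<otimes>\<^bsub>stalk P (\<phi> x)\<^esub> \<upsilon> x) =
          (\<lambda>x\<in>V. \<sigma> x \<otimes>\<^bsub>stalk P (\<phi> x)\<^esub> (\<lambda>x\<in>V. \<tau> x \<otimes>\<^bsub>stalk P (\<phi> x)\<^esub> \<upsilon> x) x)"
        by (rule restrict_ext)
          (simp add: monoid.m_assoc[OF comm_monoid.axioms(1)[OF st[OF V]]] inverse_image_stalk[OF s]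
            inverse_image_stalk[OF t] inverse_image_stalk[OF u])
    qed
  next
    fix U V assume V: "openin X V" "V \<subseteq> U"
    show "restr (inverse_image X \<phi> P) U V \<in> hom (sections (inverse_image X \<phi> P) U) (sections (inverse_image X \<phi> P) V)"
      using V by (auto simp: hom_def res fun_eq_iff)
    show "restr (inverse_image X \<phi> P) U V \<one>\<^bsub>sections (inverse_image X \<phi> P) U\<^esub> =
        \<one>\<^bsub>sections (inverse_image X \<phi> P) V\<^esub>"
      using V by (auto simp: fun_eq_iff)
  next
    fix U \<sigma> assume "\<sigma> \<in> carrier (sections (inverse_image X \<phi> P) U)"
    then show "restr (inverse_image X \<phi> P) U U \<sigma> = \<sigma>" by (simp add: ext)
  next
    fix U V W :: "'a set" and \<sigma> assume "W \<subseteq> V"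
    then show "restr (inverse_image X \<phi> P) V W (restr (inverse_image X \<phi> P) U V \<sigma>) =
        restr (inverse_image X \<phi> P) U W \<sigma>" by (auto simp: fun_eq_iff)
  qed
qed

end

section \<open>Sheafification and its stalks\<close>

context
  fixes P :: "('a, 'm) presheaf"
  assumes P: "monoid_presheaf P"
begin

lemma sheafification_monoid: "monoid_presheaf (sheafification P)"
  unfolding sheafification_def by (rule inverse_image_monoid[OF P]) simp

lemma pulled_back_id_closed:
  "openin (base P) U \<Longrightarrow> s \<in> carrier (sections P U) \<Longrightarrow>
    pulled_back_section P (\<lambda>x. x) U s U \<in> carrier (sections (sheafification P) U)"
  unfolding sheafification_def by (rule pulled_back_section_closed[OF P]) auto

text \<open>A section of the sheafification is induced near \<open>x\<close> by some section of
  \<open>P\<close>; shrinking to that neighbourhood gives the representative. With the next lemma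
  this says that \<open>P\<close> and its sheafification have the same stalks.\<close>

lemma sheafification_stalk_cases:
  assumes "p \<in> carrier (stalk (sheafification P) x)"
  obtains U s where "openin (base P) U" "x \<in> U" "s \<in> carrier (sections P U)"
    "p = germ (sheafification P) x U (pulled_back_section P (\<lambda>x. x) U s U)"
proof -
  have b: "base (sheafification P) = base P" by (simp add: sheafification_def inverse_image_def)
  obtain V \<sigma> where V: "openin (base P) V" "x \<in> V" "\<sigma> \<in> carrier (sections (sheafification P) V)"
    "p = germ (sheafification P) x V \<sigma>"
    using assms by (auto simp: stalk_def b)
  obtain V' W s where W: "openin (base P) V'" "x \<in> V'" "V' \<subseteq> V" "openin (base P) W" "V' \<subseteq> W"
    "s \<in> carrier (sections P W)" "\<forall>y\<in>V'. \<sigma> y = germ P y W s"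
    using V(2,3) mem_inverse_image[OF P, of "base P" "\<lambda>x. x" \<sigma> V]
    by (auto simp: sheafification_def)
  have s: "restr P W V' s \<in> carrier (sections P V')"
    using W by (intro presheaf_restr_closed[OF P])
  have "pulled_back_section P (\<lambda>x. x) V' (restr P W V' s) V' = restrict \<sigma> V'"
    unfolding pulled_back_section_def using W germ_restr[OF P W(4,1) _ W(5,6)]
    by (intro restrict_ext) simp
  also have "\<dots> = restr (sheafification P) V V' \<sigma>"
    by (simp add: sheafification_def inverse_image_def)
  finally have "germ (sheafification P) x V' (pulled_back_section P (\<lambda>x. x) V' (restr P W V' s) V') = p"
    using germ_restr[OF sheafification_monoid, unfolded b, OF V(1) W(1,2,3) V(3)] V(4) by simp
  with that[OF W(1,2) s] show thesis by simp
qed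

text \<open>Families of germs that agree near \<open>x\<close> agree at \<open>x\<close>.
  Conversely, an equality of germs at \<open>x\<close> is an equality of sections on a neighbourhood
  and so spreads to all points nearby.\<close>

lemma sheafification_germ_eq_iff:
  assumes U: "openin (base P) U" "x \<in> U" "s \<in> carrier (sections P U)"
    and V: "openin (base P) V" "x \<in> V" "t \<in> carrier (sections P V)"
  shows "germ (sheafification P) x U (pulled_back_section P (\<lambda>x. x) U s U) =
      germ (sheafification P) x V (pulled_back_section P (\<lambda>x. x) V t V) \<longleftrightarrow>
    germ P x U s = germ P x V t"
proof -
  have b: "base (sheafification P) = base P" "\<And>U V \<sigma>. restr (sheafification P) U V \<sigma> = restrict \<sigma> V"
    by (simp_all add: sheafification_def inverse_image_def)
  have "germ (sheafification P) x U (pulled_back_section P (\<lambda>x. x) U s U) =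
      germ (sheafification P) x V (pulled_back_section P (\<lambda>x. x) V t V) \<longleftrightarrow>
    (\<exists>W. openin (base P) W \<and> x \<in> W \<and> W \<subseteq> U \<inter> V \<and>
       restrict (pulled_back_section P (\<lambda>x. x) U s U) W = restrict (pulled_back_section P (\<lambda>x. x) V t V) W)"
    by (subst germ_eq_iff[OF sheafification_monoid])
      (use U V pulled_back_id_closed in \<open>auto simp: b\<close>)
  also have "\<dots> \<longleftrightarrow> (\<exists>W. openin (base P) W \<and> x \<in> W \<and> W \<subseteq> U \<inter> V \<and>
       (\<forall>y\<in>W. germ P y U s = germ P y V t))"
  proof -
    have "restrict (pulled_back_section P (\<lambda>x. x) U s U) W = restrict (pulled_back_section P (\<lambda>x. x) V t V) W
      \<longleftrightarrow> (\<forall>y\<in>W. germ P y U s = germ P y V t)" if "W \<subseteq> U \<inter> V" for W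
      unfolding pulled_back_section_def fun_eq_iff using that by (auto simp: restrict_def)
    then show ?thesis by metis
  qed
  also have "\<dots> \<longleftrightarrow> germ P x U s = germ P x V t"
  proof
    assume "germ P x U s = germ P x V t"
    then obtain W where W: "openin (base P) W" "x \<in> W" "W \<subseteq> U \<inter> V" "restr P U W s = restr P V W t"
      using germ_eq_iff[OF P U V] by blast
    then have "germ P y U s = germ P y V t" if "y \<in> W" for y
      using germ_eq_iff[OF P U(1) _ U(3) V(1) _ V(3), of y] that by blast
    then show "\<exists>W. openin (base P) W \<and> x \<in> W \<and> W \<subseteq> U \<inter> V \<and> (\<forall>y\<in>W. germ P y U s = germ P y V t)"
      using W by blast
  qed blast
  finally show ?thesis .
qed

lemma sheafification_germ_mult:
  assumes U: "openin (base P) U" "x \<in> U" "s \<in> carrier (sections P U)"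
    and V: "openin (base P) V" "x \<in> V" "t \<in> carrier (sections P V)"
  shows "germ (sheafification P) x U (pulled_back_section P (\<lambda>x. x) U s U) \<otimes>\<^bsub>stalk (sheafification P) x\<^esub>
      germ (sheafification P) x V (pulled_back_section P (\<lambda>x. x) V t V) =
    germ (sheafification P) x (U \<inter> V) (pulled_back_section P (\<lambda>x. x) (U \<inter> V)
      (restr P U (U \<inter> V) s \<otimes>\<^bsub>sections P (U \<inter> V)\<^esub> restr P V (U \<inter> V) t) (U \<inter> V))"
proof -
  have b: "base (sheafification P) = base P" "\<And>U V \<sigma>. restr (sheafification P) U V \<sigma> = restrict \<sigma> V"
    "\<And>U \<sigma> \<tau>. \<sigma> \<otimes>\<^bsub>sections (sheafification P) U\<^esub> \<tau> = (\<lambda>x\<in>U. \<sigma> x \<otimes>\<^bsub>stalk P x\<^esub> \<tau> x)"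
    by (simp_all add: sheafification_def inverse_image_def)
  have "(\<lambda>y\<in>U \<inter> V. restrict (pulled_back_section P (\<lambda>x. x) U s U) (U \<inter> V) y \<otimes>\<^bsub>stalk P y\<^esub>
      restrict (pulled_back_section P (\<lambda>x. x) V t V) (U \<inter> V) y) =
    pulled_back_section P (\<lambda>x. x) (U \<inter> V)
      (restr P U (U \<inter> V) s \<otimes>\<^bsub>sections P (U \<inter> V)\<^esub> restr P V (U \<inter> V) t) (U \<inter> V)"
    unfolding pulled_back_section_def
    by (rule restrict_ext) (use stalk_mult_germ[OF P U(1) _ U(3) V(1) _ V(3)] in simp)
  then show ?thesis
    using stalk_mult_germ[OF sheafification_monoid, unfolded b, OF U(1,2) pulled_back_id_closed[OF U(1,3)]
        V(1,2) pulled_back_id_closed[OF V(1,3)]] by simp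
qed

end

section \<open>Germs of fractions\<close>

definition frac_section :: "('a, 'm) presheaf \<Rightarrow> 'a set \<Rightarrow> 'm \<Rightarrow> 'm \<Rightarrow> ('a, 'm) gp_section" where
  "frac_section F U a b = (\<lambda>y\<in>U. germ (gp_presheaf F) y U (gp_rel (sections F U) `` {(a, b)}))"

text \<open>A germ of a family of germs: sheafification turns the fraction into the family of its
  germs, and the inverse image takes germs once more. All stalk elements occurring in the theorem
  are handled in this form.\<close>

definition frac_germ :: "('a, 'm) presheaf \<Rightarrow> 'a \<Rightarrow> 'a set \<Rightarrow> 'm \<Rightarrow> 'm \<Rightarrow>
    ('a set \<times> ('a, 'm) gp_section) set" where
  "frac_germ F x U a b = germ (gp_sheaf F) x U (frac_section F U a b)"

lemma to_gp_eq_frac_section: "to_gp F U m = frac_section F U m \<one>\<^bsub>sections F U\<^esub>"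
  by (simp add: to_gp_def frac_section_def)

lemma frac_section_pulled_back:
  "frac_section F U a b =
    pulled_back_section (gp_presheaf F) (\<lambda>x. x) U (gp_rel (sections F U) `` {(a, b)}) U"
  by (simp add: frac_section_def pulled_back_section_def)

context
  fixes F :: "('a, 'm) presheaf"
  assumes F: "monoid_presheaf F"
begin

lemma gp_sheaf_monoid: "monoid_presheaf (gp_sheaf F)"
  unfolding gp_sheaf_def by (intro sheafification_monoid gp_presheaf_monoid F)

lemma frac_section_closed:
  assumes "openin (base F) U" "a \<in> carrier (sections F U)" "b \<in> carrier (sections F U)"
  shows "frac_section F U a b \<in> carrier (sections (gp_sheaf F) U)"
  unfolding frac_section_pulled_back gp_sheaf_def
  using assms by (intro pulled_back_id_closed gp_presheaf_monoid F)
    (auto intro: gp_class_closed presheaf_comm_monoid[OF F])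

lemma gp_germ_eq_iff:
  assumes U: "openin (base F) U" "x \<in> U" and ab: "a \<in> carrier (sections F U)" "b \<in> carrier (sections F U)"
    and V: "openin (base F) V" "x \<in> V" and cd: "c \<in> carrier (sections F V)" "d \<in> carrier (sections F V)"
  shows "germ (gp_presheaf F) x U (gp_rel (sections F U) `` {(a, b)}) =
      germ (gp_presheaf F) x V (gp_rel (sections F V) `` {(c, d)}) \<longleftrightarrow>
    (\<exists>W. openin (base F) W \<and> x \<in> W \<and> W \<subseteq> U \<inter> V \<and> (\<exists>e\<in>carrier (sections F W).
      e \<otimes>\<^bsub>sections F W\<^esub> (restr F U W a \<otimes>\<^bsub>sections F W\<^esub> restr F V W d) =
      e \<otimes>\<^bsub>sections F W\<^esub> (restr F V W c \<otimes>\<^bsub>sections F W\<^esub> restr F U W b)))"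
proof -
  have "restr (gp_presheaf F) U W (gp_rel (sections F U) `` {(a, b)}) =
      restr (gp_presheaf F) V W (gp_rel (sections F V) `` {(c, d)}) \<longleftrightarrow>
    (\<exists>e\<in>carrier (sections F W).
      e \<otimes>\<^bsub>sections F W\<^esub> (restr F U W a \<otimes>\<^bsub>sections F W\<^esub> restr F V W d) =
      e \<otimes>\<^bsub>sections F W\<^esub> (restr F V W c \<otimes>\<^bsub>sections F W\<^esub> restr F U W b))"
    if "openin (base F) W" "W \<subseteq> U \<inter> V" for W
    using that U V ab cd
    by (simp add: gp_restr_class[OF F] gp_class_eq_iff[OF presheaf_comm_monoid[OF F]] presheaf_restr_closed[OF F])
  then show ?thesis
    using U V gp_class_closed[OF presheaf_comm_monoid[OF F U(1)] ab]
      gp_class_closed[OF presheaf_comm_monoid[OF F V(1)] cd]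
    by (subst germ_eq_iff[OF gp_presheaf_monoid[OF F]]) auto
qed

lemma gp_germ_mult:
  assumes U: "openin (base F) U" "x \<in> U" and ab: "a \<in> carrier (sections F U)" "b \<in> carrier (sections F U)"
    and V: "openin (base F) V" "x \<in> V" and cd: "c \<in> carrier (sections F V)" "d \<in> carrier (sections F V)"
  shows "germ (gp_presheaf F) x U (gp_rel (sections F U) `` {(a, b)}) \<otimes>\<^bsub>stalk (gp_presheaf F) x\<^esub>
      germ (gp_presheaf F) x V (gp_rel (sections F V) `` {(c, d)}) =
    germ (gp_presheaf F) x (U \<inter> V) (gp_rel (sections F (U \<inter> V)) ``
      {(restr F U (U \<inter> V) a \<otimes>\<^bsub>sections F (U \<inter> V)\<^esub> restr F V (U \<inter> V) c,
        restr F U (U \<inter> V) b \<otimes>\<^bsub>sections F (U \<inter> V)\<^esub> restr F V (U \<inter> V) d)})"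
proof -
  have UV: "openin (base F) (U \<inter> V)" using U V by blast
  show ?thesis
    using stalk_mult_germ[OF gp_presheaf_monoid[OF F], unfolded gp_presheaf_simps,
        OF U gp_class_closed[OF presheaf_comm_monoid[OF F U(1)] ab]
        V gp_class_closed[OF presheaf_comm_monoid[OF F V(1)] cd]] U V UV ab cd
    by (simp add: gp_restr_class[OF F] gp_class_mult[OF presheaf_comm_monoid[OF F]] presheaf_restr_closed[OF F])
qed

lemma gp_stalk_cases:
  assumes "p \<in> carrier (stalk (gp_presheaf F) x)"
  obtains U a b where "openin (base F) U" "x \<in> U" "a \<in> carrier (sections F U)" "b \<in> carrier (sections F U)"
    "p = germ (gp_presheaf F) x U (gp_rel (sections F U) `` {(a, b)})"
  using assms gp_class_cases[OF presheaf_comm_monoid[OF F]]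
  unfolding stalk_def by simp metis

text \<open>Both layers of germs collapse because sheafification keeps stalks. What remains is an
  equation between sections near \<open>x\<close>, with the multiplier \<open>e\<close> of the group
  completion.\<close>

lemma frac_germ_eq_iff:
  assumes U: "openin (base F) U" "x \<in> U" and ab: "a \<in> carrier (sections F U)" "b \<in> carrier (sections F U)"
    and V: "openin (base F) V" "x \<in> V" and cd: "c \<in> carrier (sections F V)" "d \<in> carrier (sections F V)"
  shows "frac_germ F x U a b = frac_germ F x V c d \<longleftrightarrow>
    (\<exists>W. openin (base F) W \<and> x \<in> W \<and> W \<subseteq> U \<inter> V \<and> (\<exists>e\<in>carrier (sections F W).
      e \<otimes>\<^bsub>sections F W\<^esub> (restr F U W a \<otimes>\<^bsub>sections F W\<^esub> restr F V W d) =
      e \<otimes>\<^bsub>sections F W\<^esub> (restr F V W c \<otimes>\<^bsub>sections F W\<^esub> restr F U W b)))"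
  unfolding frac_germ_def frac_section_pulled_back gp_sheaf_def
  using sheafification_germ_eq_iff[OF gp_presheaf_monoid[OF F], unfolded gp_presheaf_simps,
      OF U gp_class_closed[OF presheaf_comm_monoid[OF F U(1)] ab]
        V gp_class_closed[OF presheaf_comm_monoid[OF F V(1)] cd]]
  unfolding gp_germ_eq_iff[OF U ab V cd] .

lemma frac_germ_mult:
  assumes U: "openin (base F) U" "x \<in> U" and ab: "a \<in> carrier (sections F U)" "b \<in> carrier (sections F U)"
    and V: "openin (base F) V" "x \<in> V" and cd: "c \<in> carrier (sections F V)" "d \<in> carrier (sections F V)"
  shows "frac_germ F x U a b \<otimes>\<^bsub>stalk (gp_sheaf F) x\<^esub> frac_germ F x V c d =
    frac_germ F x (U \<inter> V) (restr F U (U \<inter> V) a \<otimes>\<^bsub>sections F (U \<inter> V)\<^esub> restr F V (U \<inter> V) c)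
        (restr F U (U \<inter> V) b \<otimes>\<^bsub>sections F (U \<inter> V)\<^esub> restr F V (U \<inter> V) d)"
proof -
  have UV: "openin (base F) (U \<inter> V)" using U V by blast
  show ?thesis
    unfolding frac_germ_def frac_section_pulled_back gp_sheaf_def
    using sheafification_germ_mult[OF gp_presheaf_monoid[OF F], unfolded gp_presheaf_simps,
        OF U gp_class_closed[OF presheaf_comm_monoid[OF F U(1)] ab]
        V gp_class_closed[OF presheaf_comm_monoid[OF F V(1)] cd]] U V UV ab cd
    by (simp add: gp_restr_class[OF F] gp_class_mult[OF presheaf_comm_monoid[OF F]] presheaf_restr_closed[OF F])
qed

lemma frac_germ_cases:
  assumes "p \<in> carrier (stalk (gp_sheaf F) x)"
  obtains U a b where "openin (base F) U" "x \<in> U" "a \<in> carrier (sections F U)" "b \<in> carrier (sections F U)"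
    "p = frac_germ F x U a b"
proof -
  obtain U s where U: "openin (base F) U" "x \<in> U" "s \<in> carrier (group_completion (sections F U))"
    "p = germ (gp_sheaf F) x U (pulled_back_section (gp_presheaf F) (\<lambda>x. x) U s U)"
    using sheafification_stalk_cases[OF gp_presheaf_monoid[OF F], of p x] assms
    unfolding gp_sheaf_def gp_presheaf_simps by metis
  obtain a b where "a \<in> carrier (sections F U)" "b \<in> carrier (sections F U)"
    "s = gp_rel (sections F U) `` {(a, b)}"
    using gp_class_cases[OF presheaf_comm_monoid[OF F U(1)] U(3)] .
  with that U show thesis unfolding frac_germ_def frac_section_pulled_back by blast
qed

lemma frac_germ_closed:
  assumes "openin (base F) U" "x \<in> U" "a \<in> carrier (sections F U)" "b \<in> carrier (sections F U)"
  shows "frac_germ F x U a b \<in> carrier (stalk (gp_sheaf F) x)"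
proof -
  have "base (gp_sheaf F) = base F"
    by (simp add: gp_sheaf_def sheafification_def inverse_image_def)
  then show ?thesis
    using assms frac_section_closed[OF assms(1,3,4)] unfolding stalk_def frac_germ_def by auto
qed

lemma one_gp_stalk:
  "\<one>\<^bsub>stalk (gp_sheaf F) x\<^esub> = frac_germ F x (topspace (base F))
    \<one>\<^bsub>sections F (topspace (base F))\<^esub> \<one>\<^bsub>sections F (topspace (base F))\<^esub>"
  by (simp add: frac_germ_def frac_section_def stalk_def gp_sheaf_def sheafification_def inverse_image_def
      group_completion_def)

end

text \<open>The only neighbourhood of \<open>()\<close> is \<open>UNIV\<close>, so being locally
  induced is no more than being a germ: sections over the point are the elements of one
  stalk.\<close>

lemma sections_over_point:
  fixes \<phi> :: "unit \<Rightarrow> 'b"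
  shows "carrier (sections (inverse_image (discrete_topology UNIV) \<phi> P) UNIV) =
    {\<sigma>. \<sigma> () \<in> carrier (stalk P (\<phi> ()))}"
proof -
  have "(\<exists>V' W s. () \<in> V' \<and> openin (base P) W \<and> \<phi> ` V' \<subseteq> W \<and> s \<in> carrier (sections P W) \<and>
      restrict \<sigma> V' = pulled_back_section P \<phi> W s V') \<longleftrightarrow> \<sigma> () \<in> carrier (stalk P (\<phi> ()))" for \<sigma>
  proof -
    have *: "() \<in> V' \<longleftrightarrow> V' = UNIV" for V' :: "unit set" by auto
    have "restrict \<sigma> UNIV = pulled_back_section P \<phi> W s UNIV \<longleftrightarrow> \<sigma> () = germ P (\<phi> ()) W s" for W s
      by (simp add: pulled_back_section_def fun_eq_iff)
    then show ?thesis by (auto simp: * stalk_def UNIV_unit)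
  qed
  then show ?thesis by (simp add: inverse_image_def)
qed

text \<open>A presheaf morphism has a component over the empty set as well; extensionality leaves
  exactly one section there.\<close>

lemma sections_over_empty:
  "openin X {} \<Longrightarrow> carrier (sections (inverse_image X \<phi> P) {}) = {\<lambda>_. undefined}"
  by (auto simp: inverse_image_def)

section \<open>Coordinate changes\<close>

lemma openin_Euclidean_preimage:
  fixes f :: "(nat \<Rightarrow> real) \<Rightarrow> 'b :: topological_space"
  assumes W: "openin (Euclidean_space n) W" and f: "continuous_on W f" and T: "open T"
  shows "openin (Euclidean_space n) (W \<inter> f -` T)"
proof -
  have "openin (top_of_set W) (W \<inter> f -` T)"
    using f T by (rule continuous_openin_preimage_gen)
  then have "openin (subtopology (Euclidean_space n) W) (W \<inter> f -` T)"
    using openin_Euclidean_subset[OF W]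
    by (simp add: Euclidean_space_eq subtopology_subtopology inf.absorb2)
  then show ?thesis using W openin_trans_full by blast
qed

text \<open>The filter ignores \<open>a\<close> itself, so the values at \<open>a\<close> are
  compared separately. It is applied to curves that are known to lie in a chart only for small
  parameters.\<close>

lemma has_real_derivative_transform_eventually:
  fixes f g :: "real \<Rightarrow> real"
  assumes "(f has_real_derivative D) (at a within S)"
    and "\<forall>\<^sub>F t in at a within S. f t = g t" and "f a = g a"
  shows "(g has_real_derivative D) (at a within S)"
proof -
  have "\<forall>\<^sub>F t in at a within S. (f t - f a) / (t - a) = (g t - g a) / (t - a)"
    using assms(2) by eventually_elim (simp add: assms(3))
  with assms(1) show ?thesis
    unfolding has_field_derivative_iff by (rule Lim_transform_eventually)
qed

text \<open>At a boundary point a coordinate can only grow, so derivatives along curves in the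
  manifold are one-sided; a half-line still determines the limit.\<close>

lemma right_derivative_unique:
  fixes f :: "real \<Rightarrow> real"
  assumes "(f has_real_derivative D) (at a within {a..})" "(f has_real_derivative E) (at a within {a..})"
  shows "D = E"
  by (rule tendsto_unique[OF _ assms[unfolded has_field_derivative_iff]]) (simp add: at_within_Ici_at_right)

text \<open>Brings a two-sided partial derivative of an extension into the form of
  \<open>coord_vector\<close>, with parameter starting at 0.\<close>

lemma partial_derivative_shift:
  fixes f :: "(nat \<Rightarrow> real) \<Rightarrow> real"
  assumes "((\<lambda>t. f (p(i := t))) has_real_derivative D) (at (p i))"
  shows "((\<lambda>t. f (p(i := p i + t))) has_real_derivative D) (at 0 within S)"
proof -
  have "((\<lambda>t. p i + t) has_real_derivative 1) (at 0 within S)"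
    by (auto intro!: derivative_eq_intros)
  from DERIV_chain2[OF _ this, of "\<lambda>u. f (p(i := u))" D] assms show ?thesis by simp
qed

section \<open>Charts as relatively open subsets of orthants\<close>

context
  fixes M :: "'a corners"
  assumes M: "manifold_with_corners M"
begin

lemma atlas_chart: "c \<in> atlas M \<Longrightarrow> corner_chart (points M) c"
  using M unfolding manifold_with_corners_def by blast

lemma atlas_compatible: "c \<in> atlas M \<Longrightarrow> d \<in> atlas M \<Longrightarrow> compatible c d"
  using M unfolding manifold_with_corners_def by blast

lemma atlas_covers: "x \<in> topspace (points M) \<Longrightarrow> \<exists>c\<in>atlas M. x \<in> cdom c"
  using M unfolding manifold_with_corners_def by blast

context
  fixes c :: "'a chart"
  assumes c: "c \<in> atlas M"
begin

lemma chart_image_openin_orthant: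
  "openin (subtopology (Euclidean_space (cdim c)) (orthant (cdim c))) (coord c ` cdom c)"
  using atlas_chart[OF c] by (simp add: corner_chart_def)

lemma chart_inv_image:
  assumes "p \<in> coord c ` V" "V \<subseteq> cdom c"
  shows "chart_inv c p \<in> V" "coord c (chart_inv c p) = p"
  using assms chart_facts(2)[OF M c] by auto

lemma chart_orthant: "y \<in> cdom c \<Longrightarrow> coord c y \<in> orthant (cdim c)"
  using openin_subset[OF chart_image_openin_orthant] by auto

lemma chart_nonneg: "y \<in> cdom c \<Longrightarrow> i < cdim c \<Longrightarrow> 0 \<le> coord c y i"
  using chart_orthant by (simp add: orthant_def)

lemma chart_Euclidean: "y \<in> cdom c \<Longrightarrow> coord c y \<in> topspace (Euclidean_space (cdim c))"
  using chart_orthant by (simp add: orthant_def)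

lemma topspace_chart: "topspace (subtopology (points M) (cdom c)) = cdom c"
  using openin_subset[OF chart_facts(1)[OF M c]] by (simp add: inf.absorb2)

lemma chart_homeomorphic:
  "homeomorphic_map (subtopology (points M) (cdom c))
     (subtopology (Euclidean_space (cdim c)) (coord c ` cdom c)) (coord c)"
  using atlas_chart[OF c] by (simp add: corner_chart_def)

lemma chart_open_image:
  assumes V: "openin (points M) V" "V \<subseteq> cdom c"
  obtains T where "openin (Euclidean_space (cdim c)) T" "coord c ` V = T \<inter> orthant (cdim c)"
proof -
  let ?E = "Euclidean_space (cdim c)"
  have "openin (subtopology (points M) (cdom c)) V"
    using V by (auto simp: openin_subtopology)
  then have "openin (subtopology ?E (coord c ` cdom c)) (coord c ` V)"
    using homeomorphic_imp_open_map[OF chart_homeomorphic] by (simp add: open_map_def)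
  then obtain A where A: "openin ?E A" "coord c ` V = A \<inter> coord c ` cdom c"
    by (auto simp: openin_subtopology)
  obtain B where B: "openin ?E B" "coord c ` cdom c = B \<inter> orthant (cdim c)"
    using chart_image_openin_orthant by (auto simp: openin_subtopology)
  show thesis
    by (rule that[of "A \<inter> B"]) (use A B in auto)
qed

lemma chart_open_preimage:
  assumes "openin (Euclidean_space (cdim c)) T"
  shows "openin (points M) {y \<in> cdom c. coord c y \<in> T}"
proof -
  have "openin (subtopology (Euclidean_space (cdim c)) (coord c ` cdom c)) (T \<inter> coord c ` cdom c)"
    using assms by (auto simp: openin_subtopology)
  from openin_continuous_map_preimage[OF homeomorphic_imp_continuous_map[OF chart_homeomorphic] this]
  have "openin (subtopology (points M) (cdom c)) {y \<in> cdom c. coord c y \<in> T}"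
    unfolding topspace_chart by (rule back_subst[of "openin _"]) auto
  then show ?thesis
    using openin_trans_full chart_facts(1)[OF M c] by blast
qed

text \<open>The way to produce curves in the manifold: the image of \<open>V\<close> is the trace of
  an open set on the orthant, so tuples in the orthant that converge to the coordinates of
  \<open>x\<close> end up in it.\<close>

lemma eventually_in_chart_image:
  assumes V: "openin (points M) V" "V \<subseteq> cdom c" "x \<in> V"
    and ev: "\<forall>\<^sub>F t in F. \<gamma> t \<in> orthant (cdim c)"
    and lim: "\<And>i. i < cdim c \<Longrightarrow> ((\<lambda>t. \<gamma> t i) \<longlongrightarrow> coord c x i) F"
  shows "\<forall>\<^sub>F t in F. \<gamma> t \<in> coord c ` V"
proof -
  obtain T where T: "openin (Euclidean_space (cdim c)) T" "coord c ` V = T \<inter> orthant (cdim c)"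
    using chart_open_image[OF V(1,2)] .
  have "\<forall>\<^sub>F t in F. \<gamma> t \<in> T"
  proof (rule eventually_in_open_Euclidean[OF T(1) _ _ lim])
    show "coord c x \<in> T" using T V by auto
    show "\<forall>\<^sub>F t in F. \<gamma> t \<in> topspace (Euclidean_space (cdim c))"
      using ev by eventually_elim (simp add: orthant_def)
  qed
  with ev show ?thesis by eventually_elim (simp add: T)
qed

lemma eventually_right_in_chart_image:
  assumes V: "openin (points M) V" "V \<subseteq> cdom c" "x \<in> V" and i: "i < cdim c"
  shows "\<forall>\<^sub>F t in at 0 within {0..}. (coord c x)(i := coord c x i + t) \<in> coord c ` V"
proof (rule eventually_in_chart_image[OF V])
  have x: "coord c x \<in> orthant (cdim c)" using V chart_orthant by blast
  have "\<forall>\<^sub>F t :: real in at 0 within {0..}. t \<in> {0..}" by (simp add: eventually_at_filter)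
  then show "\<forall>\<^sub>F t in at 0 within {0..}. (coord c x)(i := coord c x i + t) \<in> orthant (cdim c)"
    by eventually_elim (use x i in \<open>auto simp: orthant_def topspace_Euclidean_space\<close>)
  show "((\<lambda>t. ((coord c x)(i := coord c x i + t)) j) \<longlongrightarrow> coord c x j) (at 0 within {0..})" for j
    by (cases "j = i") (auto intro!: tendsto_eq_intros)
qed

text \<open>\<open>H\<close> has a minimum at \<open>coord c y\<close> relative to the orthant. As
  the \<open>i\<close>-th coordinate is positive there, small moves in both senses of direction
  \<open>i\<close> stay in the orthant, so the minimum is a genuine local one along this
  line.\<close>

lemma interior_min_derivative:
  assumes V: "openin (points M) V" "V \<subseteq> cdom c" "y \<in> V" and i: "i < cdim c" and pos: "0 < coord c y i"
    and H: "\<And>z. z \<in> V \<Longrightarrow> 0 \<le> H (coord c z)" and H0: "H (coord c y) = 0"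
    and D: "((\<lambda>t. H ((coord c y)(i := t))) has_real_derivative D) (at (coord c y i))"
  shows "D = 0"
proof -
  have "\<forall>\<^sub>F t in nhds (coord c y i). (coord c y)(i := t) \<in> coord c ` V"
  proof (rule eventually_in_chart_image[OF V])
    have "\<forall>\<^sub>F t in nhds (coord c y i). 0 < t"
      using pos by (rule order_tendstoD(1)[OF filterlim_ident])
    then show "\<forall>\<^sub>F t in nhds (coord c y i). (coord c y)(i := t) \<in> orthant (cdim c)"
      by eventually_elim (use chart_orthant[of y] V i in \<open>auto simp: orthant_def topspace_Euclidean_space\<close>)
    show "((\<lambda>t. ((coord c y)(i := t)) j) \<longlongrightarrow> coord c y j) (nhds (coord c y i))" for j
      by (cases "j = i") (auto simp: filterlim_ident)
  qed
  then obtain d where d: "d > 0"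
    "\<And>t. dist t (coord c y i) < d \<Longrightarrow> (coord c y)(i := t) \<in> coord c ` V"
    unfolding eventually_nhds_metric by blast
  show ?thesis
  proof (rule DERIV_local_min[OF D d(1)], intro allI impI)
    fix t assume "\<bar>coord c y i - t\<bar> < d"
    then have "(coord c y)(i := t) \<in> coord c ` V"
      by (intro d(2)) (simp add: dist_real_def abs_minus_commute)
    then have "0 \<le> H ((coord c y)(i := t))" using H by auto
    then show "H ((coord c y)(i := coord c y i)) \<le> H ((coord c y)(i := t))" by (simp add: H0)
  qed
qed

end

section \<open>Smooth functions and transition maps\<close>

lemma smooth_functionsE:
  assumes "f \<in> smooth_functions M U" "c \<in> atlas M" "x \<in> U" "x \<in> cdom c"
  obtains V W F where "openin (points M) V" "x \<in> V" "V \<subseteq> U" "V \<subseteq> cdom c"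
    "openin (Euclidean_space (cdim c)) W" "coord c ` V \<subseteq> W" "\<forall>k. cont_diff k (cdim c) W F"
    "\<And>y. y \<in> V \<Longrightarrow> F (coord c y) = f y"
proof -
  obtain V where V: "openin (points M) V" "x \<in> V" "V \<subseteq> U \<inter> cdom c"
    "smooth_on (cdim c) (coord c ` V) (f \<circ> chart_inv c)"
    using assms unfolding smooth_functions_def by blast
  then obtain W F where W: "openin (Euclidean_space (cdim c)) W" "coord c ` V \<subseteq> W"
    "\<forall>k. cont_diff k (cdim c) W F" "\<forall>p\<in>coord c ` V. F p = (f \<circ> chart_inv c) p"
    unfolding smooth_on_def by blast
  show thesis
    by (rule that[OF V(1,2) _ _ W(1-3)])
      (use V(3) W(4) chart_facts(2)[OF M assms(2)] in \<open>auto simp: subset_iff\<close>)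
qed

lemma transition_extension:
  assumes c: "c \<in> atlas M" and d: "d \<in> atlas M" and k: "k < cdim c"
  obtains W T where "openin (Euclidean_space (cdim d)) W" "coord d ` (cdom c \<inter> cdom d) \<subseteq> W"
    "\<forall>l. cont_diff l (cdim d) W T" "\<And>y. y \<in> cdom c \<Longrightarrow> y \<in> cdom d \<Longrightarrow> T (coord d y) = coord c y k"
proof -
  have "smooth_on (cdim d) (coord d ` (cdom c \<inter> cdom d)) (\<lambda>p. (coord c \<circ> chart_inv d) p k)"
    using atlas_compatible[OF c d] k by (simp add: compatible_def smooth_map_def)
  then obtain W T where W: "openin (Euclidean_space (cdim d)) W" "coord d ` (cdom c \<inter> cdom d) \<subseteq> W"
    "\<forall>l. cont_diff l (cdim d) W T"
    "\<forall>p\<in>coord d ` (cdom c \<inter> cdom d). T p = (coord c \<circ> chart_inv d) p k"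
    unfolding smooth_on_def by blast
  show thesis
    by (rule that[OF W(1-3)]) (use W(4) chart_facts(2)[OF M d] in auto)
qed

text \<open>One chart is enough to test smoothness. In another chart \<open>d\<close> the extension
  is \<open>F\<close> composed with an extension \<open>\<tau>\<close> of the transition map from
  \<open>d\<close> to \<open>c\<close>.\<close>

lemma smooth_functions_chartI:
  assumes c: "c \<in> atlas M" and V: "openin (points M) V" "V \<subseteq> cdom c" and f: "f \<in> extensional V"
    and W: "openin (Euclidean_space (cdim c)) W" "coord c ` V \<subseteq> W" and F: "\<forall>k. cont_diff k (cdim c) W F"
    and eq: "\<And>y. y \<in> V \<Longrightarrow> F (coord c y) = f y"
  shows "f \<in> smooth_functions M V"
proof -
  let ?n = "cdim c"
  have "smooth_on (cdim d) (coord d ` (V \<inter> cdom d)) (f \<circ> chart_inv d)" if d: "d \<in> atlas M" for d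
  proof -
    let ?m = "cdim d"
    have "\<forall>k. \<exists>A T. k < ?n \<longrightarrow> openin (Euclidean_space ?m) A \<and> coord d ` (cdom c \<inter> cdom d) \<subseteq> A \<and>
      (\<forall>l. cont_diff l ?m A T) \<and> (\<forall>y\<in>cdom c \<inter> cdom d. T (coord d y) = coord c y k)"
      using transition_extension[OF c d] by (metis IntD1 IntD2)
    then obtain A T where A: "\<And>k. k < ?n \<Longrightarrow> openin (Euclidean_space ?m) (A k)"
      "\<And>k. k < ?n \<Longrightarrow> coord d ` (cdom c \<inter> cdom d) \<subseteq> A k"
      and T: "\<And>k l. k < ?n \<Longrightarrow> cont_diff l ?m (A k) (T k)"
      "\<And>k y. k < ?n \<Longrightarrow> y \<in> cdom c \<Longrightarrow> y \<in> cdom d \<Longrightarrow> T k (coord d y) = coord c y k"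
      by (metis IntI)
    \<comment> \<open>The components of the transition map are extended to different open sets. For
      \<open>cdim c = 0\<close> there are none of them, hence the explicit
      \<open>topspace\<close>.\<close>
    define B where "B = topspace (Euclidean_space ?m) \<inter> (\<Inter>k\<in>{..<?n}. A k)"
    have B: "openin (Euclidean_space ?m) B"
    proof (cases "?n = 0")
      case False
      then have "openin (Euclidean_space ?m) (\<Inter>k\<in>{..<?n}. A k)"
        using A(1) by (intro openin_INT2) auto
      then show ?thesis unfolding B_def by blast
    qed (simp add: B_def)
    define \<tau> where "\<tau> q = (\<lambda>k. if k < ?n then T k q else 0)" for q
    have TB: "cont_diff l ?m B (T k)" if "k < ?n" for k l
      using T(1)[OF that] by (rule cont_diff_subset) (use that in \<open>auto simp: B_def\<close>)
    have \<tau>c: "continuous_on B \<tau>"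
      unfolding \<tau>_def
    proof (rule continuous_on_coordinatewise_then_product)
      show "continuous_on B (\<lambda>q. if k < ?n then T k q else 0)" for k
        using cont_diff_continuous_on[OF B TB] by (cases "k < ?n") auto
    qed
    obtain O' where O': "open O'" "W = topspace (Euclidean_space ?n) \<inter> O'"
      using W by (auto simp: Euclidean_space_eq openin_open)
    \<comment> \<open>Away from the manifold \<open>\<tau>\<close> may leave the domain
      \<open>W\<close> of \<open>F\<close>; the preimage of \<open>W\<close> is open and still
      contains the chart image.\<close>
    define C where "C = B \<inter> \<tau> -` O'"
    have C: "openin (Euclidean_space ?m) C"
      unfolding C_def by (rule openin_Euclidean_preimage[OF B \<tau>c O'(1)])
    have \<tau>E: "\<tau> q \<in> topspace (Euclidean_space ?n)" for q
      by (simp add: \<tau>_def topspace_Euclidean_space)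
    have \<tau>y: "\<tau> (coord d y) = coord c y" if "y \<in> V \<inter> cdom d" for y
      using that V(2) chart_Euclidean[OF c, of y] T(2)
      by (auto simp: \<tau>_def fun_eq_iff topspace_Euclidean_space subset_iff)
    have "\<forall>l. cont_diff l ?m C (\<lambda>q. F (\<tau> q))"
      unfolding \<tau>_def
    proof (intro allI cont_diff_compose[OF W(1) C])
      show "cont_diff l ?m C (T k)" if "k < ?n" for k l
        using TB[OF that] by (rule cont_diff_subset) (simp add: C_def)
      show "(\<lambda>k. if k < ?n then T k q else 0) \<in> W" if "q \<in> C" for q
        using that \<tau>E[of q] by (simp add: C_def O' \<tau>_def)
    qed (use F in blast)
    moreover have "coord d ` (V \<inter> cdom d) \<subseteq> C"
    proof (rule image_subsetI)
      fix y assume y: "y \<in> V \<inter> cdom d"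
      have "coord d y \<in> B"
        unfolding B_def using y V(2) A(2) chart_Euclidean[OF d, of y] by auto
      moreover have "\<tau> (coord d y) \<in> O'" using y W(2) O' \<tau>y[OF y] by auto
      ultimately show "coord d y \<in> C" by (simp add: C_def)
    qed
    moreover have "F (\<tau> p) = (f \<circ> chart_inv d) p" if "p \<in> coord d ` (V \<inter> cdom d)" for p
      using that \<tau>y eq chart_facts(2)[OF M d] by auto
    ultimately show ?thesis
      unfolding smooth_on_def using C by (intro exI[of _ C] exI[of _ "\<lambda>q. F (\<tau> q)"] conjI ballI)
  qed
  moreover have "openin (points M) (V \<inter> cdom d)" if "d \<in> atlas M" for d
    using V(1) chart_facts(1)[OF M that] by blast
  ultimately show ?thesis
    unfolding smooth_functions_def using f by (intro CollectI conjI ballI exI[of _ "V \<inter> cdom _"]) auto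
qed

lemma coord_smooth:
  assumes c: "c \<in> atlas M" and V: "openin (points M) V" "V \<subseteq> cdom c" and i: "i < cdim c"
  shows "(\<lambda>y\<in>V. coord c y i) \<in> smooth_functions M V"
  by (rule smooth_functions_chartI[OF c V _ openin_topspace, of _ "\<lambda>p. p i"])
    (use chart_Euclidean[OF c] V i cont_diff_coord in auto)

text \<open>If the \<open>i\<close>-th coordinate of \<open>e\<close> vanishes at \<open>x\<close>, the chain rule applied to
  \<open>s\<^sub>i = s\<^sub>i(r(s))\<close> reads \<open>1 = (\<Sum>k. \<partial>s\<^sub>i/\<partial>r\<^sub>k * \<partial>r\<^sub>k/\<partial>s\<^sub>i)\<close>, so some \<open>k\<close> has both factors
  nonzero at \<open>x\<close>. As \<open>s\<^sub>i \<ge> 0\<close>, the first factor forces \<open>r\<^sub>k(x) = 0\<close>. As \<open>r\<^sub>k \<ge> 0\<close>, the second forces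
  \<open>s\<^sub>i = 0\<close> wherever \<open>r\<^sub>k = 0\<close> near \<open>x\<close>, and Hadamard's lemma divides \<open>s\<^sub>i\<close> by \<open>r\<^sub>k\<close>.\<close>

lemma transition_zero_coord:
  assumes c: "c \<in> atlas M" and e: "e \<in> atlas M" and x: "x \<in> cdom c" "x \<in> cdom e"
    and i: "i \<in> zero_coords e x"
  obtains V g k where "openin (points M) V" "x \<in> V" "V \<subseteq> cdom c \<inter> cdom e" "k \<in> zero_coords c x"
    "g \<in> pos_functions M V" "\<And>y. y \<in> V \<Longrightarrow> coord e y i = g y * coord c y k"
proof -
  let ?n = "cdim c" and ?m = "cdim e"
  define D where "D = cdom c \<inter> cdom e"
  have D: "openin (points M) D" "x \<in> D" "D \<subseteq> cdom c" "D \<subseteq> cdom e"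
    using chart_facts(1)[OF M] c e x by (auto simp: D_def)
  have im: "i < ?m" and q0: "coord e x i = 0" using i by (auto simp: zero_coords_def)
  obtain W F where W: "openin (Euclidean_space ?n) W" "coord c ` D \<subseteq> W" and F: "\<forall>l. cont_diff l ?n W F"
    and Feq: "\<And>y. y \<in> D \<Longrightarrow> F (coord c y) = coord e y i"
    using transition_extension[OF e c im] unfolding D_def by (metis Int_commute IntD1 IntD2)
  have "\<forall>k. \<exists>A T. k < ?n \<longrightarrow> openin (Euclidean_space ?m) A \<and> coord e ` D \<subseteq> A \<and>
      (\<forall>l. cont_diff l ?m A T) \<and> (\<forall>y\<in>D. T (coord e y) = coord c y k)"
    using transition_extension[OF c e] unfolding D_def by (metis IntD1 IntD2)
  then obtain A G where A: "\<And>k. k < ?n \<Longrightarrow> openin (Euclidean_space ?m) (A k)"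
      "\<And>k. k < ?n \<Longrightarrow> coord e ` D \<subseteq> A k"
    and G: "\<And>k l. k < ?n \<Longrightarrow> cont_diff l ?m (A k) (G k)"
    and Geq: "\<And>k y. k < ?n \<Longrightarrow> y \<in> D \<Longrightarrow> G k (coord e y) = coord c y k"
    by metis
  have "cont_diff (Suc 0) ?n W F" using F by blast
  then obtain F' where F': "\<And>k p. k < ?n \<Longrightarrow> p \<in> W \<Longrightarrow> ((\<lambda>t. F (p(k := t))) has_real_derivative F' k p) (at (p k))"
    and "\<And>k. k < ?n \<Longrightarrow> cont_diff 0 ?n W (F' k)"
    using cont_diff_partials by blast
  then have F'c: "\<And>k. k < ?n \<Longrightarrow> continuous_on W (F' k)"
    using cont_diff_continuous_on[OF W(1)] by blast
  have "\<exists>G'. (\<forall>p\<in>A k. ((\<lambda>t. G k (p(i := t))) has_real_derivative G' p) (at (p i))) \<and> continuous_on (A k) G'"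
    if k: "k < ?n" for k
  proof -
    obtain g where "\<And>j p. j < ?m \<Longrightarrow> p \<in> A k \<Longrightarrow> ((\<lambda>t. G k (p(j := t))) has_real_derivative g j p) (at (p j))"
      "\<And>j. j < ?m \<Longrightarrow> cont_diff 0 ?m (A k) (g j)"
      using cont_diff_partials[OF G[OF k, of "Suc 0"]] by blast
    then show ?thesis using cont_diff_continuous_on[OF A(1)[OF k]] im by blast
  qed
  then obtain G' where G': "\<And>k p. k < ?n \<Longrightarrow> p \<in> A k \<Longrightarrow> ((\<lambda>t. G k (p(i := t))) has_real_derivative G' k p) (at (p i))"
    and G'c: "\<And>k. k < ?n \<Longrightarrow> continuous_on (A k) (G' k)"
    by metis
  define p where "p = coord c x"
  define q where "q = coord e x"
  have pW: "p \<in> W" and qA: "\<And>k. k < ?n \<Longrightarrow> q \<in> A k" using W(2) A(2) D(2) by (auto simp: p_def q_def)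
  \<comment> \<open>The coordinate line of \<open>e\<close> through \<open>x\<close> in direction
    \<open>i\<close>, read in the chart \<open>c\<close>.\<close>
  define \<gamma> where "\<gamma> t = coord c (chart_inv e (q(i := q i + t)))" for t
  have ev: "\<forall>\<^sub>F t in at 0 within {0..}. q(i := q i + t) \<in> coord e ` D"
    unfolding q_def by (rule eventually_right_in_chart_image[OF e D(1,4,2) im])
  have \<gamma>0: "\<gamma> 0 = p" using chart_facts(2)[OF M e x(2)] by (simp add: \<gamma>_def p_def q_def)
  \<comment> \<open>The right derivative at 0 of the \<open>i\<close>-th coordinate of
    \<open>e\<close> along \<open>\<gamma>\<close>, computed by the chain rule and directly.\<close>
  have sum1: "(\<Sum>k<?n. F' k p * G' k q) = 1"
  proof (rule right_derivative_unique)
    have "((\<lambda>t. \<gamma> t k) has_real_derivative G' k q) (at 0 within {0..})" if k: "k < ?n" for k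
    proof (rule has_real_derivative_transform_eventually)
      show "((\<lambda>t. G k (q(i := q i + t))) has_real_derivative G' k q) (at 0 within {0..})"
        by (rule partial_derivative_shift[where f = "G k", OF G'[OF k qA[OF k]]])
      show "\<forall>\<^sub>F t in at 0 within {0..}. G k (q(i := q i + t)) = \<gamma> t k"
        using ev by eventually_elim
          (auto simp: \<gamma>_def Geq[OF k] chart_facts(2)[OF M e] subsetD[OF D(4)])
      show "G k (q(i := q i + 0)) = \<gamma> 0 k"
        using Geq[OF k D(2)] \<gamma>0 by (simp add: q_def p_def)
    qed
    moreover have "\<forall>\<^sub>F t in at 0 within {0..}. \<gamma> t \<in> topspace (Euclidean_space ?n)"
      using ev
    proof eventually_elim
      case (elim t)
      then have "chart_inv e (q(i := q i + t)) \<in> D" using chart_inv_image(1)[OF e _ D(4)] by blast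
      then show ?case unfolding \<gamma>_def using D(3) chart_Euclidean[OF c] by blast
    qed
    ultimately show "((\<lambda>t. F (\<gamma> t)) has_real_derivative (\<Sum>k<?n. F' k p * G' k q)) (at 0 within {0..})"
      using has_real_derivative_chain[OF W(1) _ F' F'c, where \<gamma> = \<gamma> and ?t0.0 = 0
          and \<gamma>' = "\<lambda>k. G' k q" and S = "{0..}"] pW \<gamma>0 by simp
    show "((\<lambda>t. F (\<gamma> t)) has_real_derivative 1) (at 0 within {0..})"
    proof (rule has_real_derivative_transform_eventually)
      show "((\<lambda>t. q i + t) has_real_derivative 1) (at 0 within {0..})"
        by (auto intro!: derivative_eq_intros)
      show "\<forall>\<^sub>F t in at 0 within {0..}. q i + t = F (\<gamma> t)"
        using ev
      proof eventually_elim
        case (elim t)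
        note inv = chart_inv_image[OF e elim D(4)]
        show ?case unfolding \<gamma>_def Feq[OF inv(1)] inv(2) by simp
      qed
      show "q i + 0 = F (\<gamma> 0)" using Feq[OF D(2)] by (simp add: \<gamma>0 p_def q_def)
    qed
  qed
  then have "(\<Sum>k<?n. F' k p * G' k q) \<noteq> 0" by simp
  then obtain k where kn: "k < ?n" and "F' k p * G' k q \<noteq> 0"
    by (meson lessThan_iff sum.not_neutral_contains_not_neutral)
  then have Fk: "F' k p \<noteq> 0" and Gk: "G' k q \<noteq> 0" by auto
  have Fnn: "0 \<le> F (coord c z)" if "z \<in> D" for z
    using chart_nonneg[OF e _ im] Feq D(4) that by auto
  have F0: "F p = 0" using Feq[OF D(2)] q0 by (simp add: p_def)
  have pk: "p k = 0"
  proof (rule ccontr)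
    assume "p k \<noteq> 0"
    then have "0 < coord c x k" using chart_nonneg[OF c x(1) kn] by (simp add: p_def)
    from interior_min_derivative[OF c D(1,3,2) kn this Fnn F0[unfolded p_def] F'[OF kn pW, unfolded p_def]] Fk
    show False by (simp add: p_def)
  qed
  then have kz: "k \<in> zero_coords c x" using kn by (simp add: zero_coords_def p_def)
  \<comment> \<open>The difference quotients are nonnegative for \<open>t > 0\<close>, and their
    limit is already known to be nonzero. Its sign becomes the positivity of the quotient
    \<open>g\<close>.\<close>
  have Fpos: "0 < F' k p"
  proof -
    have "((\<lambda>t. F (p(k := p k + t))) has_real_derivative F' k p) (at 0 within {0..})"
      by (rule partial_derivative_shift[OF F'[OF kn pW]])
    then have lim: "((\<lambda>t. F (p(k := p k + t)) / t) \<longlongrightarrow> F' k p) (at 0 within {0..})"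
      by (simp add: has_field_derivative_iff F0)
    have "\<forall>\<^sub>F t :: real in at 0 within {0..}. t \<in> {0..}" by (simp add: eventually_at_filter)
    then have "\<forall>\<^sub>F t in at 0 within {0..}. 0 \<le> F (p(k := p k + t)) / t"
      using eventually_right_in_chart_image[OF c D(1,3,2) kn]
    proof eventually_elim
      case (elim t)
      then show ?case using Fnn by (auto simp: p_def)
    qed
    from tendsto_lowerbound[OF lim this] Fk show ?thesis by (simp add: at_within_Ici_at_right)
  qed
  define N where "N = D \<inter> {y \<in> cdom e. coord e y \<in> A k \<inter> G' k -` (- {0})}"
  have "openin (points M) {y \<in> cdom e. coord e y \<in> A k \<inter> G' k -` (- {0})}"
    by (intro chart_open_preimage[OF e] openin_Euclidean_preimage A(1) G'c kn) (auto intro: open_Compl)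
  then have N: "openin (points M) N" "N \<subseteq> cdom c" "x \<in> N" "N \<subseteq> D"
    using D x qA[OF kn] Gk unfolding N_def q_def by auto
  \<comment> \<open>If the \<open>i\<close>-th coordinate of \<open>e\<close> were positive at such
    a \<open>y\<close>, the function \<open>G k\<close> would have a zero minimum there that is
    interior in direction \<open>i\<close>. Its derivative would vanish, but \<open>N\<close> is the
    set where it does not.\<close>
  have zero: "coord e y i = 0" if y: "y \<in> N" and "coord c y k = 0" for y
  proof (rule ccontr)
    assume "coord e y i \<noteq> 0"
    moreover have yD: "y \<in> D" "y \<in> cdom e" using y N(4) D(4) by auto
    ultimately have pos: "0 < coord e y i" using chart_nonneg[OF e _ im, of y] by simp
    have G0: "G k (coord e y) = 0" using Geq[OF kn yD(1)] that(2) by simp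
    have Gnn: "0 \<le> G k (coord e z)" if "z \<in> D" for z
      using Geq[OF kn that] chart_nonneg[OF c _ kn] D(3) that by auto
    have yA: "coord e y \<in> A k" using A(2)[OF kn] yD by auto
    from interior_min_derivative[OF e D(1,4) yD(1) im pos Gnn G0 G'[OF kn yA]] y
    show False by (simp add: N_def)
  qed
  obtain T where T: "openin (Euclidean_space ?n) T" "coord c ` N = T \<inter> orthant ?n"
    using chart_open_image[OF c N(1,2)] .
  have WT: "openin (Euclidean_space ?n) (W \<inter> T)" using W T by blast
  have FWT: "\<forall>l. cont_diff l ?n (W \<inter> T) F" using F by (meson cont_diff_subset inf_le1)
  have pWT: "p \<in> W \<inter> T" using pW T N(3) by (auto simp: p_def)
  have FD: "((\<lambda>t. F (p(k := t))) has_real_derivative F' k p) (at 0)" using F'[OF kn pW] pk by simp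
  obtain B H where B: "openin (Euclidean_space ?n) B" "p \<in> B" "B \<subseteq> W \<inter> T"
    and H: "\<forall>l. cont_diff l ?n B H" "H p = F' k p"
    and star: "\<And>z. z \<in> B \<Longrightarrow> z(k := 0) \<in> B"
    and FH: "\<And>z. z \<in> B \<Longrightarrow> F z = F (z(k := 0)) + z k * H z"
    by (rule Hadamard[OF WT FWT pWT pk kn FD]) blast
  have Hc: "continuous_on B H" using H(1) cont_diff_continuous_on[OF B(1)] by blast
  define V where "V = N \<inter> {y \<in> cdom c. coord c y \<in> B \<inter> H -` {0<..}}"
  have "openin (points M) {y \<in> cdom c. coord c y \<in> B \<inter> H -` {0<..}}"
    by (intro chart_open_preimage[OF c] openin_Euclidean_preimage B(1) Hc) auto
  then have V: "openin (points M) V" "x \<in> V" "V \<subseteq> N" "V \<subseteq> cdom c"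
    using N x B(2) H(2) Fpos by (auto simp: V_def p_def)
  have "(\<lambda>y\<in>V. H (coord c y)) \<in> smooth_functions M V"
    by (rule smooth_functions_chartI[OF c V(1,4) _ B(1) _ H(1)]) (auto simp: V_def)
  then have "(\<lambda>y\<in>V. H (coord c y)) \<in> pos_functions M V"
    by (auto simp: pos_functions_def V_def)
  moreover have "coord e y i = (\<lambda>y\<in>V. H (coord c y)) y * coord c y k" if y: "y \<in> V" for y
  proof -
    have yB: "coord c y \<in> B" "y \<in> N" "y \<in> cdom c" using y by (auto simp: V_def)
    \<comment> \<open>\<open>B\<close> is stable under setting the \<open>k\<close>-th coordinate to
      0, and so is the orthant. The new tuple therefore belongs to an actual point of
      \<open>N\<close>, to which \<open>zero\<close> applies.\<close>
    have "(coord c y)(k := 0) \<in> T \<inter> orthant ?n"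
      using star[OF yB(1)] B(3) chart_orthant[OF c yB(3)] kn
      by (auto simp: orthant_def topspace_Euclidean_space)
    then obtain z where z: "z \<in> N" "coord c z = (coord c y)(k := 0)"
      using T(2) by (metis imageE)
    then have "F ((coord c y)(k := 0)) = 0"
      using zero[OF z(1)] Feq[of z] N(4) by auto
    then show ?thesis
      using FH[OF yB(1)] Feq[of y] yB(2) N(4) y by (auto simp: mult.commute)
  qed
  moreover have "V \<subseteq> cdom c \<inter> cdom e" using V N D by blast
  ultimately show thesis using that V kz by blast
qed

text \<open>The monomial form is demanded in every chart \<open>c\<close>. A coordinate that
  vanishes at \<open>x\<close> becomes a positive function times one coordinate of \<open>c\<close>;
  any other is itself positive near \<open>x\<close>, and all exponents are 0.\<close>

lemma coord_basic_section:
  assumes e: "e \<in> atlas M" and i: "i < cdim e"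
  shows "(\<lambda>y\<in>cdom e. coord e y i) \<in> basic_sections M (cdom e)"
proof -
  have "\<exists>V g j. openin (points M) V \<and> x \<in> V \<and> V \<subseteq> cdom e \<inter> cdom c \<and> g \<in> pos_functions M V \<and>
      (\<forall>y\<in>V. (\<lambda>y\<in>cdom e. coord e y i) y = g y * (\<Prod>l<cdim c. coord c y l ^ (j l :: nat)))"
    if c: "c \<in> atlas M" and x: "x \<in> cdom e \<inter> cdom c" for c x
  proof (cases "i \<in> zero_coords e x")
    case True
    obtain V g k where V: "openin (points M) V" "x \<in> V" "V \<subseteq> cdom c \<inter> cdom e" and k: "k \<in> zero_coords c x"
      and g: "g \<in> pos_functions M V" "\<And>y. y \<in> V \<Longrightarrow> coord e y i = g y * coord c y k"
      by (rule transition_zero_coord[OF c e _ _ True]) (use x in blast)+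
    have "(\<Prod>l<cdim c. coord c y l ^ (if l = k then 1 else 0)) = coord c y k" for y
    proof -
      have "(\<Prod>l<cdim c. coord c y l ^ (if l = k then 1 else 0)) = (\<Prod>l<cdim c. if l = k then coord c y l else 1)"
        by (intro prod.cong) auto
      then show ?thesis using k by (simp add: prod.delta zero_coords_def)
    qed
    then show ?thesis
      using V g by (intro exI[of _ V] exI[of _ g] exI[of _ "\<lambda>l. if l = k then 1 else 0"]) auto
  next
    case False
    have pos: "0 < coord e x i" using False x chart_nonneg[OF e _ i, of x] i by (auto simp: zero_coords_def less_le)
    define V where "V = {y \<in> cdom e. coord e y \<in> topspace (Euclidean_space (cdim e)) \<inter> (\<lambda>p. p i) -` {0<..}} \<inter> cdom c"
    have "openin (points M) {y \<in> cdom e. coord e y \<in> topspace (Euclidean_space (cdim e)) \<inter> (\<lambda>p. p i) -` {0<..}}"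
      by (intro chart_open_preimage[OF e] openin_Euclidean_preimage)
        (auto intro: continuous_on_subset[OF continuous_on_product_coordinates])
    then have V: "openin (points M) V" "x \<in> V" "V \<subseteq> cdom e \<inter> cdom c" "V \<subseteq> cdom e"
      using chart_facts(1)[OF M c] x pos chart_Euclidean[OF e] by (auto simp: V_def)
    have "(\<lambda>y\<in>V. coord e y i) \<in> pos_functions M V"
      using coord_smooth[OF e V(1,4) i] by (auto simp: pos_functions_def V_def)
    then show ?thesis
      using V by (intro exI[of _ V] exI[of _ "\<lambda>y\<in>V. coord e y i"] exI[of _ "\<lambda>_. 0"]) auto
  qed
  then show ?thesis
    using coord_smooth[OF e chart_facts(1)[OF M e] subset_refl i] chart_nonneg[OF e _ i]
    by (auto simp: basic_sections_def nonneg_functions_def)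
qed

end

section \<open>Tangential basepoints\<close>

definition coord_fun :: "'a chart \<Rightarrow> nat \<Rightarrow> 'a \<Rightarrow> real" where
  "coord_fun c i = (\<lambda>y. coord c y i)"

text \<open>The representative of a normal vector that has no components along the remaining
  coordinate directions of \<open>c\<close>.\<close>

definition coord_tangent ::
    "'a corners \<Rightarrow> 'a chart \<Rightarrow> 'a \<Rightarrow> (nat \<Rightarrow> real) \<Rightarrow> ('a \<Rightarrow> real) \<Rightarrow> real" where
  "coord_tangent M c x v =
     (\<lambda>f\<in>smooth_near M x. \<Sum>i\<in>zero_coords c x. v i * coord_vector c x i f)"

lemma normal_vector_eq: "normal_vector M c x v = normal_rel M x `` {coord_tangent M c x v}"
  by (simp add: normal_vector_def coord_tangent_def)

lemma finite_zero_coords [simp]: "finite (zero_coords c x)"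
  by (simp add: zero_coords_def)

lemma zero_coordsD: "i \<in> zero_coords c x \<Longrightarrow> i < cdim c" "i \<in> zero_coords c x \<Longrightarrow> coord c x i = 0"
  by (simp_all add: zero_coords_def)

section \<open>Smooth germs at a point\<close>

context
  fixes M :: "'a corners"
  assumes M: "manifold_with_corners M"
begin

text \<open>Germs are treated through one chart at \<open>x\<close> and an extension to an open set
  of the full coordinate space, where two-sided partial derivatives exist.\<close>

lemma smooth_near_iff:
  assumes c: "c \<in> atlas M" and x: "x \<in> cdom c"
  shows "f \<in> smooth_near M x \<longleftrightarrow> (\<exists>V W F. openin (points M) V \<and> x \<in> V \<and> V \<subseteq> cdom c \<and>
    openin (Euclidean_space (cdim c)) W \<and> coord c ` V \<subseteq> W \<and> (\<forall>k. cont_diff k (cdim c) W F) \<and>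
    (\<forall>y\<in>V. F (coord c y) = f y))" (is "_ \<longleftrightarrow> ?R")
proof
  assume "f \<in> smooth_near M x"
  then obtain U where U: "x \<in> U" "restrict f U \<in> smooth_functions M U"
    unfolding smooth_near_def by blast
  obtain V W F where V: "openin (points M) V" "x \<in> V" "V \<subseteq> U" "V \<subseteq> cdom c"
    "openin (Euclidean_space (cdim c)) W" "coord c ` V \<subseteq> W" "\<forall>k. cont_diff k (cdim c) W F"
    "\<And>y. y \<in> V \<Longrightarrow> F (coord c y) = restrict f U y"
    by (rule smooth_functionsE[OF M U(2) c U(1) x]) blast
  then have "F (coord c y) = f y" if "y \<in> V" for y
    using that by auto
  with V show ?R by (intro exI[of _ V] exI[of _ W] exI[of _ F]) simp
next
  assume ?R
  then obtain V W F where V: "openin (points M) V" "x \<in> V" "V \<subseteq> cdom c"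
    "openin (Euclidean_space (cdim c)) W" "coord c ` V \<subseteq> W" "\<forall>k. cont_diff k (cdim c) W F"
    "\<forall>y\<in>V. F (coord c y) = f y"
    by blast
  have "restrict f V \<in> smooth_functions M V"
    by (rule smooth_functions_chartI[OF M c V(1,3) _ V(4,5,6)]) (use V(7) in auto)
  then show "f \<in> smooth_near M x"
    unfolding smooth_near_def using V(1,2) by blast
qed

lemma smooth_near_atlas:
  assumes "f \<in> smooth_near M x"
  obtains c where "c \<in> atlas M" "x \<in> cdom c"
proof -
  have "x \<in> topspace (points M)"
    using assms openin_subset unfolding smooth_near_def by fastforce
  then show thesis using atlas_covers[OF M] that by blast
qed

text \<open>Covers sums, products and scalar multiples together: extensions are combined on the
  intersection of their domains.\<close>

lemma smooth_near_binop:
  assumes f: "f \<in> smooth_near M x" and g: "g \<in> smooth_near M x"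
    and op: "\<And>k n W F G. cont_diff k n W F \<Longrightarrow> cont_diff k n W G \<Longrightarrow> cont_diff k n W (\<lambda>p. op (F p) (G p))"
  shows "(\<lambda>y. op (f y) (g y)) \<in> smooth_near M x"
proof -
  obtain c where c: "c \<in> atlas M" "x \<in> cdom c" using smooth_near_atlas[OF f] .
  obtain V W F where V: "openin (points M) V" "x \<in> V" "V \<subseteq> cdom c"
    "openin (Euclidean_space (cdim c)) W" "coord c ` V \<subseteq> W" "\<forall>k. cont_diff k (cdim c) W F"
    "\<forall>y\<in>V. F (coord c y) = f y"
    using f unfolding smooth_near_iff[OF c] by blast
  obtain V' W' G where V': "openin (points M) V'" "x \<in> V'" "V' \<subseteq> cdom c"
    "openin (Euclidean_space (cdim c)) W'" "coord c ` V' \<subseteq> W'" "\<forall>k. cont_diff k (cdim c) W' G"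
    "\<forall>y\<in>V'. G (coord c y) = g y"
    using g unfolding smooth_near_iff[OF c] by blast
  show ?thesis
    unfolding smooth_near_iff[OF c]
  proof (intro exI conjI)
    show "openin (points M) (V \<inter> V')" "openin (Euclidean_space (cdim c)) (W \<inter> W')" using V V' by blast+
    show "\<forall>k. cont_diff k (cdim c) (W \<inter> W') (\<lambda>p. op (F p) (G p))"
      using V(6) V'(6) by (intro allI op) (auto intro: cont_diff_subset)
  qed (use V V' in auto)
qed

lemma smooth_near_add: "f \<in> smooth_near M x \<Longrightarrow> g \<in> smooth_near M x \<Longrightarrow> (\<lambda>y. f y + g y) \<in> smooth_near M x"
  by (rule smooth_near_binop) (auto intro: cont_diff_add)

lemma smooth_near_mult: "f \<in> smooth_near M x \<Longrightarrow> g \<in> smooth_near M x \<Longrightarrow> (\<lambda>y. f y * g y) \<in> smooth_near M x"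
  by (rule smooth_near_binop) (auto intro: cont_diff_mult)

lemma smooth_near_scale: "f \<in> smooth_near M x \<Longrightarrow> (\<lambda>y. a * f y) \<in> smooth_near M x"
  using smooth_near_binop[of f x f "\<lambda>u w. a * u"] cont_diff_mult[OF cont_diff_const] by blast

lemma smooth_nearI:
  assumes "f \<in> smooth_functions M U" "openin (points M) U" "x \<in> U"
  shows "f \<in> smooth_near M x"
proof -
  have "restrict f U = f" using assms(1) by (simp add: smooth_functions_def extensional_restrict)
  then show ?thesis using assms unfolding smooth_near_def by auto
qed

lemma coord_fun_smooth_near:
  assumes "c \<in> atlas M" "x \<in> cdom c" "i < cdim c"
  shows "coord_fun c i \<in> smooth_near M x"
  using coord_smooth[OF M assms(1) chart_facts(1)[OF M assms(1)] subset_refl assms(3)]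
    chart_facts(1)[OF M assms(1)] assms(2)
  unfolding smooth_near_def coord_fun_def by blast

section \<open>Coordinate vectors as derivations\<close>

context
  fixes c :: "'a chart" and x :: 'a
  assumes c: "c \<in> atlas M" and x: "x \<in> cdom c"
begin

lemma eventually_chart_inv_right:
  assumes U: "openin (points M) U" "x \<in> U" and i: "i < cdim c"
  shows "\<forall>\<^sub>F t in at 0 within {0..}. chart_inv c ((coord c x)(i := coord c x i + t)) \<in> U"
proof -
  have "openin (points M) (U \<inter> cdom c)" using U chart_facts(1)[OF M c] by blast
  then have "\<forall>\<^sub>F t in at 0 within {0..}. (coord c x)(i := coord c x i + t) \<in> coord c ` (U \<inter> cdom c)"
    by (rule eventually_right_in_chart_image[OF M c]) (use U x i in auto)
  then show ?thesis
    by eventually_elim (use chart_inv_image(1)[OF M c] in blast)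
qed

text \<open>\<open>coord_vector\<close> picks a vector derivative, which is meaningful only once one
  exists. It is supplied by the partial derivative of an extension of \<open>f\<close> beyond the
  boundary.\<close>

lemma coord_vector_derivative:
  assumes f: "f \<in> smooth_near M x" and i: "i < cdim c"
  shows "((\<lambda>t. f (chart_inv c ((coord c x)(i := coord c x i + t)))) has_real_derivative
    coord_vector c x i f) (at 0 within {0..})"
proof -
  obtain V W F where V: "openin (points M) V" "x \<in> V" "V \<subseteq> cdom c"
    "openin (Euclidean_space (cdim c)) W" "coord c ` V \<subseteq> W" and F: "\<forall>k. cont_diff k (cdim c) W F"
    and eq: "\<forall>y\<in>V. F (coord c y) = f y"
    using f unfolding smooth_near_iff[OF c x] by blast
  have "cont_diff (Suc 0) (cdim c) W F" using F by blast
  then obtain g where g: "\<And>i p. i < cdim c \<Longrightarrow> p \<in> W \<Longrightarrow> ((\<lambda>t. F (p(i := t))) has_real_derivative g i p) (at (p i))"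
    using cont_diff_partials by blast
  have p: "coord c x \<in> W" using V by blast
  have "((\<lambda>t. f (chart_inv c ((coord c x)(i := coord c x i + t)))) has_real_derivative g i (coord c x))
      (at 0 within {0..})"
  proof (rule has_real_derivative_transform_eventually)
    show "((\<lambda>t. F ((coord c x)(i := coord c x i + t))) has_real_derivative g i (coord c x)) (at 0 within {0..})"
      by (rule partial_derivative_shift[OF g[OF i p]])
    show "\<forall>\<^sub>F t in at 0 within {0..}. F ((coord c x)(i := coord c x i + t)) =
        f (chart_inv c ((coord c x)(i := coord c x i + t)))"
      using eventually_right_in_chart_image[OF M c V(1,3,2) i]
    proof eventually_elim
      case (elim t)
      note inv = chart_inv_image[OF M c elim V(3)]
      show ?case using eq inv by metis
    qed
    show "F ((coord c x)(i := coord c x i + 0)) = f (chart_inv c ((coord c x)(i := coord c x i + 0)))"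
      using eq V(2) chart_facts(2)[OF M c x] by simp
  qed
  moreover from this have "coord_vector c x i f = g i (coord c x)"
    unfolding coord_vector_def has_real_derivative_iff_has_vector_derivative
    by (intro vector_derivative_within) (simp_all add: at_within_Ici_at_right)
  ultimately show ?thesis by simp
qed

lemma coord_vector_unique:
  assumes "((\<lambda>t. f (chart_inv c ((coord c x)(i := coord c x i + t)))) has_real_derivative D) (at 0 within {0..})"
    "f \<in> smooth_near M x" "i < cdim c"
  shows "coord_vector c x i f = D"
  using right_derivative_unique[OF coord_vector_derivative[OF assms(2,3)] assms(1)] .

lemma coord_vector_cong:
  assumes "f \<in> smooth_near M x" "g \<in> smooth_near M x" "i < cdim c"
    and U: "openin (points M) U" "x \<in> U" "\<And>y. y \<in> U \<Longrightarrow> f y = g y"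
  shows "coord_vector c x i f = coord_vector c x i g"
proof (rule coord_vector_unique[OF _ assms(1,3)])
  show "((\<lambda>t. f (chart_inv c ((coord c x)(i := coord c x i + t)))) has_real_derivative
      coord_vector c x i g) (at 0 within {0..})"
  proof (rule has_real_derivative_transform_eventually[OF coord_vector_derivative[OF assms(2,3)]])
    show "\<forall>\<^sub>F t in at 0 within {0..}. g (chart_inv c ((coord c x)(i := coord c x i + t))) =
        f (chart_inv c ((coord c x)(i := coord c x i + t)))"
      using eventually_chart_inv_right[OF U(1,2) assms(3)] by eventually_elim (simp add: U(3))
    show "g (chart_inv c ((coord c x)(i := coord c x i + 0))) = f (chart_inv c ((coord c x)(i := coord c x i + 0)))"
      using U(2,3) chart_facts(2)[OF M c x] by simp
  qed
qed

lemma coord_vector_mult: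
  assumes f: "f \<in> smooth_near M x" and g: "g \<in> smooth_near M x" and i: "i < cdim c"
  shows "coord_vector c x i (\<lambda>y. f y * g y) = f x * coord_vector c x i g + g x * coord_vector c x i f"
  using DERIV_mult[OF coord_vector_derivative[OF f i] coord_vector_derivative[OF g i]]
    chart_facts(2)[OF M c x]
  by (intro coord_vector_unique smooth_near_mult f g i) (simp add: algebra_simps)

text \<open>The derivation laws hold for each one-sided derivative along a coordinate line and pass
  to linear combinations. Functions agreeing near \<open>x\<close> agree on an initial piece of each
  line.\<close>

lemma coord_tangent_closed: "coord_tangent M c x v \<in> tangent_space M x"
  unfolding tangent_space_def
proof (intro CollectI conjI ballI impI allI)
  show "coord_tangent M c x v \<in> extensional (smooth_near M x)" by (simp add: coord_tangent_def)
  fix f g assume f: "f \<in> smooth_near M x" and g: "g \<in> smooth_near M x"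
  show "coord_tangent M c x v f = coord_tangent M c x v g"
    if U: "\<exists>U. openin (points M) U \<and> x \<in> U \<and> (\<forall>y\<in>U. f y = g y)"
  proof -
    obtain U where U: "openin (points M) U" "x \<in> U" "\<And>y. y \<in> U \<Longrightarrow> f y = g y" using U by blast
    have "coord_vector c x i f = coord_vector c x i g" if "i \<in> zero_coords c x" for i
      by (rule coord_vector_cong[OF f g zero_coordsD(1)[OF that] U])
    then show ?thesis using f g by (simp add: coord_tangent_def)
  qed
  have "coord_vector c x i (\<lambda>y. f y + g y) = coord_vector c x i f + coord_vector c x i g"
    if "i < cdim c" for i
    by (intro coord_vector_unique smooth_near_add f g that DERIV_add coord_vector_derivative)
  then show "coord_tangent M c x v (\<lambda>y. f y + g y) = coord_tangent M c x v f + coord_tangent M c x v g"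
    using f g smooth_near_add[OF f g] zero_coordsD(1)[of _ c x]
    by (simp add: coord_tangent_def distrib_left sum.distrib cong: sum.cong)
  have "coord_vector c x i (\<lambda>y. a * f y) = a * coord_vector c x i f" if "i < cdim c" for i a
    by (intro coord_vector_unique smooth_near_scale f that DERIV_cmult coord_vector_derivative)
  then show "coord_tangent M c x v (\<lambda>y. a * f y) = a * coord_tangent M c x v f" for a
    using f smooth_near_scale[OF f] zero_coordsD(1)[of _ c x]
    by (simp add: coord_tangent_def sum_distrib_left mult_ac cong: sum.cong)
  show "coord_tangent M c x v (\<lambda>y. f y * g y) = f x * coord_tangent M c x v g + g x * coord_tangent M c x v f"
    using f g smooth_near_mult[OF f g] zero_coordsD(1)[of _ c x]
    by (simp add: coord_tangent_def coord_vector_mult sum_distrib_left sum.distrib[symmetric] algebra_simps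
        cong: sum.cong)
qed

lemma coord_tangent_coord:
  assumes k: "k \<in> zero_coords c x"
  shows "coord_tangent M c x v (coord_fun c k) = v k"
proof -
  have kn: "k < cdim c" using zero_coordsD(1)[OF k] .
  have sm: "coord_fun c k \<in> smooth_near M x" by (rule coord_fun_smooth_near[OF c x kn])
  have "coord_vector c x i (coord_fun c k) = (if i = k then 1 else 0)" if i: "i < cdim c" for i
  proof (rule coord_vector_unique[OF _ sm i])
    show "((\<lambda>t. coord_fun c k (chart_inv c ((coord c x)(i := coord c x i + t)))) has_real_derivative
        (if i = k then 1 else 0)) (at 0 within {0..})"
    proof (rule has_real_derivative_transform_eventually)
      show "((\<lambda>t. ((coord c x)(i := coord c x i + t)) k) has_real_derivative (if i = k then 1 else 0))
          (at 0 within {0..})"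
        by (cases "i = k") (auto intro!: derivative_eq_intros)
      show "\<forall>\<^sub>F t in at 0 within {0..}. ((coord c x)(i := coord c x i + t)) k =
          coord_fun c k (chart_inv c ((coord c x)(i := coord c x i + t)))"
        using eventually_right_in_chart_image[OF M c chart_facts(1)[OF M c] subset_refl x i]
      proof eventually_elim
        case (elim t)
        show ?case unfolding coord_fun_def chart_inv_image(2)[OF M c elim subset_refl] ..
      qed
      show "((coord c x)(i := coord c x i + 0)) k = coord_fun c k (chart_inv c ((coord c x)(i := coord c x i + 0)))"
        using chart_facts(2)[OF M c x] by (simp add: coord_fun_def)
    qed
  qed
  then have "coord_tangent M c x v (coord_fun c k) = (\<Sum>i\<in>zero_coords c x. v i * (if i = k then 1 else 0))"
    using sm zero_coordsD(1)[of _ c x] by (simp add: coord_tangent_def cong: sum.cong)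
  also have "\<dots> = v k" using k by (simp add: if_distrib sum.delta cong: if_cong)
  finally show ?thesis .
qed

end

text \<open>In the Leibniz rule for the product, the term with the derivative of \<open>g\<close> is
  multiplied by the value of the \<open>k\<close>-th coordinate at \<open>x\<close>, which is
  0.\<close>

lemma coord_tangent_transition:
  assumes c: "c \<in> atlas M" "x \<in> cdom c" and e: "e \<in> atlas M" "x \<in> cdom e" and i: "i < cdim e"
    and V: "openin (points M) V" "x \<in> V" and k: "k \<in> zero_coords c x" and g: "g \<in> pos_functions M V"
    and eq: "\<And>y. y \<in> V \<Longrightarrow> coord e y i = g y * coord c y k"
  shows "coord_tangent M c x v (coord_fun e i) = g x * v k"
proof -
  have gs: "g \<in> smooth_near M x"
    using smooth_nearI[OF _ V] g by (simp add: pos_functions_def)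
  have ks: "coord_fun c k \<in> smooth_near M x"
    by (rule coord_fun_smooth_near[OF c zero_coordsD(1)[OF k]])
  have es: "coord_fun e i \<in> smooth_near M x" by (rule coord_fun_smooth_near[OF e i])
  have ps: "(\<lambda>y. g y * coord_fun c k y) \<in> smooth_near M x" by (rule smooth_near_mult[OF gs ks])
  note T = coord_tangent_closed[OF c, of v, unfolded tangent_space_def, THEN CollectD, THEN conjunct2, rule_format]
  have "coord_tangent M c x v (coord_fun e i) = coord_tangent M c x v (\<lambda>y. g y * coord_fun c k y)"
    by (rule T[OF es ps, THEN conjunct1, rule_format]) (use V eq in \<open>auto simp: coord_fun_def\<close>)
  also have "\<dots> = g x * coord_tangent M c x v (coord_fun c k) + coord_fun c k x * coord_tangent M c x v g"
    using T[OF gs ks] by simp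
  also have "\<dots> = g x * v k"
    using coord_tangent_coord[OF c k] zero_coordsD(2)[OF k] by (simp add: coord_fun_def)
  finally show ?thesis .
qed

text \<open>A difference of tangent vectors is again a tangent vector, so lying in the tangent face
  only says that the two agree on the vanishing coordinates of every chart at
  \<open>x\<close>.\<close>

lemma normal_rel_iff:
  "(D, E) \<in> normal_rel M x \<longleftrightarrow> D \<in> tangent_space M x \<and> E \<in> tangent_space M x \<and>
    (\<forall>c\<in>atlas M. x \<in> cdom c \<longrightarrow> (\<forall>i\<in>zero_coords c x. D (coord_fun c i) = E (coord_fun c i)))"
proof -
  have "(\<lambda>f\<in>smooth_near M x. D f - E f) \<in> tangent_space M x"
    if D: "D \<in> tangent_space M x" and E: "E \<in> tangent_space M x"
    unfolding tangent_space_def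
  proof (intro CollectI conjI ballI impI allI)
    fix f g assume f: "f \<in> smooth_near M x" and g: "g \<in> smooth_near M x"
    note D' = D[unfolded tangent_space_def, THEN CollectD, THEN conjunct2, rule_format, OF f g]
    note E' = E[unfolded tangent_space_def, THEN CollectD, THEN conjunct2, rule_format, OF f g]
    show "(\<lambda>f\<in>smooth_near M x. D f - E f) f = (\<lambda>f\<in>smooth_near M x. D f - E f) g"
      if U: "\<exists>U. openin (points M) U \<and> x \<in> U \<and> (\<forall>y\<in>U. f y = g y)"
      using f g D'[THEN conjunct1, rule_format, OF U] E'[THEN conjunct1, rule_format, OF U] by simp
    show "(\<lambda>f\<in>smooth_near M x. D f - E f) (\<lambda>y. f y + g y) =
        (\<lambda>f\<in>smooth_near M x. D f - E f) f + (\<lambda>f\<in>smooth_near M x. D f - E f) g"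
      using f g smooth_near_add[OF f g] D' E' by simp
    show "(\<lambda>f\<in>smooth_near M x. D f - E f) (\<lambda>y. a * f y) = a * (\<lambda>f\<in>smooth_near M x. D f - E f) f" for a
      using f smooth_near_scale[OF f] D' E' by (simp add: right_diff_distrib)
    show "(\<lambda>f\<in>smooth_near M x. D f - E f) (\<lambda>y. f y * g y) =
        f x * (\<lambda>f\<in>smooth_near M x. D f - E f) g + g x * (\<lambda>f\<in>smooth_near M x. D f - E f) f"
      using f g smooth_near_mult[OF f g] D' E' by (simp add: algebra_simps)
  qed simp
  moreover have "(\<lambda>f\<in>smooth_near M x. D f - E f) (\<lambda>y. coord c y i) = 0 \<longleftrightarrow> D (coord_fun c i) = E (coord_fun c i)"
    if "c \<in> atlas M" "x \<in> cdom c" "i \<in> zero_coords c x" for c i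
    using coord_fun_smooth_near[OF that(1,2) zero_coordsD(1)[OF that(3)]]
    unfolding coord_fun_def by simp
  ultimately show ?thesis
    unfolding normal_rel_def tangent_face_def by auto
qed

lemma normal_class_eq_iff:
  assumes D: "D \<in> tangent_space M x" and E: "E \<in> tangent_space M x"
  shows "normal_rel M x `` {D} = normal_rel M x `` {E} \<longleftrightarrow>
    (\<forall>c\<in>atlas M. x \<in> cdom c \<longrightarrow> (\<forall>i\<in>zero_coords c x. D (coord_fun c i) = E (coord_fun c i)))"
proof
  assume "normal_rel M x `` {D} = normal_rel M x `` {E}"
  moreover have "(E, E) \<in> normal_rel M x" using E by (simp add: normal_rel_iff)
  ultimately have "(D, E) \<in> normal_rel M x" by blast
  then show "\<forall>c\<in>atlas M. x \<in> cdom c \<longrightarrow> (\<forall>i\<in>zero_coords c x. D (coord_fun c i) = E (coord_fun c i))"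
    unfolding normal_rel_iff by blast
next
  assume "\<forall>c\<in>atlas M. x \<in> cdom c \<longrightarrow> (\<forall>i\<in>zero_coords c x. D (coord_fun c i) = E (coord_fun c i))"
  then have "(D, X) \<in> normal_rel M x \<longleftrightarrow> (E, X) \<in> normal_rel M x" for X
    using D E unfolding normal_rel_iff by auto
  then show "normal_rel M x `` {D} = normal_rel M x `` {E}" by blast
qed

lemma normal_vector_in_positive:
  assumes c: "c \<in> atlas M" "x \<in> cdom c" and v: "\<forall>i\<in>zero_coords c x. 0 < v i"
  shows "normal_vector M c x v \<in> positive_normal_space M x"
proof -
  have "normal_vector M c x v \<in> normal_space M x"
    unfolding normal_vector_eq normal_space_def by (rule quotientI[OF coord_tangent_closed[OF c]])
  then show ?thesis
    unfolding positive_normal_space_def using c v by blast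
qed

end

section \<open>Leading coefficients along curves\<close>

text \<open>The virtual morphism of \<open>(x, v)\<close> takes the value \<open>g x * (\<Prod>i. v\<^sub>i ^ j\<^sub>i)\<close> on
  \<open>f = g * (\<Prod>i. r\<^sub>i ^ j\<^sub>i)\<close>. This is the leading coefficient of \<open>f\<close> along the curve
  \<open>r\<^sub>i = t * v\<^sub>i\<close>, hence independent of the presentation of \<open>f\<close>.\<close>

definition normal_curve :: "'a chart \<Rightarrow> 'a \<Rightarrow> (nat \<Rightarrow> real) \<Rightarrow> real \<Rightarrow> 'a" where
  "normal_curve c x v t = chart_inv c (\<lambda>i. if i \<in> zero_coords c x then t * v i else coord c x i)"

text \<open>The exponent is left free and positivity pins it down: if 0 were allowed as a value,
  every exponent below the right one would yield it.\<close>

definition leading_coefficient :: "(real \<Rightarrow> real) \<Rightarrow> real \<Rightarrow> bool" where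
  "leading_coefficient u a \<longleftrightarrow> 0 < a \<and> (\<exists>J :: nat. ((\<lambda>t. u t / t ^ J) \<longlongrightarrow> a) (at_right 0))"

text \<open>If \<open>K < J\<close>, then \<open>u t / t ^ K\<close> is \<open>u t / t ^ J\<close>
  times a positive power of \<open>t\<close>, so it tends to 0 and not to a positive number. Hence
  the exponents agree, and so do the limits.\<close>

lemma leading_coefficient_unique:
  assumes "leading_coefficient u a" "leading_coefficient u b"
  shows "a = b"
proof -
  have le: "J \<le> K" if J: "((\<lambda>t. u t / t ^ J) \<longlongrightarrow> a) (at_right 0)"
    and K: "((\<lambda>t. u t / t ^ K) \<longlongrightarrow> b) (at_right 0)" "0 < b" for a b :: real and J K :: nat
  proof (rule ccontr)
    assume "\<not> J \<le> K"
    then have KJ: "K < J" by simp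
    have "((\<lambda>t. u t / t ^ J * t ^ (J - K)) \<longlongrightarrow> a * 0 ^ (J - K)) (at_right 0)"
      by (intro tendsto_intros J)
    then have "((\<lambda>t. u t / t ^ K) \<longlongrightarrow> a * 0 ^ (J - K)) (at_right 0)"
    proof (rule Lim_transform_eventually)
      show "\<forall>\<^sub>F t in at_right (0::real). u t / t ^ J * t ^ (J - K) = u t / t ^ K"
        using eventually_at_right_less[of 0]
      proof eventually_elim
        case (elim t)
        have "t ^ J = t ^ K * t ^ (J - K)" using KJ by (simp flip: power_add)
        then show ?case using elim by simp
      qed
    qed
    then have "b = a * 0 ^ (J - K)" using tendsto_unique[OF _ K(1)] by simp
    moreover have "(0 :: real) ^ (J - K) = 0" using KJ by simp
    ultimately show False using K(2) by simp
  qed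
  obtain J K where J: "((\<lambda>t. u t / t ^ J) \<longlongrightarrow> a) (at_right 0)" "0 < a"
    and K: "((\<lambda>t. u t / t ^ K) \<longlongrightarrow> b) (at_right 0)" "0 < b"
    using assms unfolding leading_coefficient_def by blast
  have "J = K" using le[OF J(1) K] le[OF K(1) J] by simp
  then show ?thesis using tendsto_unique[OF _ J(1)] K(1) by simp
qed

lemma leading_coefficient_mult:
  assumes "leading_coefficient u a" "leading_coefficient w b"
  shows "leading_coefficient (\<lambda>t. u t * w t) (a * b)"
proof -
  obtain J K where J: "((\<lambda>t. u t / t ^ J) \<longlongrightarrow> a) (at_right 0)" "0 < a"
    and K: "((\<lambda>t. w t / t ^ K) \<longlongrightarrow> b) (at_right 0)" "0 < b"
    using assms unfolding leading_coefficient_def by blast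
  have "((\<lambda>t. u t * w t / t ^ (J + K)) \<longlongrightarrow> a * b) (at_right 0)"
    using tendsto_mult[OF J(1) K(1)] by (simp add: power_add)
  then show ?thesis using J(2) K(2) unfolding leading_coefficient_def by (meson mult_pos_pos)
qed

lemma leading_coefficient_cong:
  assumes "leading_coefficient u a" "\<forall>\<^sub>F t in at_right 0. u t = w t"
  shows "leading_coefficient w a"
proof -
  obtain J where J: "((\<lambda>t. u t / t ^ J) \<longlongrightarrow> a) (at_right 0)" "0 < a"
    using assms unfolding leading_coefficient_def by blast
  have "\<forall>\<^sub>F t in at_right 0. u t / t ^ J = w t / t ^ J"
    using assms(2) by eventually_elim simp
  from Lim_transform_eventually[OF J(1) this] show ?thesis
    using J(2) unfolding leading_coefficient_def by blast
qed

definition basepoint_value :: "'a chart \<Rightarrow> 'a \<Rightarrow> (nat \<Rightarrow> real) \<Rightarrow> ('a \<Rightarrow> real) \<Rightarrow> real" where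
  "basepoint_value c x v f = (THE a. leading_coefficient (\<lambda>t. f (normal_curve c x v t)) a)"

text \<open>The values that the natural bijection prescribes on the coordinates of
  \<open>c\<close>.\<close>

definition basepoint_coord :: "'a chart \<Rightarrow> 'a \<Rightarrow> (nat \<Rightarrow> real) \<Rightarrow> nat \<Rightarrow> real" where
  "basepoint_coord c x v i = (if i \<in> zero_coords c x then v i else coord c x i)"

lemma basepoint_value_eqI:
  "leading_coefficient (\<lambda>t. f (normal_curve c x v t)) a \<Longrightarrow> basepoint_value c x v f = a"
  unfolding basepoint_value_def using leading_coefficient_unique by blast

section \<open>Basic sections along the normal curve of a basepoint\<close>

context
  fixes M :: "'a corners" and c :: "'a chart" and x :: 'a and v :: "nat \<Rightarrow> real"
  assumes M: "manifold_with_corners M" and c: "c \<in> atlas M" and x: "x \<in> cdom c"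
    and v: "\<forall>i\<in>zero_coords c x. 0 < v i"
begin

lemma basepoint_coord_pos: "i < cdim c \<Longrightarrow> 0 < basepoint_coord c x v i"
  using v chart_nonneg[OF M c x, of i] by (auto simp: basepoint_coord_def zero_coords_def less_le)

text \<open>Positivity of \<open>v\<close> keeps the tuple in the orthant for \<open>t > 0\<close>,
  and it tends to the coordinates of \<open>x\<close>; so for small \<open>t\<close> it comes from a
  point of \<open>V\<close>.\<close>

lemma normal_curve_eventually:
  assumes V: "openin (points M) V" "x \<in> V"
  shows "\<forall>\<^sub>F t in at_right 0. 0 < t \<and> normal_curve c x v t \<in> V \<inter> cdom c \<and>
    coord c (normal_curve c x v t) = (\<lambda>i. if i \<in> zero_coords c x then t * v i else coord c x i)"
proof -
  have V': "openin (points M) (V \<inter> cdom c)" using V chart_facts(1)[OF M c] by blast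
  have pos: "\<forall>\<^sub>F t in at_right (0 :: real). 0 < t" by (rule eventually_at_right_less)
  have "\<forall>\<^sub>F t in at_right 0. (\<lambda>i. if i \<in> zero_coords c x then t * v i else coord c x i) \<in> coord c ` (V \<inter> cdom c)"
  proof (rule eventually_in_chart_image[OF M c V' Int_lower2])
    show "x \<in> V \<inter> cdom c" using V x by blast
    show "\<forall>\<^sub>F t in at_right 0. (\<lambda>i. if i \<in> zero_coords c x then t * v i else coord c x i) \<in> orthant (cdim c)"
      using pos by eventually_elim
        (use v chart_orthant[OF M c x] in \<open>auto simp: orthant_def topspace_Euclidean_space zero_coords_def\<close>)
    show "((\<lambda>t. if i \<in> zero_coords c x then t * v i else coord c x i) \<longlongrightarrow> coord c x i) (at_right 0)" for i
      using zero_coordsD(2)[of i c x] by (cases "i \<in> zero_coords c x") (auto intro!: tendsto_eq_intros)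
  qed
  then show ?thesis
    using pos
  proof eventually_elim
    case (elim t)
    show ?case
      using chart_inv_image[OF M c elim(1) Int_lower2] elim(2) by (simp add: normal_curve_def)
  qed
qed

lemma smooth_normal_curve_tendsto:
  assumes g: "g \<in> smooth_functions M V" "openin (points M) V" "x \<in> V"
  shows "((\<lambda>t. g (normal_curve c x v t)) \<longlongrightarrow> g x) (at_right 0)"
proof -
  obtain V' W F where V: "openin (points M) V'" "x \<in> V'"
    "openin (Euclidean_space (cdim c)) W" "coord c ` V' \<subseteq> W" "\<forall>k. cont_diff k (cdim c) W F"
    "\<And>y. y \<in> V' \<Longrightarrow> F (coord c y) = g y"
    by (rule smooth_functionsE[OF M g(1) c g(3) x]) blast
  have "((\<lambda>t. F (coord c (normal_curve c x v t))) \<longlongrightarrow> F (coord c x)) (at_right 0)"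
  proof (rule tendsto_compose_Euclidean[where p = "coord c x" and f = F, OF V(3)])
    show "coord c x \<in> W" using V by blast
    show "continuous_on W F" using cont_diff_continuous_on[OF V(3)] V(5) by blast
    show "\<forall>\<^sub>F t in at_right 0. coord c (normal_curve c x v t) \<in> topspace (Euclidean_space (cdim c))"
      using normal_curve_eventually[OF V(1,2)] by eventually_elim (use chart_Euclidean[OF M c] in blast)
    show "((\<lambda>t. coord c (normal_curve c x v t) i) \<longlongrightarrow> coord c x i) (at_right 0)" for i
    proof (rule Lim_transform_eventually)
      show "((\<lambda>t. if i \<in> zero_coords c x then t * v i else coord c x i) \<longlongrightarrow> coord c x i) (at_right 0)"
        using zero_coordsD(2)[of i c x] by (cases "i \<in> zero_coords c x") (auto intro!: tendsto_eq_intros)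
      show "\<forall>\<^sub>F t in at_right 0. (if i \<in> zero_coords c x then t * v i else coord c x i) =
          coord c (normal_curve c x v t) i"
        using normal_curve_eventually[OF V(1,2)] by eventually_elim simp
    qed
  qed
  then have "((\<lambda>t. F (coord c (normal_curve c x v t))) \<longlongrightarrow> g x) (at_right 0)"
    using V(6)[OF V(2)] by simp
  then show ?thesis
  proof (rule Lim_transform_eventually)
    show "\<forall>\<^sub>F t in at_right 0. F (coord c (normal_curve c x v t)) = g (normal_curve c x v t)"
      using normal_curve_eventually[OF V(1,2)] by eventually_elim (use V(6) in blast)
  qed
qed

lemma leading_coefficient_monomial:
  assumes V: "openin (points M) V" "x \<in> V" and g: "g \<in> pos_functions M V"
    and f: "\<And>y. y \<in> V \<Longrightarrow> f y = g y * (\<Prod>i<cdim c. coord c y i ^ (j i :: nat))"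
  shows "leading_coefficient (\<lambda>t. f (normal_curve c x v t)) (g x * (\<Prod>i<cdim c. basepoint_coord c x v i ^ j i))"
proof -
  \<comment> \<open>The order of vanishing of the monomial along the curve: each power of a
    vanishing coordinate contributes one factor \<open>t\<close>.\<close>
  define J where "J = (\<Sum>i<cdim c. if i \<in> zero_coords c x then j i else 0)"
  have "((\<lambda>t. g (normal_curve c x v t) * (\<Prod>i<cdim c. basepoint_coord c x v i ^ j i)) \<longlongrightarrow>
      g x * (\<Prod>i<cdim c. basepoint_coord c x v i ^ j i)) (at_right 0)"
    using g by (intro tendsto_mult_right smooth_normal_curve_tendsto[OF _ V]) (simp add: pos_functions_def)
  then have "((\<lambda>t. f (normal_curve c x v t) / t ^ J) \<longlongrightarrow>
      g x * (\<Prod>i<cdim c. basepoint_coord c x v i ^ j i)) (at_right 0)"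
  proof (rule Lim_transform_eventually)
    show "\<forall>\<^sub>F t in at_right 0. g (normal_curve c x v t) * (\<Prod>i<cdim c. basepoint_coord c x v i ^ j i) =
        f (normal_curve c x v t) / t ^ J"
      using normal_curve_eventually[OF V]
    proof eventually_elim
      case (elim t)
      then have t: "0 < t" and y: "normal_curve c x v t \<in> V"
        and cy: "\<And>i. coord c (normal_curve c x v t) i = (if i \<in> zero_coords c x then t * v i else coord c x i)"
        by auto
      have "(\<Prod>i<cdim c. coord c (normal_curve c x v t) i ^ j i) =
          (\<Prod>i<cdim c. t ^ (if i \<in> zero_coords c x then j i else 0) * basepoint_coord c x v i ^ j i)"
        by (rule prod.cong) (auto simp: cy basepoint_coord_def power_mult_distrib)
      also have "\<dots> = t ^ J * (\<Prod>i<cdim c. basepoint_coord c x v i ^ j i)"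
        by (simp add: prod.distrib J_def power_sum)
      finally show ?case using f[OF y] t by simp
    qed
  qed
  moreover have "0 < g x * (\<Prod>i<cdim c. basepoint_coord c x v i ^ j i)"
    using g V(2) basepoint_coord_pos by (intro mult_pos_pos prod_pos) (auto simp: pos_functions_def)
  ultimately show ?thesis unfolding leading_coefficient_def by blast
qed

lemma basepoint_value_monomial:
  assumes "openin (points M) V" "x \<in> V" "g \<in> pos_functions M V"
    "\<And>y. y \<in> V \<Longrightarrow> f y = g y * (\<Prod>i<cdim c. coord c y i ^ (j i :: nat))"
  shows "basepoint_value c x v f = g x * (\<Prod>i<cdim c. basepoint_coord c x v i ^ j i)"
  by (rule basepoint_value_eqI[OF leading_coefficient_monomial[OF assms]])

lemma basic_section_monomial:
  assumes f: "f \<in> basic_sections M U" and U: "x \<in> U"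
  obtains V g j where "openin (points M) V" "x \<in> V" "V \<subseteq> U" "V \<subseteq> cdom c" "g \<in> pos_functions M V"
    "\<And>y. y \<in> V \<Longrightarrow> f y = g y * (\<Prod>i<cdim c. coord c y i ^ (j i :: nat))"
proof -
  have "x \<in> U \<inter> cdom c" using U x by blast
  then obtain V g and j :: "nat \<Rightarrow> nat" where "openin (points M) V" "x \<in> V" "V \<subseteq> U \<inter> cdom c" "g \<in> pos_functions M V"
    "\<forall>y\<in>V. f y = g y * (\<Prod>i<cdim c. coord c y i ^ j i)"
    using f c unfolding basic_sections_def by blast
  then show thesis by (intro that[of V g j]) auto
qed

lemma leading_coefficient_basic:
  assumes "f \<in> basic_sections M U" "x \<in> U"
  shows "leading_coefficient (\<lambda>t. f (normal_curve c x v t)) (basepoint_value c x v f)"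
proof -
  obtain V g j where *: "openin (points M) V" "x \<in> V" "V \<subseteq> U" "V \<subseteq> cdom c" "g \<in> pos_functions M V"
    "\<And>y. y \<in> V \<Longrightarrow> f y = g y * (\<Prod>i<cdim c. coord c y i ^ (j i :: nat))"
    by (rule basic_section_monomial[OF assms]) blast
  show ?thesis
    using leading_coefficient_monomial[OF *(1,2,5,6)] basepoint_value_monomial[OF *(1,2,5,6)] by simp
qed

lemma basepoint_value_pos: "f \<in> basic_sections M U \<Longrightarrow> x \<in> U \<Longrightarrow> 0 < basepoint_value c x v f"
  using leading_coefficient_basic by (simp add: leading_coefficient_def)

lemma basepoint_value_cong:
  assumes "f \<in> basic_sections M U" "x \<in> U" "openin (points M) V" "x \<in> V" "\<And>y. y \<in> V \<Longrightarrow> f y = g y"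
  shows "basepoint_value c x v g = basepoint_value c x v f"
proof (rule basepoint_value_eqI, rule leading_coefficient_cong[OF leading_coefficient_basic[OF assms(1,2)]])
  show "\<forall>\<^sub>F t in at_right 0. f (normal_curve c x v t) = g (normal_curve c x v t)"
    using normal_curve_eventually[OF assms(3,4)] by eventually_elim (use assms(5) in blast)
qed

text \<open>Leading coefficients multiply. Agreement of \<open>h\<close> with the product near
  \<open>x\<close> suffices, which admits products restricted to a neighbourhood.\<close>

lemma basepoint_value_mult:
  assumes f: "f \<in> basic_sections M U" "x \<in> U" and g: "g \<in> basic_sections M U'" "x \<in> U'"
    and V: "openin (points M) V" "x \<in> V" "\<And>y. y \<in> V \<Longrightarrow> h y = f y * g y"
  shows "basepoint_value c x v h = basepoint_value c x v f * basepoint_value c x v g"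
proof (rule basepoint_value_eqI,
    rule leading_coefficient_cong[OF leading_coefficient_mult[OF leading_coefficient_basic[OF f] leading_coefficient_basic[OF g]]])
  show "\<forall>\<^sub>F t in at_right 0. f (normal_curve c x v t) * g (normal_curve c x v t) = h (normal_curve c x v t)"
    using normal_curve_eventually[OF V(1,2)] by eventually_elim (use V(3) in auto)
qed

lemma basepoint_value_pos_function:
  assumes "f \<in> pos_functions M U" "openin (points M) U" "x \<in> U"
  shows "basepoint_value c x v f = f x"
  using basepoint_value_monomial[OF assms(2,3,1), of f "\<lambda>_. 0"] by simp

lemma basepoint_value_coord_transition:
  assumes V: "openin (points M) V" "x \<in> V" and g: "g \<in> pos_functions M V" and k: "k < cdim c"
    and f: "\<And>y. y \<in> V \<Longrightarrow> f y = g y * coord c y k"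
  shows "basepoint_value c x v f = g x * basepoint_coord c x v k"
proof -
  have one: "(\<Prod>i<cdim c. z i ^ (if i = k then 1 else 0)) = z k" for z :: "nat \<Rightarrow> real"
  proof -
    have "(\<Prod>i<cdim c. z i ^ (if i = k then 1 else 0)) = (\<Prod>i<cdim c. if i = k then z i else 1)"
      by (intro prod.cong) auto
    then show ?thesis using k by (simp add: prod.delta)
  qed
  show ?thesis
    using basepoint_value_monomial[OF V g, of f "\<lambda>i. if i = k then 1 else 0"] f unfolding one by simp
qed

lemma basepoint_value_coord:
  assumes k: "k < cdim c"
  shows "basepoint_value c x v (coord_fun c k) = basepoint_coord c x v k"
  using basepoint_value_coord_transition[OF chart_facts(1)[OF M c] x _ k, of "\<lambda>y\<in>cdom c. 1" "coord_fun c k"]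
    smooth_functions_one[OF M chart_facts(1)[OF M c]] x
  by (simp add: pos_functions_def coord_fun_def)

text \<open>The link between the two sides of the bijection: \<open>basepoint_value\<close>
  describes the morphism and \<open>coord_tangent\<close> the normal vector. Allowing any chart
  \<open>e\<close> at \<open>x\<close> is what makes comparison across charts possible.\<close>

lemma basepoint_value_eq_coord_tangent:
  assumes e: "e \<in> atlas M" "x \<in> cdom e" and i: "i \<in> zero_coords e x"
  shows "basepoint_value c x v (coord_fun e i) = coord_tangent M c x v (coord_fun e i)"
proof -
  obtain V g k where V: "openin (points M) V" "x \<in> V" "k \<in> zero_coords c x"
    "g \<in> pos_functions M V" "\<And>y. y \<in> V \<Longrightarrow> coord e y i = g y * coord c y k"
    by (rule transition_zero_coord[OF M c e(1) x e(2) i]) blast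
  show ?thesis
    using coord_tangent_transition[OF M c x e zero_coordsD(1)[OF i] V]
      basepoint_value_coord_transition[OF V(1,2,4) zero_coordsD(1)[OF V(3)], of "coord_fun e i"] V(3,5)
    by (simp add: coord_fun_def basepoint_coord_def)
qed

end

section \<open>Sections over the point\<close>

lemma function_presheaf_simps [simp]:
  "base (function_presheaf X S) = X"
  "carrier (sections (function_presheaf X S) U) = S U"
  "f \<otimes>\<^bsub>sections (function_presheaf X S) U\<^esub> g = (\<lambda>x\<in>U. f x * g x)"
  "\<one>\<^bsub>sections (function_presheaf X S) U\<^esub> = (\<lambda>x\<in>U. 1)"
  "restr (function_presheaf X S) U V f = restrict f V"
  by (simp_all add: function_presheaf_def)

lemma points_point_manifold [simp]: "points point_manifold = discrete_topology UNIV"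
  by (simp add: point_manifold_def)

lemma unit_set_cases: "V = {} \<or> V = (UNIV :: unit set)"
  by auto

lemma smooth_functions_point: "smooth_functions point_manifold U = extensional U"
proof -
  have "smooth_on (cdim c) (coord c ` (U \<inter> cdom c)) (f \<circ> chart_inv c)"
    if c: "c \<in> atlas point_manifold" for c and f :: "unit \<Rightarrow> real"
  proof (rule smooth_on_cong)
    have "corner_chart (discrete_topology UNIV) c" using c by (simp add: point_manifold_def)
    then have "coord c ` cdom c \<subseteq> topspace (Euclidean_space (cdim c))"
      unfolding corner_chart_def by (metis openin_subset topspace_subtopology_subset inf.boundedE topspace_subtopology)
    then show "smooth_on (cdim c) (coord c ` (U \<inter> cdom c)) (\<lambda>_. f ())"
      by (intro smooth_on_const) blast
  qed simp
  then show ?thesis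
    unfolding smooth_functions_def by (auto intro!: exI[of _ "U \<inter> cdom _"])
qed

lemma pos_functions_point: "pos_functions point_manifold U = {f \<in> extensional U. \<forall>x\<in>U. 0 < f x}"
  by (simp add: pos_functions_def smooth_functions_point)

section \<open>The group completed sheaf of the point\<close>

abbreviation point_sheaf :: "(unit, unit \<Rightarrow> real) presheaf" where
  "point_sheaf \<equiv> function_presheaf (discrete_topology UNIV) (pos_functions point_manifold)"

lemma log_sheaf_point: "log_sheaf point_log = point_sheaf"
  by (simp add: trivial_log_def)

lemma point_sheaf_monoid: "monoid_presheaf point_sheaf"
proof -
  have "monoid_sheaf point_sheaf"
  proof (rule monoid_sheaf_function_presheaf)
    fix U :: "unit set" and f :: "unit \<Rightarrow> real"
    assume f: "f \<in> extensional U"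
      and loc: "\<And>x. x \<in> U \<Longrightarrow> \<exists>V. openin (discrete_topology UNIV) V \<and> x \<in> V \<and> V \<subseteq> U \<and>
        restrict f V \<in> pos_functions point_manifold V"
    have "0 < f x" if "x \<in> U" for x
      using loc[OF that] by (auto simp: pos_functions_point)
    then show "f \<in> pos_functions point_manifold U" using f by (simp add: pos_functions_point)
  qed (auto simp: pos_functions_point)
  then show ?thesis by (simp add: monoid_sheaf_def)
qed

lemma point_value_eq:
  "point_value a = (\<lambda>_. germ (gp_presheaf point_sheaf) () UNIV
     (gp_rel (sections point_sheaf UNIV) `` {(\<lambda>_. a, \<lambda>_. 1)}))"
  by (simp add: point_value_def log_sheaf_point to_gp_def fun_eq_iff restrict_UNIV)

lemma sections_gp_point:
  "carrier (sections (gp_sheaf point_sheaf) UNIV) = {\<sigma>. \<sigma> () \<in> carrier (stalk (gp_presheaf point_sheaf) ())}"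
  "\<sigma> \<otimes>\<^bsub>sections (gp_sheaf point_sheaf) UNIV\<^esub> \<tau> = (\<lambda>_. \<sigma> () \<otimes>\<^bsub>stalk (gp_presheaf point_sheaf) ()\<^esub> \<tau> ())"
  "\<one>\<^bsub>sections (gp_sheaf point_sheaf) UNIV\<^esub> = (\<lambda>_. \<one>\<^bsub>stalk (gp_presheaf point_sheaf) ()\<^esub>)"
  "carrier (sections (gp_sheaf point_sheaf) {}) = {\<lambda>_. undefined}"
  using sections_over_point[of "\<lambda>x. x" "gp_presheaf point_sheaf"]
    sections_over_empty[of "discrete_topology UNIV" "\<lambda>x. x" "gp_presheaf point_sheaf"]
  by (simp_all add: gp_sheaf_def sheafification_def) (simp_all add: inverse_image_def fun_eq_iff)

lemma point_const_closed: "0 < a \<Longrightarrow> (\<lambda>_. a) \<in> carrier (sections point_sheaf UNIV)"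
  by (simp add: pos_functions_point)

lemma point_value_closed:
  "0 < a \<Longrightarrow> point_value a \<in> carrier (sections (gp_sheaf point_sheaf) UNIV)"
  using gp_class_closed[OF presheaf_comm_monoid[OF point_sheaf_monoid], OF _ point_const_closed point_const_closed, of a 1]
  unfolding sections_gp_point point_value_eq by (force simp: stalk_def)

lemma point_value_mult:
  assumes "0 < a" "0 < b"
  shows "point_value a \<otimes>\<^bsub>sections (gp_sheaf point_sheaf) UNIV\<^esub> point_value b = point_value (a * b)"
  unfolding sections_gp_point point_value_eq
  using gp_germ_mult[OF point_sheaf_monoid _ _ point_const_closed[OF assms(1)] point_const_closed[OF zero_less_one]
      _ _ point_const_closed[OF assms(2)] point_const_closed[OF zero_less_one], of "()"]
  by (simp add: fun_eq_iff restrict_UNIV)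

lemma point_value_one: "\<one>\<^bsub>sections (gp_sheaf point_sheaf) UNIV\<^esub> = point_value 1"
  unfolding sections_gp_point point_value_eq by (simp add: stalk_def group_completion_def restrict_UNIV)

text \<open>The multiplier of the group completion is positive at the single point and
  cancels.\<close>

lemma point_value_inject:
  assumes "point_value a = point_value b" "0 < a" "0 < b"
  shows "a = b"
proof -
  have "germ (gp_presheaf point_sheaf) () UNIV (gp_rel (sections point_sheaf UNIV) `` {(\<lambda>_. a, \<lambda>_. 1)}) =
      germ (gp_presheaf point_sheaf) () UNIV (gp_rel (sections point_sheaf UNIV) `` {(\<lambda>_. b, \<lambda>_. 1)})"
    using assms(1) unfolding point_value_eq by meson
  then obtain W e where "() \<in> W" "e \<in> pos_functions point_manifold W"
    "(\<lambda>x\<in>W. e x * (\<lambda>x\<in>W. restrict (\<lambda>_. a) W x * restrict (\<lambda>_. 1) W x) x) =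
     (\<lambda>x\<in>W. e x * (\<lambda>x\<in>W. restrict (\<lambda>_. b) W x * restrict (\<lambda>_. 1) W x) x)"
    using gp_germ_eq_iff[OF point_sheaf_monoid _ _ point_const_closed[OF assms(2)] point_const_closed[OF zero_less_one]
      _ _ point_const_closed[OF assms(3)] point_const_closed[OF zero_less_one], of "()"]
    by auto
  from fun_cong[OF this(3), of "()"] this(1,2) show ?thesis
    by (auto simp: pos_functions_point)
qed

text \<open>Positive reals already form a group: the fraction \<open>a / b\<close> is the class of
  the number \<open>a () / b ()\<close>.\<close>

lemma point_value_surj:
  assumes "\<sigma> \<in> carrier (sections (gp_sheaf point_sheaf) UNIV)"
  obtains a where "0 < a" "\<sigma> = point_value a"
proof -
  have "\<sigma> () \<in> carrier (stalk (gp_presheaf point_sheaf) ())" using assms by (simp add: sections_gp_point)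
  then obtain U a b where U: "() \<in> U" "a \<in> carrier (sections point_sheaf U)" "b \<in> carrier (sections point_sheaf U)"
    "\<sigma> () = germ (gp_presheaf point_sheaf) () U (gp_rel (sections point_sheaf U) `` {(a, b)})"
    by (rule gp_stalk_cases[OF point_sheaf_monoid]) blast
  have UU: "U = UNIV" using U(1) by auto
  have pos: "0 < a ()" "0 < b ()" using U(2,3) by (auto simp: UU pos_functions_point)
  have "germ (gp_presheaf point_sheaf) () U (gp_rel (sections point_sheaf U) `` {(a, b)}) =
      germ (gp_presheaf point_sheaf) () UNIV (gp_rel (sections point_sheaf UNIV) `` {(\<lambda>_. a () / b (), \<lambda>_. 1)})"
    unfolding UU
  proof (subst gp_germ_eq_iff[OF point_sheaf_monoid])
    show "\<exists>W. openin (base point_sheaf) W \<and> () \<in> W \<and> W \<subseteq> UNIV \<inter> UNIV \<and> (\<exists>e\<in>carrier (sections point_sheaf W).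
      e \<otimes>\<^bsub>sections point_sheaf W\<^esub> (restr point_sheaf UNIV W a \<otimes>\<^bsub>sections point_sheaf W\<^esub> restr point_sheaf UNIV W (\<lambda>_. 1)) =
      e \<otimes>\<^bsub>sections point_sheaf W\<^esub> (restr point_sheaf UNIV W (\<lambda>_. a () / b ()) \<otimes>\<^bsub>sections point_sheaf W\<^esub> restr point_sheaf UNIV W b))"
      using pos by (intro exI[of _ UNIV] bexI[of _ "\<lambda>_. 1"] conjI) (auto simp: fun_eq_iff pos_functions_point)
  qed (use pos U in \<open>auto simp: UU pos_functions_point\<close>)
  then have "\<sigma> = point_value (a () / b ())"
    unfolding point_value_eq using U(4) by (simp add: fun_eq_iff)
  with that[OF divide_pos_pos[OF pos]] show thesis .
qed

section \<open>Germs of fractions of basic sections\<close>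

abbreviation basic_presheaf :: "'a corners \<Rightarrow> ('a, 'a \<Rightarrow> real) presheaf" where
  "basic_presheaf M \<equiv> function_presheaf (points M) (basic_sections M)"

abbreviation "basic_stalk M x \<equiv> stalk (gp_sheaf (basic_presheaf M)) x"

abbreviation "basic_frac M x \<equiv> frac_germ (basic_presheaf M) x"

abbreviation basic_pullback where
  "basic_pullback M x \<equiv>
     inverse_image (discrete_topology UNIV) (\<lambda>_ :: unit. x) (gp_sheaf (basic_presheaf M))"

lemma log_sheaf_basic: "log_sheaf (basic_log M) = basic_presheaf M"
  by (simp add: basic_log_def)

text \<open>The homomorphism on the stalk attached to \<open>(x, v)\<close>. The description ranges
  over all fractions representing \<open>p\<close>; that they give one value is shown in
  \<open>frac_value_frac_germ\<close>.\<close>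

definition frac_value :: "'a corners \<Rightarrow> 'a chart \<Rightarrow> 'a \<Rightarrow> (nat \<Rightarrow> real) \<Rightarrow>
    ('a set \<times> ('a, 'a \<Rightarrow> real) gp_section) set \<Rightarrow> real" where
  "frac_value M c x v p = (THE r. \<exists>U a b. openin (points M) U \<and> x \<in> U \<and>
     a \<in> basic_sections M U \<and> b \<in> basic_sections M U \<and> p = basic_frac M x U a b \<and>
     r = basepoint_value c x v a / basepoint_value c x v b)"

context
  fixes M :: "'a corners"
  assumes M: "manifold_with_corners M"
begin

lemma basic_presheaf_monoid: "monoid_presheaf (basic_presheaf M)"
  using monoid_sheaf_basic[OF M] by (simp add: monoid_sheaf_def)

lemma basic_sections_mult:
  "openin (points M) U \<Longrightarrow> f \<in> basic_sections M U \<Longrightarrow> g \<in> basic_sections M U \<Longrightarrow>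
    (\<lambda>y\<in>U. f y * g y) \<in> basic_sections M U"
  using presheaf_mult_closed[OF basic_presheaf_monoid, of U f g] by simp

lemma basic_sections_one: "openin (points M) U \<Longrightarrow> (\<lambda>y\<in>U. 1) \<in> basic_sections M U"
  using presheaf_one_closed[OF basic_presheaf_monoid, of U] by simp

lemma basic_sections_restrict:
  "openin (points M) U \<Longrightarrow> openin (points M) V \<Longrightarrow> V \<subseteq> U \<Longrightarrow> f \<in> basic_sections M U \<Longrightarrow>
    restrict f V \<in> basic_sections M V"
  using presheaf_restr_closed[OF basic_presheaf_monoid, of U V f] by simp

text \<open>The sections are real functions, so the equation becomes pointwise. The multiplier
  \<open>e\<close> may vanish on the boundary, in particular at \<open>x\<close>, so it cannot
  simply be divided out there.\<close>

lemma basic_frac_eq_iff: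
  assumes "openin (points M) U" "x \<in> U" "a \<in> basic_sections M U" "b \<in> basic_sections M U"
    and "openin (points M) V" "x \<in> V" "a' \<in> basic_sections M V" "b' \<in> basic_sections M V"
  shows "basic_frac M x U a b = basic_frac M x V a' b' \<longleftrightarrow>
    (\<exists>W. openin (points M) W \<and> x \<in> W \<and> W \<subseteq> U \<inter> V \<and>
      (\<exists>e\<in>basic_sections M W. \<forall>y\<in>W. e y * (a y * b' y) = e y * (a' y * b y)))"
proof -
  have eq: "(\<lambda>y\<in>W. e y * (\<lambda>y\<in>W. restrict a W y * restrict b' W y) y) =
      (\<lambda>y\<in>W. e y * (\<lambda>y\<in>W. restrict a' W y * restrict b W y) y) \<longleftrightarrow>
    (\<forall>y\<in>W. e y * (a y * b' y) = e y * (a' y * b y))" for W and e :: "'a \<Rightarrow> real"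
    by (auto simp: fun_eq_iff restrict_def)
  show ?thesis
    using frac_germ_eq_iff[OF basic_presheaf_monoid, unfolded function_presheaf_simps, OF assms]
    unfolding eq .
qed

lemma basic_frac_restrict:
  assumes "openin (points M) U" "x \<in> V" "a \<in> basic_sections M U" "b \<in> basic_sections M U"
    and "openin (points M) V" "V \<subseteq> U"
  shows "basic_frac M x U a b = basic_frac M x V (restrict a V) (restrict b V)"
  using assms basic_sections_one[OF assms(5)]
  by (subst basic_frac_eq_iff)
    (auto intro!: basic_sections_restrict exI[of _ V] bexI[of _ "\<lambda>y\<in>V. 1"] intro: assms(1))

lemma basic_frac_mult:
  assumes "openin (points M) U" "x \<in> U" "a \<in> basic_sections M U" "b \<in> basic_sections M U"
    and "a' \<in> basic_sections M U" "b' \<in> basic_sections M U"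
  shows "basic_frac M x U a b \<otimes>\<^bsub>basic_stalk M x\<^esub>
      basic_frac M x U a' b' =
    basic_frac M x U (\<lambda>y\<in>U. a y * a' y) (\<lambda>y\<in>U. b y * b' y)"
proof -
  have "(\<lambda>y\<in>U. restrict f U y * restrict g U y) = (\<lambda>y\<in>U. f y * g y)" for f g :: "'a \<Rightarrow> real"
    by (auto simp: fun_eq_iff)
  then show ?thesis
    using frac_germ_mult[OF basic_presheaf_monoid, of U x a b U a' b'] assms by simp
qed

lemma basic_frac_cases2:
  assumes "p \<in> carrier (basic_stalk M x)" "q \<in> carrier (basic_stalk M x)"
  obtains U a b a' b' where "openin (points M) U" "x \<in> U" "a \<in> basic_sections M U" "b \<in> basic_sections M U"
    "a' \<in> basic_sections M U" "b' \<in> basic_sections M U"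
    "p = basic_frac M x U a b" "q = basic_frac M x U a' b'"
proof -
  obtain U a b where U: "openin (points M) U" "x \<in> U" "a \<in> basic_sections M U" "b \<in> basic_sections M U"
    "p = basic_frac M x U a b"
    by (rule frac_germ_cases[OF basic_presheaf_monoid assms(1)]) (simp only: function_presheaf_simps)
  obtain V a' b' where V: "openin (points M) V" "x \<in> V" "a' \<in> basic_sections M V" "b' \<in> basic_sections M V"
    "q = basic_frac M x V a' b'"
    by (rule frac_germ_cases[OF basic_presheaf_monoid assms(2)]) (simp only: function_presheaf_simps)
  have W: "openin (points M) (U \<inter> V)" "x \<in> U \<inter> V" using U V by auto
  have "restrict a (U \<inter> V) \<in> basic_sections M (U \<inter> V)" "restrict b (U \<inter> V) \<in> basic_sections M (U \<inter> V)"
    using U W(1) by (auto intro!: basic_sections_restrict[OF U(1)] simp del: restrict_restrict)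
  moreover have "restrict a' (U \<inter> V) \<in> basic_sections M (U \<inter> V)" "restrict b' (U \<inter> V) \<in> basic_sections M (U \<inter> V)"
    using V W(1) by (auto intro!: basic_sections_restrict[OF V(1)] simp del: restrict_restrict)
  moreover have "p = basic_frac M x (U \<inter> V) (restrict a (U \<inter> V)) (restrict b (U \<inter> V))"
    unfolding U(5) by (rule basic_frac_restrict[OF U(1) W(2) U(3,4) W(1) Int_lower1])
  moreover have "q = basic_frac M x (U \<inter> V) (restrict a' (U \<inter> V)) (restrict b' (U \<inter> V))"
    unfolding V(5) by (rule basic_frac_restrict[OF V(1) W(2) V(3,4) W(1) Int_lower2])
  ultimately show thesis by (rule that[OF W])
qed

lemma basic_frac_one:
  assumes "openin (points M) U" "x \<in> U"
  shows "\<one>\<^bsub>basic_stalk M x\<^esub> = basic_frac M x U (\<lambda>y\<in>U. 1) (\<lambda>y\<in>U. 1)"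
proof -
  have U: "U \<subseteq> topspace (points M)" using openin_subset[OF assms(1)] .
  have r: "restrict (\<lambda>y\<in>topspace (points M). 1 :: real) U = (\<lambda>y\<in>U. 1)"
    using U by (auto simp: fun_eq_iff restrict_def)
  show ?thesis
    unfolding one_gp_stalk[OF basic_presheaf_monoid] function_presheaf_simps
    using basic_frac_restrict[OF openin_topspace assms(2) basic_sections_one basic_sections_one assms(1) U]
    unfolding r by simp
qed

section \<open>The homomorphism on the stalk\<close>

context
  fixes c :: "'a chart" and x :: 'a and v :: "nat \<Rightarrow> real"
  assumes c: "c \<in> atlas M" and x: "x \<in> cdom c" and v: "\<forall>i\<in>zero_coords c x. 0 < v i"
begin

text \<open>The cross-multiplied equation holds near \<open>x\<close>, hence along the normal curve.
  Leading coefficients are multiplicative and unique, and that of the multiplier \<open>e\<close> is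
  positive, so it cancels although \<open>e\<close> may vanish at \<open>x\<close>.\<close>

lemma frac_value_frac_germ:
  assumes U: "openin (points M) U" "x \<in> U" and ab: "a \<in> basic_sections M U" "b \<in> basic_sections M U"
  shows "frac_value M c x v (basic_frac M x U a b) =
    basepoint_value c x v a / basepoint_value c x v b"
  unfolding frac_value_def
proof (rule the_equality)
  fix r assume "\<exists>V a' b'. openin (points M) V \<and> x \<in> V \<and>
     a' \<in> basic_sections M V \<and> b' \<in> basic_sections M V \<and>
     basic_frac M x U a b = basic_frac M x V a' b' \<and>
     r = basepoint_value c x v a' / basepoint_value c x v b'"
  then obtain V a' b' where V: "openin (points M) V" "x \<in> V"
    and ab': "a' \<in> basic_sections M V" "b' \<in> basic_sections M V"
    and eq: "basic_frac M x U a b = basic_frac M x V a' b'"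
    and r: "r = basepoint_value c x v a' / basepoint_value c x v b'"
    by blast
  obtain W e where W: "openin (points M) W" "x \<in> W" "e \<in> basic_sections M W"
    and e: "\<forall>y\<in>W. e y * (a y * b' y) = e y * (a' y * b y)"
    using eq unfolding basic_frac_eq_iff[OF U ab V ab'] by blast
  let ?l = "\<lambda>f. basepoint_value c x v f"
  note lead = leading_coefficient_basic[OF M c x v]
  have "leading_coefficient (\<lambda>t. e (normal_curve c x v t) * (a (normal_curve c x v t) * b' (normal_curve c x v t)))
      (?l e * (?l a * ?l b'))"
    by (intro leading_coefficient_mult lead[OF W(3,2)] lead[OF ab(1) U(2)] lead[OF ab'(2) V(2)])
  moreover have "leading_coefficient (\<lambda>t. e (normal_curve c x v t) * (a (normal_curve c x v t) * b' (normal_curve c x v t)))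
      (?l e * (?l a' * ?l b))"
  proof (rule leading_coefficient_cong)
    show "leading_coefficient (\<lambda>t. e (normal_curve c x v t) * (a' (normal_curve c x v t) * b (normal_curve c x v t)))
      (?l e * (?l a' * ?l b))"
      by (intro leading_coefficient_mult lead[OF W(3,2)] lead[OF ab(2) U(2)] lead[OF ab'(1) V(2)])
    show "\<forall>\<^sub>F t in at_right 0. e (normal_curve c x v t) * (a' (normal_curve c x v t) * b (normal_curve c x v t)) =
        e (normal_curve c x v t) * (a (normal_curve c x v t) * b' (normal_curve c x v t))"
      using normal_curve_eventually[OF M c x v W(1,2)]
      by eventually_elim (rule bspec[OF e, symmetric], blast)
  qed
  ultimately have "?l e * (?l a * ?l b') = ?l e * (?l a' * ?l b)"
    by (rule leading_coefficient_unique)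
  then have "?l a * ?l b' = ?l a' * ?l b"
    using basepoint_value_pos[OF M c x v W(3,2)] by simp
  then show "r = ?l a / ?l b"
    using basepoint_value_pos[OF M c x v ab(2) U(2)] basepoint_value_pos[OF M c x v ab'(2) V(2)]
    by (simp add: r frac_eq_eq)
qed (use U ab in blast)

lemma frac_value_mult:
  assumes p: "p \<in> carrier (basic_stalk M x)" and q: "q \<in> carrier (basic_stalk M x)"
  shows "frac_value M c x v (p \<otimes>\<^bsub>basic_stalk M x\<^esub> q) = frac_value M c x v p * frac_value M c x v q"
proof -
  obtain U a b a' b' where U: "openin (points M) U" "x \<in> U"
    and ab: "a \<in> basic_sections M U" "b \<in> basic_sections M U" "a' \<in> basic_sections M U" "b' \<in> basic_sections M U"
    and pq: "p = basic_frac M x U a b" "q = basic_frac M x U a' b'"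
    by (rule basic_frac_cases2[OF p q]) blast
  have "basepoint_value c x v (\<lambda>y\<in>U. f y * g y) = basepoint_value c x v f * basepoint_value c x v g"
    if "f \<in> basic_sections M U" "g \<in> basic_sections M U" for f g
    by (rule basepoint_value_mult[OF M c x v that(1) U(2) that(2) U(2) U]) simp
  then show ?thesis
    using ab by (simp add: pq basic_frac_mult[OF U] frac_value_frac_germ[OF U] basic_sections_mult[OF U(1)])
qed

lemma frac_value_pos:
  assumes p: "p \<in> carrier (basic_stalk M x)"
  shows "0 < frac_value M c x v p"
proof -
  obtain U a b where U: "openin (points M) U" "x \<in> U" "a \<in> basic_sections M U" "b \<in> basic_sections M U"
    "p = basic_frac M x U a b"
    by (rule basic_frac_cases2[OF p p]) blast
  then show ?thesis
    by (simp add: frac_value_frac_germ basepoint_value_pos[OF M c x v])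
qed

lemma basepoint_value_one: "openin (points M) U \<Longrightarrow> x \<in> U \<Longrightarrow> basepoint_value c x v (\<lambda>y\<in>U. 1) = 1"
  using basepoint_value_pos_function[OF M c x v, of "\<lambda>y\<in>U. 1" U] smooth_functions_one[OF M, of U]
  by (simp add: pos_functions_def)

lemma frac_value_one: "frac_value M c x v \<one>\<^bsub>basic_stalk M x\<^esub> = 1"
  using chart_facts(1)[OF M c] x basic_sections_one[OF chart_facts(1)[OF M c]]
  by (simp add: basic_frac_one[of "cdom c"] frac_value_frac_germ basepoint_value_one)

end

end

section \<open>Virtual morphisms from the point\<close>

text \<open>Every subset of the point is open. The restriction to \<open>V\<close> produces the
  value over \<open>UNIV\<close> and the only section over the empty set; the bound on
  \<open>\<sigma>\<close> makes each component extensional.\<close>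

definition basepoint_morphism :: "'a corners \<Rightarrow> 'a chart \<Rightarrow> 'a \<Rightarrow> (nat \<Rightarrow> real) \<Rightarrow>
    (unit \<Rightarrow> 'a) \<times>
    (unit set \<Rightarrow> (unit \<Rightarrow> ('a set \<times> ('a, 'a \<Rightarrow> real) gp_section) set) \<Rightarrow> (unit, unit \<Rightarrow> real) gp_section)" where
  "basepoint_morphism M c x v =
     (\<lambda>_. x, \<lambda>V. \<lambda>\<sigma>\<in>carrier (sections (basic_pullback M x) V).
        restrict (point_value (frac_value M c x v (\<sigma> ()))) V)"

context
  fixes M :: "'a corners"
  assumes M: "manifold_with_corners M"
begin

lemma of_pos_basic:
  assumes "openin (points M) W" "f \<in> pos_functions M W"
  shows "of_pos (basic_log M) W f = f"
  unfolding of_pos_def using assms pos_functions_subset_basic[OF M assms(1)]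
  by (intro the_equality) (auto simp: basic_log_def)

lemma of_pos_point: "0 < a \<Longrightarrow> of_pos point_log UNIV (\<lambda>_. a) = (\<lambda>_. a)"
  unfolding of_pos_def by (intro the_equality) (auto simp: trivial_log_def pos_functions_point)

text \<open>Pulled back along a constant map, a section \<open>f\<close> is just its germ at
  \<open>x\<close>, written as the fraction with denominator 1.\<close>

lemma pulled_back_to_gp:
  "pulled_back_section (gp_sheaf (basic_presheaf M)) (\<lambda>_ :: unit. x) W (to_gp (basic_presheaf M) W f) UNIV =
    (\<lambda>_. basic_frac M x W f (\<lambda>y\<in>W. 1))"
  by (simp add: pulled_back_section_def frac_germ_def to_gp_eq_frac_section restrict_UNIV)

lemma pulled_back_coord_eq:
  "pulled_back_coord M (\<lambda>_. x) c i =
    (\<lambda>_. basic_frac M x (cdom c) (\<lambda>y\<in>cdom c. coord c y i) (\<lambda>y\<in>cdom c. 1))"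
  by (simp add: pulled_back_coord_def log_sheaf_basic pulled_back_to_gp)

lemma const_smooth_map:
  assumes x: "x \<in> topspace (points M)"
  shows "(\<lambda>_. x) \<in> smooth_maps point_manifold M"
  unfolding smooth_maps_def
proof (intro CollectI conjI ballI impI)
  fix c d :: "_ chart" and y
  assume c: "c \<in> atlas point_manifold" and d: "d \<in> atlas M" and y: "y \<in> cdom c" and xd: "x \<in> cdom d"
  have c: "corner_chart (discrete_topology UNIV) c" using c by (simp add: point_manifold_def)
  then have img: "coord c ` cdom c \<subseteq> topspace (Euclidean_space (cdim c))"
    unfolding corner_chart_def by (metis openin_subset inf.boundedE topspace_subtopology)
  have U: "cdom c = UNIV" using y by auto
  have "smooth_map (cdim c) (cdim d) (coord c ` cdom c) (coord d \<circ> (\<lambda>_. x) \<circ> chart_inv c)"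
    unfolding smooth_map_def comp_def using smooth_on_const[OF img] by blast
  then show "\<exists>V. openin (points point_manifold) V \<and> y \<in> V \<and> V \<subseteq> cdom c \<and> (\<lambda>_. x) ` V \<subseteq> cdom d \<and>
      smooth_map (cdim c) (cdim d) (coord c ` V) (coord d \<circ> (\<lambda>_. x) \<circ> chart_inv c)"
    using y xd by (intro exI[of _ "cdom c"]) auto
qed (use x in auto)

context
  fixes x :: 'a
  assumes x: "x \<in> topspace (points M)"
begin

lemma inverse_image_point_simps:
  "carrier (sections (basic_pullback M x) UNIV) =
    {\<sigma>. \<sigma> () \<in> carrier (basic_stalk M x)}"
  "carrier (sections (basic_pullback M x) {}) =
    {\<lambda>_. undefined}"
  "\<sigma> \<otimes>\<^bsub>sections (basic_pullback M x) UNIV\<^esub> \<tau> =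
    (\<lambda>_. \<sigma> () \<otimes>\<^bsub>basic_stalk M x\<^esub> \<tau> ())"
  "\<one>\<^bsub>sections (basic_pullback M x) UNIV\<^esub> =
    (\<lambda>_. \<one>\<^bsub>basic_stalk M x\<^esub>)"
  "base (basic_pullback M x) =
    discrete_topology UNIV"
  "restr (basic_pullback M x) U V \<sigma> = restrict \<sigma> V"
  using sections_over_point[of "\<lambda>_. x" "gp_sheaf (basic_presheaf M)"]
    sections_over_empty[of "discrete_topology UNIV" "\<lambda>_. x" "gp_sheaf (basic_presheaf M)"]
  by (simp_all) (simp_all add: inverse_image_def fun_eq_iff)

lemma sections_empty_mult:
  "\<sigma> \<otimes>\<^bsub>sections (inverse_image X \<phi> P) {}\<^esub> \<tau> = (\<lambda>_. undefined)"
  "\<one>\<^bsub>sections (inverse_image X \<phi> P) {}\<^esub> = (\<lambda>_. undefined)"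
  by (simp_all add: inverse_image_def restrict_def)

lemma base_gp_basic: "base (gp_sheaf (basic_presheaf M)) = points M"
  by (simp add: gp_sheaf_def sheafification_def inverse_image_def)

text \<open>Over \<open>UNIV\<close> the claims are that \<open>frac_value\<close> is positive,
  multiplicative and unital, and equals \<open>f x\<close> on a positive function \<open>f\<close>.
  Over the empty set all sections coincide.\<close>

lemma basepoint_morphism_closed:
  assumes c: "c \<in> atlas M" and xc: "x \<in> cdom c" and v: "\<forall>i\<in>zero_coords c x. 0 < v i"
  shows "basepoint_morphism M c x v \<in> virtual_morphisms point_log (basic_log M)"
proof -
  let ?I = "basic_pullback M x"
  let ?h = "\<lambda>V. \<lambda>\<sigma>\<in>carrier (sections ?I V). restrict (point_value (frac_value M c x v (\<sigma> ()))) V"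
  note pos = frac_value_pos[OF M c xc v]
  have U: "?h UNIV \<sigma> = point_value (frac_value M c x v (\<sigma> ()))"
    if "\<sigma> () \<in> carrier (basic_stalk M x)" for \<sigma>
    using that by (simp add: inverse_image_point_simps restrict_UNIV)
  have E: "?h {} (\<lambda>_. undefined) = (\<lambda>_. undefined)"
    by (simp add: inverse_image_point_simps) (simp add: restrict_def)
  have mor: "presheaf_morphism ?I (gp_sheaf point_sheaf) ?h"
    unfolding presheaf_morphism_def inverse_image_point_simps(5)
  proof (intro conjI allI impI; (elim conjE)?)
    fix V :: "unit set"
    consider "V = {}" | "V = UNIV" using unit_set_cases by blast
    then show "?h V \<in> hom (sections ?I V) (sections (gp_sheaf point_sheaf) V)"
    proof cases
      case 1
      show ?thesis
        unfolding 1
      proof (rule homI)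
        fix \<sigma> \<tau> assume "\<sigma> \<in> carrier (sections ?I {})"
        then have s: "\<sigma> = (\<lambda>_. undefined)" by (simp add: inverse_image_point_simps)
        show "?h {} \<sigma> \<in> carrier (sections (gp_sheaf point_sheaf) {})"
          unfolding s E by (simp add: sections_gp_point)
        assume "\<tau> \<in> carrier (sections ?I {})"
        then have t: "\<tau> = (\<lambda>_. undefined)" by (simp add: inverse_image_point_simps)
        show "?h {} (\<sigma> \<otimes>\<^bsub>sections ?I {}\<^esub> \<tau>) =
            ?h {} \<sigma> \<otimes>\<^bsub>sections (gp_sheaf point_sheaf) {}\<^esub> ?h {} \<tau>"
          unfolding s t sections_empty_mult E by (simp add: gp_sheaf_def sheafification_def sections_empty_mult)
      qed
    next
      case 2
      have "comm_monoid (basic_stalk M x)"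
        using x by (intro stalk_comm_monoid gp_sheaf_monoid[OF basic_presheaf_monoid[OF M]]) (simp add: base_gp_basic)
      then have cl: "p \<otimes>\<^bsub>basic_stalk M x\<^esub> q \<in> carrier (basic_stalk M x)"
        if "p \<in> carrier (basic_stalk M x)" "q \<in> carrier (basic_stalk M x)" for p q
        using that by (simp add: comm_monoid.axioms(1) monoid.m_closed)
      show ?thesis
        unfolding 2
      proof (rule homI)
        fix \<sigma> assume "\<sigma> \<in> carrier (sections ?I UNIV)"
        then have s: "\<sigma> () \<in> carrier (basic_stalk M x)"
          by (simp add: inverse_image_point_simps)
        show "?h UNIV \<sigma> \<in> carrier (sections (gp_sheaf point_sheaf) UNIV)"
          unfolding U[of \<sigma>, OF s] by (rule point_value_closed[OF pos[OF s]])
        fix \<tau> assume "\<tau> \<in> carrier (sections ?I UNIV)"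
        then have t: "\<tau> () \<in> carrier (basic_stalk M x)"
          by (simp add: inverse_image_point_simps)
        have st: "(\<sigma> \<otimes>\<^bsub>sections ?I UNIV\<^esub> \<tau>) () = \<sigma> () \<otimes>\<^bsub>basic_stalk M x\<^esub> \<tau> ()"
          by (simp add: inverse_image_point_simps)
        show "?h UNIV (\<sigma> \<otimes>\<^bsub>sections ?I UNIV\<^esub> \<tau>) =
            ?h UNIV \<sigma> \<otimes>\<^bsub>sections (gp_sheaf point_sheaf) UNIV\<^esub> ?h UNIV \<tau>"
          unfolding U[of \<sigma>, OF s] U[of \<tau>, OF t] point_value_mult[OF pos[OF s] pos[OF t]]
          using U[of "\<sigma> \<otimes>\<^bsub>sections ?I UNIV\<^esub> \<tau>", unfolded st, OF cl[OF s t]]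
          unfolding frac_value_mult[OF M c xc v s t] .
      qed
    qed
  next
    fix V :: "unit set"
    consider "V = {}" | "V = UNIV" using unit_set_cases by blast
    then show "?h V \<one>\<^bsub>sections ?I V\<^esub> = \<one>\<^bsub>sections (gp_sheaf point_sheaf) V\<^esub>"
    proof cases
      case 1
      show ?thesis unfolding 1 sections_empty_mult E
        by (simp add: gp_sheaf_def sheafification_def sections_empty_mult)
    next
      case 2
      have "\<one>\<^bsub>basic_stalk M x\<^esub> \<in> carrier (basic_stalk M x)"
        using x by (intro monoid.one_closed comm_monoid.axioms(1) stalk_comm_monoid
            gp_sheaf_monoid[OF basic_presheaf_monoid[OF M]]) (simp add: base_gp_basic)
      then show ?thesis
        unfolding 2 point_value_one inverse_image_point_simps(4)
        using U[of "\<lambda>_. \<one>\<^bsub>basic_stalk M x\<^esub>"] unfolding frac_value_one[OF M c xc v] by blast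
    qed
  next
    fix U V :: "unit set" and \<sigma> assume s: "\<sigma> \<in> carrier (sections ?I U)" and VU: "V \<subseteq> U"
    have R: "restr (gp_sheaf point_sheaf) U V \<tau> = restrict \<tau> V" for \<tau>
      by (simp add: gp_sheaf_def sheafification_def inverse_image_def)
    consider "V = {}" | "V = UNIV" "U = UNIV" using unit_set_cases VU by blast
    then show "?h V (restr ?I U V \<sigma>) = restr (gp_sheaf point_sheaf) U V (?h U \<sigma>)"
    proof cases
      case 1
      have a: "restr ?I U V \<sigma> = (\<lambda>_. undefined)"
        unfolding 1 inverse_image_point_simps(6) by (simp add: restrict_def)
      have b: "restr (gp_sheaf point_sheaf) U V (?h U \<sigma>) = (\<lambda>_. undefined)"
        unfolding 1 R[unfolded 1] by (simp add: restrict_def)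
      show ?thesis unfolding a b unfolding 1 by (rule E)
    next
      case 2
      then show ?thesis unfolding R inverse_image_point_simps(6) by (simp only: restrict_UNIV)
    qed
  qed
  have cond: "?h V (pulled_back_section (gp_sheaf (basic_presheaf M)) (\<lambda>_. x) W
        (to_gp (basic_presheaf M) W (of_pos (basic_log M) W f)) V) =
      to_gp point_sheaf V (of_pos point_log V (\<lambda>_\<in>V. f x))"
    if W: "openin (points M) W" "(\<lambda>_. x) ` V \<subseteq> W" and f: "f \<in> pos_functions M W" for V :: "unit set" and W f
  proof -
    consider "V = {}" | "V = UNIV" using unit_set_cases by blast
    then show ?thesis
    proof cases
      case 1
      have pb: "pulled_back_section (gp_sheaf (basic_presheaf M)) (\<lambda>_. x) W
          (to_gp (basic_presheaf M) W (of_pos (basic_log M) W f)) {} = (\<lambda>_. undefined)"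
        by (simp add: pulled_back_section_def restrict_def)
      show ?thesis unfolding 1 pb E by (simp add: to_gp_def restrict_def)
    next
      case 2
      have xW: "x \<in> W" using W(2) 2 by auto
      have fx: "0 < f x" using f xW by (simp add: pos_functions_def)
      have fb: "f \<in> basic_sections M W" using f pos_functions_subset_basic[OF M W(1)] by blast
      note ob = basic_sections_one[OF M W(1)]
      have cl: "basic_frac M x W f (\<lambda>y\<in>W. 1) \<in> carrier (basic_stalk M x)"
        using W(1) xW fb ob by (intro frac_germ_closed[OF basic_presheaf_monoid[OF M]]) simp_all
      have val: "frac_value M c x v (basic_frac M x W f (\<lambda>y\<in>W. 1)) = f x"
        using basepoint_value_pos_function[OF M c xc v f W(1) xW] basepoint_value_one[OF M c xc v W(1) xW]
        by (simp add: frac_value_frac_germ[OF M c xc v W(1) xW fb ob])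
      have tg: "to_gp point_sheaf UNIV (\<lambda>_. f x) = point_value (f x)"
        by (simp add: point_value_def log_sheaf_point)
      show ?thesis
        using U[of "\<lambda>_. basic_frac M x W f (\<lambda>y\<in>W. 1)", OF cl]
        unfolding 2 of_pos_basic[OF W(1) f] pulled_back_to_gp restrict_UNIV of_pos_point[OF fx] val tg .
    qed
  qed
  show ?thesis
    unfolding virtual_morphisms_def Let_def basepoint_morphism_def log_sheaf_basic log_sheaf_point
    using const_smooth_map[OF x] mor cond
    by (simp add: basic_log_def[of M] trivial_log_def extensional_def)
qed

text \<open>A virtual morphism is determined by its values on the coordinates that vanish at \<open>x\<close>: the
  values on positive functions are prescribed, and near \<open>x\<close> every basic section is a positive function
  times a monomial in the coordinates.\<close>

lemma virtual_morphism_unique: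
  assumes h: "(\<lambda>_. x, h) \<in> virtual_morphisms point_log (basic_log M)"
    and c: "c \<in> atlas M" and xc: "x \<in> cdom c" and v: "\<forall>i\<in>zero_coords c x. 0 < v i"
    and hv: "\<And>i. i \<in> zero_coords c x \<Longrightarrow> h UNIV (pulled_back_coord M (\<lambda>_. x) c i) = point_value (v i)"
  shows "(\<lambda>_. x, h) = basepoint_morphism M c x v"
proof -
  let ?B = "basic_presheaf M"
  let ?G = "gp_sheaf ?B"
  let ?I = "inverse_image (discrete_topology UNIV) (\<lambda>_ :: unit. x) ?G"
  let ?T = "sections (gp_sheaf point_sheaf) UNIV"
  have hext: "h V \<in> extensional (carrier (sections ?I V))" for V
    using h unfolding virtual_morphisms_def Let_def by (simp add: basic_log_def trivial_log_def)
  have mor: "presheaf_morphism ?I (gp_sheaf point_sheaf) h"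
    using h unfolding virtual_morphisms_def Let_def by (simp add: basic_log_def trivial_log_def)
  have hpos: "h UNIV (\<lambda>_. frac_germ ?B x W f (\<lambda>y\<in>W. 1)) = point_value (f x)"
    if W: "openin (points M) W" "x \<in> W" and f: "f \<in> pos_functions M W" for W f
  proof -
    have "0 < f x" using f W(2) by (simp add: pos_functions_def)
    have "h UNIV (pulled_back_section ?G (\<lambda>_. x) W (to_gp ?B W (of_pos (basic_log M) W f)) UNIV) =
        to_gp point_sheaf UNIV (of_pos point_log UNIV (\<lambda>_\<in>UNIV. f x))"
      using h W f unfolding virtual_morphisms_def Let_def log_sheaf_basic log_sheaf_point
      by (simp add: basic_log_def[of M] trivial_log_def[of point_manifold])
    then show ?thesis
      unfolding of_pos_basic[OF W(1) f] pulled_back_to_gp restrict_UNIV of_pos_point[OF \<open>0 < f x\<close>]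
      by (simp add: point_value_def log_sheaf_point)
  qed
  have hhom: "h V \<in> hom (sections ?I V) (sections (gp_sheaf point_sheaf) V) \<and>
      h V \<one>\<^bsub>sections ?I V\<^esub> = \<one>\<^bsub>sections (gp_sheaf point_sheaf) V\<^esub>" for V
    using mor[unfolded presheaf_morphism_def inverse_image_point_simps(5), THEN conjunct1, rule_format, of V]
    by simp
  have h1: "h UNIV (\<lambda>_. \<one>\<^bsub>stalk ?G x\<^esub>) = point_value 1"
    using hhom[of UNIV] unfolding inverse_image_point_simps(4) point_value_one by (rule conjunct2)
  note hhom = hhom[THEN conjunct1]
  \<comment> \<open>By the identification of sections over the point with positive reals,
    \<open>h\<close> over \<open>UNIV\<close> becomes a positive function on the stalk, and
    multiplicativity can be used for real numbers.\<close>
  define r where "r p = (SOME a. 0 < a \<and> h UNIV (\<lambda>_. p) = point_value a)" for p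
  have r: "0 < r p \<and> h UNIV (\<lambda>_. p) = point_value (r p)" if p: "p \<in> carrier (stalk ?G x)" for p
  proof -
    have "(\<lambda>_. p) \<in> carrier (sections ?I UNIV)" using p by (simp add: inverse_image_point_simps)
    from hom_in_carrier[OF hhom this]
    have "\<exists>a. 0 < a \<and> h UNIV (\<lambda>_. p) = point_value a" by (rule point_value_surj) blast
    then show ?thesis unfolding r_def by (rule someI_ex)
  qed
  have r_eq: "r p = a" if "p \<in> carrier (stalk ?G x)" "0 < a" "h UNIV (\<lambda>_. p) = point_value a" for p a
    using point_value_inject[of "r p" a] r[OF that(1)] that(2,3) by simp
  have st: "comm_monoid (stalk ?G x)"
    using x by (intro stalk_comm_monoid gp_sheaf_monoid[OF basic_presheaf_monoid[OF M]]) (simp add: base_gp_basic)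
  have r_mult: "r (p \<otimes>\<^bsub>stalk ?G x\<^esub> q) = r p * r q"
    if p: "p \<in> carrier (stalk ?G x)" and q: "q \<in> carrier (stalk ?G x)" for p q
  proof (rule r_eq)
    show "p \<otimes>\<^bsub>stalk ?G x\<^esub> q \<in> carrier (stalk ?G x)"
      using st p q by (simp add: comm_monoid.axioms(1) monoid.m_closed)
    show "0 < r p * r q" using r p q by simp
    have "h UNIV ((\<lambda>_. p) \<otimes>\<^bsub>sections ?I UNIV\<^esub> (\<lambda>_. q)) = h UNIV (\<lambda>_. p) \<otimes>\<^bsub>?T\<^esub> h UNIV (\<lambda>_. q)"
      by (rule hom_mult[OF hhom]) (use p q in \<open>simp_all add: inverse_image_point_simps\<close>)
    also have "\<dots> = point_value (r p * r q)"
      using r[OF p] r[OF q] point_value_mult[of "r p" "r q"] by simp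
    finally show "h UNIV (\<lambda>_. p \<otimes>\<^bsub>stalk ?G x\<^esub> q) = point_value (r p * r q)"
      unfolding inverse_image_point_simps(3) .
  qed
  have r_one: "r \<one>\<^bsub>stalk ?G x\<^esub> = 1"
    using st h1 by (intro r_eq) (simp_all add: comm_monoid.axioms(1) monoid.one_closed)
  \<comment> \<open>The value on a section \<open>a\<close>, seen as the fraction with denominator
    1.\<close>
  define s where "s U a = r (frac_germ ?B x U a (\<lambda>y\<in>U. 1))" for U a
  have cl: "frac_germ ?B x U a b \<in> carrier (stalk ?G x)"
    if "openin (points M) U" "x \<in> U" "a \<in> basic_sections M U" "b \<in> basic_sections M U" for U a b
    using that by (intro frac_germ_closed[OF basic_presheaf_monoid[OF M]]) simp_all
  have s_pos: "s U f = f x" if U: "openin (points M) U" "x \<in> U" and f: "f \<in> pos_functions M U" for U f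
    unfolding s_def
  proof (rule r_eq[OF cl[OF U _ basic_sections_one[OF M U(1)]] _ hpos[OF U f]])
    show "f \<in> basic_sections M U" using f pos_functions_subset_basic[OF M U(1)] by blast
    show "0 < f x" using f U(2) by (simp add: pos_functions_def)
  qed
  have s_restrict: "s U a = s V (restrict a V)"
    if U: "openin (points M) U" "a \<in> basic_sections M U" and V: "openin (points M) V" "x \<in> V" "V \<subseteq> U" for U V a
  proof -
    have "restrict (\<lambda>y\<in>U. 1 :: real) V = (\<lambda>y\<in>V. 1)" using V(3) by (auto simp: fun_eq_iff)
    with basic_frac_restrict[OF M U(1) V(2) U(2) basic_sections_one[OF M U(1)] V(1,3)]
    show ?thesis unfolding s_def by simp
  qed
  have s_mult: "s U (\<lambda>y\<in>U. a y * b y) = s U a * s U b"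
    if U: "openin (points M) U" "x \<in> U" and ab: "a \<in> basic_sections M U" "b \<in> basic_sections M U" for U a b
  proof -
    note o = basic_sections_one[OF M U(1)]
    have "(\<lambda>y\<in>U. (\<lambda>y\<in>U. 1) y * (\<lambda>y\<in>U. 1) y) = (\<lambda>y\<in>U. 1 :: real)" by (auto simp: fun_eq_iff)
    with basic_frac_mult[OF M U ab(1) o ab(2) o] r_mult[OF cl[OF U ab(1) o] cl[OF U ab(2) o]]
    show ?thesis unfolding s_def by simp
  qed
  have s_one: "s U (\<lambda>y\<in>U. 1) = 1" if U: "openin (points M) U" "x \<in> U" for U
    unfolding s_def basic_frac_one[OF M U, symmetric] by (rule r_one)
  have s_coord: "s (cdom c) (\<lambda>y\<in>cdom c. coord c y i) = basepoint_coord c x v i" if i: "i < cdim c" for i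
  proof (cases "i \<in> zero_coords c x")
    case True
    have "s (cdom c) (\<lambda>y\<in>cdom c. coord c y i) = v i"
      unfolding s_def
      using hv[OF True] v True
      by (intro r_eq cl chart_facts(1)[OF M c] xc coord_basic_section[OF M c i]
          basic_sections_one[OF M chart_facts(1)[OF M c]]) (auto simp: pulled_back_coord_eq)
    then show ?thesis using True by (simp add: basepoint_coord_def)
  next
    case False
    \<comment> \<open>A coordinate that does not vanish at \<open>x\<close> is a positive function
      on this neighbourhood, so its value is already prescribed.\<close>
    define V where "V = {y \<in> cdom c. coord c y \<in> topspace (Euclidean_space (cdim c)) \<inter> (\<lambda>p. p i) -` {0<..}}"
    have V: "openin (points M) V"
      unfolding V_def by (intro chart_open_preimage[OF M c] openin_Euclidean_preimage)
        (auto intro: continuous_on_subset[OF continuous_on_product_coordinates])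
    have "0 < coord c x i"
      using False i chart_nonneg[OF M c xc i] by (simp add: zero_coords_def less_le)
    then have xV: "x \<in> V" "V \<subseteq> cdom c" using xc chart_Euclidean[OF M c xc] by (auto simp: V_def)
    have "(\<lambda>y\<in>V. coord c y i) \<in> pos_functions M V"
      using coord_smooth[OF M c V xV(2) i] by (auto simp: pos_functions_def V_def)
    moreover have "restrict (\<lambda>y\<in>cdom c. coord c y i) V = (\<lambda>y\<in>V. coord c y i)"
      using xV(2) by (auto simp: fun_eq_iff)
    ultimately show ?thesis
      using s_restrict[OF chart_facts(1)[OF M c] coord_basic_section[OF M c i] V xV] s_pos[OF V xV(1)] False xV(1)
      by (simp add: basepoint_coord_def)
  qed
  \<comment> \<open>Membership and value are proved together, because multiplicativity of
    \<open>s\<close> is available only for basic sections.\<close>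
  have s_monomial: "(\<lambda>y\<in>V. \<Prod>i\<in>I. coord c y i ^ j i) \<in> basic_sections M V \<and>
      s V (\<lambda>y\<in>V. \<Prod>i\<in>I. coord c y i ^ j i) = (\<Prod>i\<in>I. basepoint_coord c x v i ^ j i)"
    if V: "openin (points M) V" "x \<in> V" "V \<subseteq> cdom c" and I: "I \<subseteq> {..<cdim c}" for V I and j :: "nat \<Rightarrow> nat"
  proof -
    have coordV: "(\<lambda>y\<in>V. coord c y i) \<in> basic_sections M V \<and> s V (\<lambda>y\<in>V. coord c y i) = basepoint_coord c x v i"
      if i: "i < cdim c" for i
    proof -
      have "restrict (\<lambda>y\<in>cdom c. coord c y i) V = (\<lambda>y\<in>V. coord c y i)"
        using V(3) by (auto simp: fun_eq_iff)
      then show ?thesis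
        using s_restrict[OF chart_facts(1)[OF M c] coord_basic_section[OF M c i] V]
          basic_sections_restrict[OF M chart_facts(1)[OF M c] V(1,3) coord_basic_section[OF M c i]] s_coord[OF i]
        by simp
    qed
    have pow: "(\<lambda>y\<in>V. coord c y i ^ k) \<in> basic_sections M V \<and> s V (\<lambda>y\<in>V. coord c y i ^ k) = basepoint_coord c x v i ^ k"
      if i: "i < cdim c" for i k
    proof -
      define P where "P k = (\<lambda>y\<in>V. coord c y i ^ k)" for k
      have P0: "P 0 = (\<lambda>y\<in>V. 1)" and PS: "P (Suc k) = (\<lambda>y\<in>V. (\<lambda>y\<in>V. coord c y i) y * P k y)" for k
        by (auto simp: P_def fun_eq_iff)
      have "P k \<in> basic_sections M V \<and> s V (P k) = basepoint_coord c x v i ^ k"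
      proof (induction k)
        case 0
        show ?case unfolding P0 power_0 by (intro conjI basic_sections_one[OF M V(1)] s_one[OF V(1,2)])
      next
        case (Suc k)
        show ?case
          unfolding PS
          using s_mult[OF V(1,2) conjunct1[OF coordV[OF i]] conjunct1[OF Suc]]
            basic_sections_mult[OF M V(1) conjunct1[OF coordV[OF i]] conjunct1[OF Suc]] coordV[OF i] Suc
          by (simp only: power_Suc simp_thms)
      qed
      then show ?thesis by (simp only: P_def)
    qed
    define Q where "Q I = (\<lambda>y\<in>V. \<Prod>i\<in>I. coord c y i ^ j i)" for I
    have Q0: "Q {} = (\<lambda>y\<in>V. 1)"
      and Qi: "finite I \<Longrightarrow> i \<notin> I \<Longrightarrow> Q (insert i I) = (\<lambda>y\<in>V. (\<lambda>y\<in>V. coord c y i ^ j i) y * Q I y)" for I i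
      by (auto simp: Q_def fun_eq_iff)
    have "finite I" using I finite_subset by blast
    then have "Q I \<in> basic_sections M V \<and> s V (Q I) = (\<Prod>i\<in>I. basepoint_coord c x v i ^ j i)" using I
    proof induction
      case empty
      show ?case unfolding Q0 prod.empty by (intro conjI basic_sections_one[OF M V(1)] s_one[OF V(1,2)])
    next
      case (insert i I)
      have i: "i < cdim c" and IH: "Q I \<in> basic_sections M V \<and> s V (Q I) = (\<Prod>i\<in>I. basepoint_coord c x v i ^ j i)"
        using insert by auto
      show ?case
        unfolding Qi[OF insert(1,2)] prod.insert[OF insert(1,2)]
        using s_mult[OF V(1,2) conjunct1[OF pow[OF i]] conjunct1[OF IH], of "j i"]
          basic_sections_mult[OF M V(1) conjunct1[OF pow[OF i]] conjunct1[OF IH], of "j i"] pow[OF i, of "j i"] IH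
        by (simp only: simp_thms)
    qed
    then show ?thesis by (simp only: Q_def)
  qed
  have s_basic: "s U a = basepoint_value c x v a"
    if U: "openin (points M) U" "x \<in> U" and a: "a \<in> basic_sections M U" for U a
  proof -
    obtain V g j where V: "openin (points M) V" "x \<in> V" "V \<subseteq> U" "V \<subseteq> cdom c" and g: "g \<in> pos_functions M V"
      and ag: "\<And>y. y \<in> V \<Longrightarrow> a y = g y * (\<Prod>i<cdim c. coord c y i ^ (j i :: nat))"
      by (rule basic_section_monomial[OF M c xc v a U(2)]) blast
    have "restrict a V = (\<lambda>y\<in>V. g y * (\<lambda>y\<in>V. \<Prod>i<cdim c. coord c y i ^ j i) y)"
      using ag by (auto simp: fun_eq_iff)
    moreover have "g \<in> basic_sections M V" using g pos_functions_subset_basic[OF M V(1)] by blast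
    ultimately have "s V (restrict a V) = g x * (\<Prod>i<cdim c. basepoint_coord c x v i ^ j i)"
      using s_mult[OF V(1,2), of g "\<lambda>y\<in>V. \<Prod>i<cdim c. coord c y i ^ j i"] s_monomial[OF V(1,2,4), of "{..<cdim c}" j]
        s_pos[OF V(1,2) g] by simp
    then show ?thesis
      using s_restrict[OF U(1) a V(1-3)] basepoint_value_monomial[OF M c xc v V(1,2) g, of a j, OF ag] by simp
  qed
  have r_frac: "r p = frac_value M c x v p" if p: "p \<in> carrier (stalk ?G x)" for p
  proof -
    obtain U a b where U: "openin (points M) U" "x \<in> U" and ab: "a \<in> basic_sections M U" "b \<in> basic_sections M U"
      and pf: "p = frac_germ ?B x U a b"
      by (rule basic_frac_cases2[OF M p p]) blast
    note o = basic_sections_one[OF M U(1)]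
    note m = basic_sections_mult[OF M U(1)]
    \<comment> \<open>Multiplying \<open>a / b\<close> by \<open>b / 1\<close> gives
      \<open>a / 1\<close>, so the values of \<open>s\<close> determine \<open>r\<close> on all
      fractions.\<close>
    have "frac_germ ?B x U a b \<otimes>\<^bsub>stalk ?G x\<^esub> frac_germ ?B x U b (\<lambda>y\<in>U. 1) = frac_germ ?B x U a (\<lambda>y\<in>U. 1)"
      unfolding basic_frac_mult[OF M U ab ab(2) o] basic_frac_eq_iff[OF M U m[OF ab] m[OF ab(2) o] U ab(1) o]
      using U o by (intro exI[of _ U] conjI bexI[of _ "\<lambda>y\<in>U. 1"]) auto
    then have "r p * s U b = s U a"
      using r_mult[OF p cl[OF U ab(2) o]] by (simp add: s_def pf)
    then show ?thesis
      using basepoint_value_pos[OF M c xc v ab(2) U(2)]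
      by (simp add: pf frac_value_frac_germ[OF M c xc v U ab] s_basic[OF U ab(1)] s_basic[OF U ab(2)] eq_divide_eq)
  qed
  have "h V = (\<lambda>\<sigma>\<in>carrier (sections ?I V). restrict (point_value (frac_value M c x v (\<sigma> ()))) V)" for V
  proof (rule extensionalityI[OF hext restrict_extensional])
    fix \<sigma> assume s: "\<sigma> \<in> carrier (sections ?I V)"
    consider "V = {}" | "V = UNIV" using unit_set_cases by blast
    then have "h V \<sigma> = restrict (point_value (frac_value M c x v (\<sigma> ()))) V"
    proof cases
      case 1
      have "h {} \<sigma> \<in> carrier (sections (gp_sheaf point_sheaf) {})"
        using hom_in_carrier[OF hhom s] unfolding 1 .
      then show ?thesis unfolding 1 by (simp add: sections_gp_point) (simp add: restrict_def)
    next
      case 2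
      have "\<sigma> () \<in> carrier (stalk ?G x)" using s by (simp add: 2 inverse_image_point_simps)
      from r[OF this] r_frac[OF this] have "h UNIV (\<lambda>_. \<sigma> ()) = point_value (frac_value M c x v (\<sigma> ()))" by simp
      then show ?thesis by (simp add: 2 restrict_UNIV)
    qed
    then show "h V \<sigma> = (\<lambda>\<sigma>\<in>carrier (sections ?I V). restrict (point_value (frac_value M c x v (\<sigma> ()))) V) \<sigma>"
      using s by simp
  qed
  then show ?thesis unfolding basepoint_morphism_def by blast
qed

text \<open>The chart \<open>e\<close> may differ from the chart \<open>c\<close> in which
  \<open>v\<close> is given, so morphisms built from different charts can be evaluated on the same
  coordinates.\<close>

lemma basepoint_morphism_coord:
  assumes c: "c \<in> atlas M" "x \<in> cdom c" and v: "\<forall>i\<in>zero_coords c x. 0 < v i"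
    and e: "e \<in> atlas M" "x \<in> cdom e" and i: "i < cdim e"
  shows "snd (basepoint_morphism M c x v) UNIV (pulled_back_coord M (\<lambda>_. x) e i) =
      point_value (basepoint_value c x v (coord_fun e i))"
    "0 < basepoint_value c x v (coord_fun e i)"
proof -
  note U = chart_facts(1)[OF M e(1)] e(2)
  note b = coord_basic_section[OF M e(1) i] and o = basic_sections_one[OF M U(1)]
  have cl: "basic_frac M x (cdom e) (\<lambda>y\<in>cdom e. coord e y i) (\<lambda>y\<in>cdom e. 1)
      \<in> carrier (basic_stalk M x)"
    using U b o by (intro frac_germ_closed[OF basic_presheaf_monoid[OF M]]) simp_all
  have val: "basepoint_value c x v (coord_fun e i) = basepoint_value c x v (\<lambda>y\<in>cdom e. coord e y i)"
    by (rule basepoint_value_cong[OF M c v b U(2) U]) (simp add: coord_fun_def)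
  then show "0 < basepoint_value c x v (coord_fun e i)"
    using basepoint_value_pos[OF M c v b U(2)] by simp
  show "snd (basepoint_morphism M c x v) UNIV (pulled_back_coord M (\<lambda>_. x) e i) =
      point_value (basepoint_value c x v (coord_fun e i))"
    using cl
    by (simp add: basepoint_morphism_def pulled_back_coord_eq inverse_image_point_simps restrict_UNIV val
        frac_value_frac_germ[OF M c v U b o] basepoint_value_one[OF M c v U])
qed

text \<open>Both equalities amount to equal values on the vanishing coordinates of charts at
  \<open>x\<close>. Equal normal vectors give the morphism of \<open>(d, w)\<close> the values
  \<open>v\<close> on the coordinates of \<open>c\<close>, which determine it; equal morphisms give
  tangent vectors that agree in every chart. One direction makes the bijection well defined, the
  other makes it injective.\<close>

lemma normal_vector_eq_iff_morphism_eq: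
  assumes c: "c \<in> atlas M" "x \<in> cdom c" and v: "\<forall>i\<in>zero_coords c x. 0 < v i"
    and d: "d \<in> atlas M" "x \<in> cdom d" and w: "\<forall>i\<in>zero_coords d x. 0 < w i"
  shows "normal_vector M c x v = normal_vector M d x w \<longleftrightarrow> basepoint_morphism M c x v = basepoint_morphism M d x w"
proof -
  note iff = normal_class_eq_iff[OF M coord_tangent_closed[OF M c] coord_tangent_closed[OF M d], of v w,
      folded normal_vector_eq]
  show ?thesis
  proof
    assume eq: "normal_vector M c x v = normal_vector M d x w"
    have "basepoint_morphism M d x w = basepoint_morphism M c x v"
    proof -
      have fst: "basepoint_morphism M d x w = (\<lambda>_. x, snd (basepoint_morphism M d x w))"
        by (simp add: basepoint_morphism_def)
      have "(\<lambda>_. x, snd (basepoint_morphism M d x w)) = basepoint_morphism M c x v"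
      proof (rule virtual_morphism_unique[OF _ c v])
        show "(\<lambda>_. x, snd (basepoint_morphism M d x w)) \<in> virtual_morphisms point_log (basic_log M)"
          using basepoint_morphism_closed[OF d w] fst by simp
        fix i assume i: "i \<in> zero_coords c x"
        have "coord_tangent M d x w (coord_fun c i) = v i"
          using eq i c coord_tangent_coord[OF M c i, of v] unfolding iff by metis
        then show "snd (basepoint_morphism M d x w) UNIV (pulled_back_coord M (\<lambda>_. x) c i) = point_value (v i)"
          using basepoint_morphism_coord(1)[OF d w c zero_coordsD(1)[OF i]]
            basepoint_value_eq_coord_tangent[OF M d w c i] by simp
      qed
      then show ?thesis using fst by simp
    qed
    then show "basepoint_morphism M c x v = basepoint_morphism M d x w" ..
  next
    assume eq: "basepoint_morphism M c x v = basepoint_morphism M d x w"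
    show "normal_vector M c x v = normal_vector M d x w"
      unfolding iff
    proof (intro ballI impI)
      fix e i assume e: "e \<in> atlas M" "x \<in> cdom e" and i: "i \<in> zero_coords e x"
      note ei = e zero_coordsD(1)[OF i]
      have "basepoint_value c x v (coord_fun e i) = basepoint_value d x w (coord_fun e i)"
        using basepoint_morphism_coord[OF c v ei] basepoint_morphism_coord[OF d w ei] eq
        by (intro point_value_inject) simp_all
      then show "coord_tangent M c x v (coord_fun e i) = coord_tangent M d x w (coord_fun e i)"
        using basepoint_value_eq_coord_tangent[OF M c v e i] basepoint_value_eq_coord_tangent[OF M d w e i]
        by simp
    qed
  qed
qed

end

text \<open>The components \<open>v\<close> are read off from \<open>h\<close> on the coordinates of
  a chart at \<open>x\<close>. They are positive because the group completed sheaf of the point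
  consists of positive reals.\<close>

lemma virtual_morphism_cases:
  assumes "(\<phi>, h) \<in> virtual_morphisms point_log (basic_log M)"
  obtains x c v where "\<phi> = (\<lambda>_. x)" "x \<in> topspace (points M)" "c \<in> atlas M" "x \<in> cdom c"
    "\<forall>i\<in>zero_coords c x. 0 < v i" "(\<phi>, h) = basepoint_morphism M c x v"
proof -
  define x where "x = \<phi> ()"
  have \<phi>: "\<phi> = (\<lambda>_. x)" by (auto simp: x_def fun_eq_iff)
  have "continuous_map (discrete_topology UNIV) (points M) \<phi>"
    using assms unfolding virtual_morphisms_def Let_def smooth_maps_def
    by (simp add: basic_log_def trivial_log_def)
  then have x: "x \<in> topspace (points M)" unfolding x_def by (auto simp: continuous_map_def)
  obtain c where c: "c \<in> atlas M" "x \<in> cdom c" using atlas_covers[OF M x] by blast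
  have mor: "presheaf_morphism (basic_pullback M x)
      (gp_sheaf point_sheaf) h"
    using assms unfolding virtual_morphisms_def Let_def \<phi> by (simp add: basic_log_def trivial_log_def)
  then have hhom: "h UNIV \<in> hom (sections (basic_pullback M x) UNIV) (sections (gp_sheaf point_sheaf) UNIV)"
    unfolding presheaf_morphism_def inverse_image_point_simps(5)[OF x] openin_discrete_topology by blast
  have "\<exists>a. 0 < a \<and> h UNIV (pulled_back_coord M (\<lambda>_. x) c i) = point_value a" if i: "i < cdim c" for i
  proof -
    note U = chart_facts(1)[OF M c(1)] c(2)
    have "basic_frac M x (cdom c) (\<lambda>y\<in>cdom c. coord c y i) (\<lambda>y\<in>cdom c. 1)
        \<in> carrier (basic_stalk M x)"
      using U coord_basic_section[OF M c(1) i] basic_sections_one[OF M U(1)]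
      by (intro frac_germ_closed[OF basic_presheaf_monoid[OF M]]) simp_all
    then have "pulled_back_coord M (\<lambda>_. x) c i \<in> carrier (sections (basic_pullback M x) UNIV)"
      by (simp add: pulled_back_coord_eq inverse_image_point_simps[OF x])
    from hom_in_carrier[OF hhom this] show ?thesis by (rule point_value_surj) blast
  qed
  then obtain v where v: "\<And>i. i < cdim c \<Longrightarrow> 0 < v i \<and> h UNIV (pulled_back_coord M (\<lambda>_. x) c i) = point_value (v i)"
    by metis
  then have pos: "\<forall>i\<in>zero_coords c x. 0 < v i" by (simp add: zero_coords_def)
  have "(\<lambda>_. x, h) = basepoint_morphism M c x v"
    by (rule virtual_morphism_unique[OF x assms[unfolded \<phi>] c pos]) (simp add: v zero_coords_def)
  with that[OF \<phi> x c pos] show thesis unfolding \<phi> by simp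
qed

end

theorem proposition1p2:
  fixes M :: "'a corners"
  assumes "manifold_with_corners M"
  shows "\<exists>\<Phi>. bij_betw \<Phi> (tangential_basepoints M) (virtual_morphisms point_log (basic_log M)) \<and>
    (\<forall>c\<in>atlas M. \<forall>x\<in>cdom c. \<forall>v. (\<forall>i\<in>zero_coords c x. 0 < v i) \<longrightarrow>
       (case \<Phi> (x, normal_vector M c x v) of (\<phi>, h) \<Rightarrow>
          \<phi> () = x \<and>
          (\<forall>i<cdim c. h UNIV (pulled_back_coord M \<phi> c i) =
             point_value (if i \<in> zero_coords c x then v i else coord c x i))))"
proof -
  note M = assms
  define good where "good x c v \<longleftrightarrow> c \<in> atlas M \<and> x \<in> cdom c \<and> (\<forall>i\<in>zero_coords c x. 0 < v i)"
    for x c and v :: "nat \<Rightarrow> real"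
  have top: "x \<in> topspace (points M)" if "good x c v" for x c v
    using that openin_subset[OF chart_facts(1)[OF M]] unfolding good_def by blast
  \<comment> \<open>A basepoint is presented by a chart and components, and any such choice may be
    taken: presentations of the same normal vector give the same morphism.\<close>
  define \<Phi> where "\<Phi> = (\<lambda>(x, N). SOME m. \<exists>c v. good x c v \<and> N = normal_vector M c x v \<and>
      m = basepoint_morphism M c x v)"
  have \<Phi>: "\<Phi> (x, normal_vector M c x v) = basepoint_morphism M c x v" if g: "good x c v" for x c v
    unfolding \<Phi>_def prod.case
  proof (rule some_equality)
    show "\<exists>c' v'. good x c' v' \<and> normal_vector M c x v = normal_vector M c' x v' \<and>
      basepoint_morphism M c x v = basepoint_morphism M c' x v'"
      using g by blast
    fix m assume "\<exists>c' v'. good x c' v' \<and> normal_vector M c x v = normal_vector M c' x v' \<and>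
      m = basepoint_morphism M c' x v'"
    then show "m = basepoint_morphism M c x v"
      using normal_vector_eq_iff_morphism_eq[OF M top[OF g]] g unfolding good_def by metis
  qed
  have basepointE: "\<exists>x c v. b = (x, normal_vector M c x v) \<and> good x c v"
    if "b \<in> tangential_basepoints M" for b
    using that unfolding tangential_basepoints_def positive_normal_space_def good_def by blast
  have basepointI: "(x, normal_vector M c x v) \<in> tangential_basepoints M" if g: "good x c v" for x c v
    using top[OF g] normal_vector_in_positive[OF M] g unfolding tangential_basepoints_def good_def by blast
  have bij: "bij_betw \<Phi> (tangential_basepoints M) (virtual_morphisms point_log (basic_log M))"
    unfolding bij_betw_def
  proof
    show "inj_on \<Phi> (tangential_basepoints M)"
    proof (rule inj_onI)
      fix b b' assume "b \<in> tangential_basepoints M" "b' \<in> tangential_basepoints M" and eq: "\<Phi> b = \<Phi> b'"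
      then obtain x c v x' c' v' where b: "b = (x, normal_vector M c x v)" "good x c v"
        and b': "b' = (x', normal_vector M c' x' v')" "good x' c' v'"
        using basepointE by metis
      have m: "basepoint_morphism M c x v = basepoint_morphism M c' x' v'"
        using eq \<Phi>[OF b(2)] \<Phi>[OF b'(2)] b(1) b'(1) by simp
      \<comment> \<open>The underlying map already determines \<open>x\<close>, so only the normal
        vectors over one point remain to be compared.\<close>
      then have "(\<lambda>_ :: unit. x) = (\<lambda>_. x')" unfolding basepoint_morphism_def by blast
      from fun_cong[OF this] have xx: "x' = x" by simp
      show "b = b'"
        using m normal_vector_eq_iff_morphism_eq[OF M top[OF b(2)]] b(2) b'(2)
        unfolding b(1) b'(1) xx good_def by metis
    qed
    show "\<Phi> ` tangential_basepoints M = virtual_morphisms point_log (basic_log M)"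
    proof
      show "\<Phi> ` tangential_basepoints M \<subseteq> virtual_morphisms point_log (basic_log M)"
      proof (rule image_subsetI)
        fix b assume "b \<in> tangential_basepoints M"
        then obtain x c v where b: "b = (x, normal_vector M c x v)" "good x c v" using basepointE by metis
        show "\<Phi> b \<in> virtual_morphisms point_log (basic_log M)"
          unfolding b(1) \<Phi>[OF b(2)] using basepoint_morphism_closed[OF M top[OF b(2)]] b(2)
          unfolding good_def by blast
      qed
      show "virtual_morphisms point_log (basic_log M) \<subseteq> \<Phi> ` tangential_basepoints M"
      proof (rule subrelI)
        fix \<phi> h assume "(\<phi>, h) \<in> virtual_morphisms point_log (basic_log M)"
        then obtain x c v where g: "good x c v" "(\<phi>, h) = basepoint_morphism M c x v"
          unfolding good_def by (rule virtual_morphism_cases[OF M]) blast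
        then show "(\<phi>, h) \<in> \<Phi> ` tangential_basepoints M"
          using \<Phi>[OF g(1)] basepointI[OF g(1)] by (metis imageI)
      qed
    qed
  qed
  have vals: "case \<Phi> (x, normal_vector M c x v) of (\<phi>, h) \<Rightarrow>
          \<phi> () = x \<and> (\<forall>i<cdim c. h UNIV (pulled_back_coord M \<phi> c i) =
             point_value (if i \<in> zero_coords c x then v i else coord c x i))"
    if c: "c \<in> atlas M" "x \<in> cdom c" and v: "\<forall>i\<in>zero_coords c x. 0 < v i" for c x v
  proof -
    have g: "good x c v" using c v by (simp add: good_def)
    have fst: "basepoint_morphism M c x v = (\<lambda>_. x, snd (basepoint_morphism M c x v))"
      by (simp add: basepoint_morphism_def)
    have "snd (basepoint_morphism M c x v) UNIV (pulled_back_coord M (\<lambda>_. x) c i) =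
        point_value (if i \<in> zero_coords c x then v i else coord c x i)" if i: "i < cdim c" for i
      using basepoint_morphism_coord(1)[OF M top[OF g] c v c i] basepoint_value_coord[OF M c v i]
      by (simp add: basepoint_coord_def)
    then show ?thesis unfolding \<Phi>[OF g] by (subst fst) simp
  qed
  show ?thesis
    by (intro exI[of _ \<Phi>] conjI ballI allI impI, rule bij, rule vals)
qed

end
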